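(* (i) $\mathfrak{L}(\mathbb{Q}^+)^w_{O(n)} \subsetneq \mathfrak{L}(SL(2,\mathbb{Q}))^w_{O(n)}$. (ii) $\mathfrak{L}(\mathbb{Z})^w_{O(n)} \subsetneq \mathfrak{L}(BS(1,2))^w_{O(n)}$ and $\mathfrak{L}(BS(1,2))^w_{O(n)}\not\subseteq\mathsf{CF}$. (iii) $\mathfrak{L}(SL(2,\mathbb{Z}))^w_{O(n)} \subsetneq \mathfrak{L}(SL(3,\mathbb{Z}))^w_{O(n)}$. (iv) $\mathfrak{L}(\mathbb{Z}^2)^w_{O(n)} \subsetneq \mathfrak{L}(\mathbf{H})^w_{O(n)}$. (v) For all $k\ge2$, $\mathsf{CF}$ and $\mathfrak{L}(\mathbb{Z}^k)^w_{O(n)}$ are incomparable. (vi) $\mathfrak{L}(SL(3,\mathbb{Z}))^w_{O(n)} = \mathfrak{L}(GL(3,\mathbb{Z}))^w_{O(n)}$. (vii) $\mathsf{REG} = \mathfrak{L}(\mathbf{F}_0)^w_{O(n)} \subsetneq \mathfrak{L}(\mathbf{F}_1)^w_{O(n)} = \mathfrak{L}(\mathbb{Z})^w_{O(n)} \subsetneq \mathfrak{L}(\mathbf{F}_2)^w_{O(n)}$.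
   Context: For a group $G$ with identity $e$, a $G$-automaton is a tuple $(Q,\Sigma,G,\delta,q_0,Q_a)$ where $Q$ is a finite set of states, $\Sigma$ a finite input alphabet, $q_0\in Q$ the initial state, $Q_a\subseteq Q$ the accepting states, and $\delta$ assigns to each $(q,\sigma)\in Q\times(\Sigma\cup\{\varepsilon\})$ a finite set of pairs $(q',m)\in Q\times G$. The register holds an element of $G$, initially $e$; using a transition $(q',m)\in\delta(q,\sigma)$ (one step) the automaton reads $\sigma$ (or nothing), moves to $q'$ and replaces the register content $x$ by $xm$. A word is accepted if some computation reads it entirely and ends in an accepting state with register equal to $e$. A $G$-automaton recognizing $\mathtt{L}$ is weakly $t(n)$ time-bounded if every $x\in\mathtt{L}$ with $|x|=n$ has an accepting computation of at most $t(n)$ steps; $\mathfrak{L}(G)^w_{O(n)}$ is the class of languages recognized by weakly $t(n)$ time-bounded $G$-automata for some $t(n)=O(n)$. Notation: $\mathbb{Q}^+$ is the multiplicative group of positive rationals; $SL(n,R)$ and $GL(n,\mathbb{Z})$ are the groups of $n\times n$ matrices over $R$ with determinant $1$, resp. integer matrices with determinant $\pm1$; $BS(1,2)=\langle a,b\mid bab^{-1}=a^2\rangle$; $\mathbf{H}$ is the discrete Heisenberg group of $3\times3$ upper unitriangular integer matrices; $\mathbb{Z}^k$ is the free Abelian group of rank $k$; $\mathbf{F}_r$ is the free group of rank $r$ ($\mathbf{F}_0$ trivial); $\mathsf{REG}$ and $\mathsf{CF}$ are the classes of regular and context-free languages. *)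

theory Defs
  imports "HOL-Analysis.Analysis" "HOL-Algebra.Algebra" "HOL-Library.Landau_Symbols"
begin

section \<open>G-automata\<close>

text \<open>A G-automaton. States are drawn from nat (any finite state set can be
renamed into nat); the input alphabet is a finite subset of the symbol type.
The transition function maps a state and either an input symbol (Some a) or
the empty word (None) to a finite set of pairs (next state, group element).\<close>

record ('a, 'g) gaut =
  states :: "nat set"
  alph   :: "'a set"
  trans  :: "nat \<Rightarrow> 'a option \<Rightarrow> (nat \<times> 'g) set"
  init   :: nat
  accst  :: "nat set"

definition valid_gaut :: "('g, 'b) monoid_scheme \<Rightarrow> ('a, 'g) gaut \<Rightarrow> bool" where
  "valid_gaut G A \<longleftrightarrow>
     finite (states A) \<and> finite (alph A) \<and> init A \<in> states A \<and> accst A \<subseteq> states A \<and>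
     (\<forall>q s. finite (trans A q s) \<and> trans A q s \<subseteq> states A \<times> carrier G) \<and>
     (\<forall>q s. q \<notin> states A \<longrightarrow> trans A q s = {}) \<and>
     (\<forall>q a. a \<notin> alph A \<longrightarrow> trans A q (Some a) = {})"

text \<open>grun G A q x w q' y n: starting in state q with register content x, the
automaton can read exactly the word w in n steps, ending in state q' with
register content y.\<close>

inductive grun :: "('g, 'b) monoid_scheme \<Rightarrow> ('a, 'g) gaut \<Rightarrow>
    nat \<Rightarrow> 'g \<Rightarrow> 'a list \<Rightarrow> nat \<Rightarrow> 'g \<Rightarrow> nat \<Rightarrow> bool"
  for G A where
  grun_nil: "grun G A q x [] q x 0"
| grun_eps: "(p, m) \<in> trans A q None \<Longrightarrow> grun G A p (x \<otimes>\<^bsub>G\<^esub> m) w q' y n \<Longrightarrow>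
             grun G A q x w q' y (Suc n)"
| grun_sym: "(p, m) \<in> trans A q (Some a) \<Longrightarrow> grun G A p (x \<otimes>\<^bsub>G\<^esub> m) w q' y n \<Longrightarrow>
             grun G A q x (a # w) q' y (Suc n)"

text \<open>accepting computation of length n\<close>
definition accepts_in :: "('g, 'b) monoid_scheme \<Rightarrow> ('a, 'g) gaut \<Rightarrow> 'a list \<Rightarrow> nat \<Rightarrow> bool" where
  "accepts_in G A w n \<longleftrightarrow> (\<exists>q \<in> accst A. grun G A (init A) \<one>\<^bsub>G\<^esub> w q \<one>\<^bsub>G\<^esub> n)"

definition gaut_lang :: "('g, 'b) monoid_scheme \<Rightarrow> ('a, 'g) gaut \<Rightarrow> 'a list set" where
  "gaut_lang G A = {w. \<exists>n. accepts_in G A w n}"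

definition weakly_time_bounded ::
    "('g, 'b) monoid_scheme \<Rightarrow> ('a, 'g) gaut \<Rightarrow> (nat \<Rightarrow> nat) \<Rightarrow> bool" where
  "weakly_time_bounded G A t \<longleftrightarrow>
     (\<forall>w \<in> gaut_lang G A. \<exists>n \<le> t (length w). accepts_in G A w n)"

text \<open>The class L(G)^w_{O(n)}; languages are sets of words over the symbol
type nat (each such language lives over a finite alphabet, namely alph A).\<close>
definition Lw_lin :: "('g, 'b) monoid_scheme \<Rightarrow> nat list set set" where
  "Lw_lin G = {L. \<exists>(A :: (nat, 'g) gaut) t. valid_gaut G A \<and> gaut_lang G A = L \<and>
        weakly_time_bounded G A t \<and> (\<lambda>n. real (t n)) \<in> O(\<lambda>n. real n)}"

section \<open>Regular and context-free languages\<close>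

definition REG :: "nat list set set" where
  "REG = {L. \<exists>(Q :: nat set) (\<Sigma> :: nat set) (\<delta> :: nat \<Rightarrow> nat \<Rightarrow> nat) q0 F.
      finite Q \<and> finite \<Sigma> \<and> q0 \<in> Q \<and> F \<subseteq> Q \<and> (\<forall>q\<in>Q. \<forall>a\<in>\<Sigma>. \<delta> q a \<in> Q) \<and>
      L = {w. set w \<subseteq> \<Sigma> \<and> fold (\<lambda>a q. \<delta> q a) w q0 \<in> F}}"

text \<open>Context-free grammars: nonterminals are nats, terminals are symbols;
a production is (A, rhs) with rhs a list of nonterminals (Inl) and terminals (Inr).
cfg_gen P \<alpha> w: the sentential form \<alpha> derives the terminal word w.\<close>
inductive cfg_gen :: "(nat \<times> (nat + 'a) list) set \<Rightarrow> (nat + 'a) list \<Rightarrow> 'a list \<Rightarrow> bool"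
  for P where
  cfg_nil: "cfg_gen P [] []"
| cfg_term: "cfg_gen P r w \<Longrightarrow> cfg_gen P (Inr a # r) (a # w)"
| cfg_nonterm: "(B, rhs) \<in> P \<Longrightarrow> cfg_gen P rhs u \<Longrightarrow> cfg_gen P r w \<Longrightarrow>
                cfg_gen P (Inl B # r) (u @ w)"

definition CF :: "nat list set set" where
  "CF = {L. \<exists>(P :: (nat \<times> (nat + nat) list) set) S. finite P \<and> L = {w. cfg_gen P [Inl S] w}}"

section \<open>The groups\<close>

text \<open>Positive rationals under multiplication.\<close>
definition Qpos_group :: "rat monoid" where
  "Qpos_group = \<lparr>carrier = {q. q > 0}, mult = (*), one = 1\<rparr>"

definition SL2Q :: "(rat^2^2) monoid" where
  "SL2Q = \<lparr>carrier = {A. det A = 1}, mult = (**), one = mat 1\<rparr>"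

definition SL2Z :: "(int^2^2) monoid" where
  "SL2Z = \<lparr>carrier = {A. det A = 1}, mult = (**), one = mat 1\<rparr>"

definition SL3Z :: "(int^3^3) monoid" where
  "SL3Z = \<lparr>carrier = {A. det A = 1}, mult = (**), one = mat 1\<rparr>"

definition GL3Z :: "(int^3^3) monoid" where
  "GL3Z = \<lparr>carrier = {A. det A = 1 \<or> det A = -1}, mult = (**), one = mat 1\<rparr>"

text \<open>Discrete Heisenberg group: 3x3 upper unitriangular integer matrices.\<close>
definition Heis :: "(int^3^3) monoid" where
  "Heis = \<lparr>carrier = {A. \<forall>i j. (j < i \<longrightarrow> A $ i $ j = 0) \<and> A $ i $ i = 1},
           mult = (**), one = mat 1\<rparr>"

text \<open>Free Abelian group of rank k: integer vectors indexed by {0..<k}.\<close>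
definition Zk :: "nat \<Rightarrow> (nat \<Rightarrow> int) monoid" where
  "Zk k = \<lparr>carrier = {f. \<forall>i\<ge>k. f i = 0}, mult = (\<lambda>f g i. f i + g i), one = (\<lambda>_. 0)\<rparr>"

text \<open>Free group of rank r: freely reduced words over the letters
(True, i) (generator i) and (False, i) (its inverse), i < r.\<close>
definition inv_letter :: "bool \<times> nat \<Rightarrow> bool \<times> nat" where
  "inv_letter l = (\<not> fst l, snd l)"

definition red_cons :: "bool \<times> nat \<Rightarrow> (bool \<times> nat) list \<Rightarrow> (bool \<times> nat) list" where
  "red_cons l ys = (case ys of [] \<Rightarrow> [l] | y # ys' \<Rightarrow> (if y = inv_letter l then ys' else l # ys))"

definition free_reduce :: "(bool \<times> nat) list \<Rightarrow> (bool \<times> nat) list" where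
  "free_reduce xs = foldr red_cons xs []"

definition freely_reduced :: "(bool \<times> nat) list \<Rightarrow> bool" where
  "freely_reduced w \<longleftrightarrow> (\<forall>i. Suc i < length w \<longrightarrow> w ! Suc i \<noteq> inv_letter (w ! i))"

definition free_group :: "nat \<Rightarrow> (bool \<times> nat) list monoid" where
  "free_group r = \<lparr>carrier = {w. freely_reduced w \<and> (\<forall>l \<in> set w. snd l < r)},
                   mult = (\<lambda>u v. free_reduce (u @ v)), one = []\<rparr>"

text \<open>BS(1,2) = <a, b | b a b^-1 = a^2>, as the quotient of the free group on
a = generator 0 and b = generator 1 by the normal closure of b a b^-1 a^-2.\<close>
definition BS12_relator :: "(bool \<times> nat) list" where
  "BS12_relator = [(True, 1), (True, 0), (False, 1), (False, 0), (False, 0)]"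

definition BS12 :: "(bool \<times> nat) list set monoid" where
  "BS12 = free_group 2 Mod
     generate (free_group 2)
       {g \<otimes>\<^bsub>free_group 2\<^esub> BS12_relator \<otimes>\<^bsub>free_group 2\<^esub> inv\<^bsub>free_group 2\<^esub> g | g.
          g \<in> carrier (free_group 2)}"

end

(*
For w and v over {0,1} consider the words w 2 rev(v) with f(w) = f(v), where f evaluates words in a
group. A two-state real-time G-automaton recognizes this language for evaluation in G. Conversely,
a weakly linear-time H-automaton that recognizes it must reach different configurations for
different values of f, but after reading n letters its register lies in a ball of radius O(n) of a
finitely generated subgroup of H. Comparing growth rates gives all separations except those about
context-free languages: free submonoids of rank two (exponential growth) against abelian groups, the
Heisenberg group (at least n^3) against Z^2, and Z against the trivial group.

The remaining separations use the pumping lemma for 0^n 1^n 2^n (recognized over Z^2) and for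
0^n 1^n 2^(2^n) (recognized over BS(1,2) because b^n a b^-n = a^(2^n)), together with the fact that
automata over SL(2,Z) accept only context-free languages. For the latter, a path in the Cayley
graph whose end is close to its start can be cut into two shorter paths of the same kind, by the
tree structure dual to the Farey tessellation; these cuts are the productions of a grammar.
*)
theory Submission
  imports Defs
begin

section \<open>Computations of G-automata\<close>

text \<open>Counting separates only groups of different growth. It is of no help for
  \<open>SL2Z\<close> against \<open>SL3Z\<close>, since both contain free submonoids of rank two
  and grow exponentially; this is why that separation goes through context-freeness. Nor does the
  crude bound for commutative monoids separate \<open>Zk 2\<close> from \<open>Heis\<close>: its
  exponent is the number of labels of the automaton, while the lower bound has exponent 3, so the
  exact exponent 2 has to be extracted. For \<open>BS12\<close> and \<open>free_group 2\<close> the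
  free submonoid is found in a common image, the affine maps of the rationals: products of t -> 2t
  and t -> 2t + 1 are binary expansions. Only a homomorphism out of the presentation is required,
  and distinct images certify distinct elements. In the Farey argument the obstacle is that a closed
  path may wander far from its start. What controls it is that the base edge separates the
  tessellation: a path that does not return to this edge stays on one side of it.\<close>

lemma grun_append:
  assumes "grun G A q x u p z n" "grun G A p z v q' y m"
  shows "grun G A q x (u @ v) q' y (n + m)"
  using assms by (induction arbitrary: rule: grun.induct) (auto intro: grun.intros)

lemma grun_split:
  assumes "grun G A q x (u @ v) q' y n"
  shows "\<exists>p z k m. n = k + m \<and> grun G A q x u p z k \<and> grun G A p z v q' y m"
  using assms
proof (induction q x "u @ v" q' y n arbitrary: u rule: grun.induct)
  case (grun_nil q x)
  then show ?case by (metis add_0 append_is_Nil_conv grun.grun_nil)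
next
  case (grun_eps p m q x q' y n)
  then obtain p' z k l where *: "n = k + l" "grun G A p (x \<otimes>\<^bsub>G\<^esub> m) u p' z k"
      "grun G A p' z v q' y l" by blast
  then have "grun G A q x u p' z (Suc k)" using grun_eps(1) by (blast intro: grun.intros)
  with * show ?case by (metis add_Suc)
next
  case (grun_sym p m q a x w q' y n)
  show ?case
  proof (cases u)
    case Nil
    then have "grun G A q x v q' y (Suc n)"
      using grun_sym by (metis append_Nil grun.grun_sym)
    then show ?thesis using Nil by (metis add_0 grun.grun_nil)
  next
    case (Cons b u')
    with grun_sym obtain p' z k l where *: "n = k + l" "grun G A p (x \<otimes>\<^bsub>G\<^esub> m) u' p' z k"
      "grun G A p' z v q' y l" by (metis append_Cons list.sel(3))
    moreover have "b = a" using Cons grun_sym.hyps by simp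
    ultimately have "grun G A q x u p' z (Suc k)" using grun_sym(1) Cons by (auto intro: grun.intros)
    with * show ?thesis by (metis add_Suc)
  qed
qed

lemma valid_gaut_transD:
  assumes "valid_gaut G A" "(p, m) \<in> trans A q s"
  shows "p \<in> states A" "m \<in> carrier G" "q \<in> states A" "\<And>a. s = Some a \<Longrightarrow> a \<in> alph A"
proof -
  have sub: "trans A q s \<subseteq> states A \<times> carrier G" using assms(1) unfolding valid_gaut_def by blast
  show "p \<in> states A" "m \<in> carrier G" using sub assms(2) by auto
  show "q \<in> states A" using assms unfolding valid_gaut_def by blast
  show "a \<in> alph A" if "s = Some a" for a using assms that unfolding valid_gaut_def by blast
qed

lemma grun_state:
  assumes "grun G A q x w q' y n" "valid_gaut G A" "q \<in> states A"
  shows "q' \<in> states A"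
  using assms by (induction rule: grun.induct) (auto dest: valid_gaut_transD)

lemma grun_carrier:
  assumes "grun G A q x w q' y n" "valid_gaut G A" "Group.monoid G" "x \<in> carrier G"
  shows "y \<in> carrier G"
  using assms
  by (induction rule: grun.induct) (auto dest: valid_gaut_transD intro: monoid.m_closed)

lemma grun_alph:
  assumes "grun G A q x w q' y n" "valid_gaut G A"
  shows "set w \<subseteq> alph A"
  using assms by (induction rule: grun.induct) (auto dest: valid_gaut_transD)

text \<open>Together with \<open>Lw_linE\<close> this trades O-notation for bounds of the form
  \<open>C * n + C\<close>. A Landau bound holds only eventually, and \<open>c * n\<close> vanishes
  at \<open>n = 0\<close>; the additive constant pays for the finitely many short words.\<close>

lemma Lw_linI:
  fixes A :: "(nat, 'g) gaut"
  assumes "valid_gaut G A" "\<And>w. w \<in> L \<Longrightarrow> \<exists>n \<le> C * length w + C. accepts_in G A w n"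
    and "\<And>w n. accepts_in G A w n \<Longrightarrow> w \<in> L"
  shows "L \<in> Lw_lin G"
proof -
  have L: "gaut_lang G A = L" using assms(2,3) unfolding gaut_lang_def by blast
  have "(\<lambda>n. real (C * n + C)) \<in> O(\<lambda>n. real n)"
  proof (rule bigoI)
    show "\<forall>\<^sub>F n in sequentially. norm (real (C * n + C)) \<le> real (2 * C) * norm (real n)"
      unfolding eventually_sequentially
    proof (intro exI allI impI)
      fix n :: nat assume "1 \<le> n"
      then have "C * n + C \<le> 2 * C * n" by (cases n) auto
      then have "real (C * n + C) \<le> real (2 * C * n)" by (simp only: of_nat_le_iff)
      then show "norm (real (C * n + C)) \<le> real (2 * C) * norm (real n)" by simp
    qed
  qed
  then show ?thesis using L assms(1,2) unfolding Lw_lin_def weakly_time_bounded_def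
    by (intro CollectI exI[of _ A] exI[of _ "\<lambda>n. C * n + C"]) auto
qed

lemma Lw_linE:
  assumes "L \<in> Lw_lin G"
  obtains A :: "(nat, 'g) gaut" and C where
    "valid_gaut G A" "gaut_lang G A = L" "\<forall>w\<in>L. \<exists>n \<le> C * length w + C. accepts_in G A w n"
proof -
  obtain A :: "(nat, 'g) gaut" and t where A: "valid_gaut G A" "gaut_lang G A = L"
      "weakly_time_bounded G A t" "(\<lambda>n. real (t n)) \<in> O(\<lambda>n. real n)"
    using assms unfolding Lw_lin_def by blast
  obtain c where "c > 0" "\<forall>\<^sub>F n in sequentially. norm (real (t n)) \<le> c * norm (real n)"
    using A(4) by (elim landau_o.bigE)
  then obtain N where N: "\<And>n. n \<ge> N \<Longrightarrow> real (t n) \<le> c * real n"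
    unfolding eventually_sequentially by auto
  define C where "C = nat \<lceil>c\<rceil> + Max (t ` {..N})"
  have le: "t n \<le> C * n + C" for n
  proof (cases "n \<ge> N")
    case True
    have "real (t n) \<le> c * real n" using N True by simp
    also have "\<dots> \<le> real (nat \<lceil>c\<rceil>) * real n" by (intro mult_right_mono real_nat_ceiling_ge) auto
    finally have "t n \<le> nat \<lceil>c\<rceil> * n" by (metis of_nat_le_iff of_nat_mult)
    then show ?thesis unfolding C_def by (simp add: algebra_simps)
  next
    case False
    then have "t n \<le> Max (t ` {..N})" by (intro Max_ge) auto
    then show ?thesis unfolding C_def by simp
  qed
  have "\<exists>n \<le> C * length w + C. accepts_in G A w n" if "w \<in> L" for w
    using A(2,3) le[of "length w"] that unfolding weakly_time_bounded_def
    by (meson order_trans)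
  then show thesis using that[OF A(1,2)] by blast
qed

text \<open>The register of the new automaton holds \<open>\<phi> x\<close>, and its finite control
  additionally stores \<open>\<kappa> x\<close>, a piece of information with finitely many values
  that can be updated from the label alone. Thus \<open>\<phi>\<close> may lose whatever finite
  information \<open>\<kappa>\<close> keeps, and every computation keeps its number of
  steps.\<close>

lemma Lw_lin_simulate:
  fixes G :: "('g, 'b) monoid_scheme" and H :: "('h, 'c) monoid_scheme"
    and \<kappa> :: "'g \<Rightarrow> nat" and \<tau> :: "nat \<Rightarrow> 'g \<Rightarrow> nat"
  assumes G: "Group.monoid G" and hom: "\<phi> \<in> hom G H" and one: "\<phi> \<one>\<^bsub>G\<^esub> = \<one>\<^bsub>H\<^esub>"
    and bound: "\<And>x. x \<in> carrier G \<Longrightarrow> \<kappa> x < K"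
    and step: "\<And>x m. x \<in> carrier G \<Longrightarrow> m \<in> carrier G \<Longrightarrow> \<kappa> (x \<otimes>\<^bsub>G\<^esub> m) = \<tau> (\<kappa> x) m"
    and \<tau>: "\<And>k m. k < K \<Longrightarrow> m \<in> carrier G \<Longrightarrow> \<tau> k m < K"
    and inj: "\<And>x. x \<in> carrier G \<Longrightarrow> \<phi> x = \<one>\<^bsub>H\<^esub> \<Longrightarrow> \<kappa> x = \<kappa> \<one>\<^bsub>G\<^esub> \<Longrightarrow> x = \<one>\<^bsub>G\<^esub>"
  shows "Lw_lin G \<subseteq> Lw_lin H"
proof
  fix L assume "L \<in> Lw_lin G"
  then obtain A :: "(nat, 'g) gaut" and C where A: "valid_gaut G A" "gaut_lang G A = L"
      "\<forall>w\<in>L. \<exists>n \<le> C * length w + C. accepts_in G A w n"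
    by (rule Lw_linE)
  interpret G: monoid G by (rule G)
  have K: "K > 0" using bound[OF G.one_closed] by simp
  \<comment> \<open>States are natural numbers, so the pair of a state and a value below
    \<open>K\<close> is packed by division with remainder.\<close>
  define e where "e q k = q * K + k" for q k :: nat
  have div: "e q k div K = q" and mod: "e q k mod K = k" if "k < K" for q k
    using that by (auto simp: e_def)
  define T where "T q s = (\<lambda>(p, m). (e p (\<tau> (q mod K) m), \<phi> m)) ` trans A (q div K) s" for q s
  define B where "B = \<lparr>states = case_prod e ` (states A \<times> {..<K}), alph = alph A, trans = T,
     init = e (init A) (\<kappa> \<one>\<^bsub>G\<^esub>), accst = (\<lambda>q. e q (\<kappa> \<one>\<^bsub>G\<^esub>)) ` accst A\<rparr>"
  have fwd: "grun H B (e q (\<kappa> x)) (\<phi> x) w (e q' (\<kappa> y)) (\<phi> y) n"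
    if "grun G A q x w q' y n" "x \<in> carrier G" for q x w q' y n
    using that
  proof (induction rule: grun.induct)
    case (grun_nil q x)
    then show ?case by (auto intro: grun.intros)
  next
    case (grun_eps p m q x w q' y n)
    have m: "m \<in> carrier G" using A(1) grun_eps(1) by (blast dest: valid_gaut_transD)
    have "(e p (\<kappa> (x \<otimes>\<^bsub>G\<^esub> m)), \<phi> m) \<in> trans B (e q (\<kappa> x)) None"
      using grun_eps m unfolding B_def T_def
      by (force simp: div mod bound step)
    moreover have "grun H B (e p (\<kappa> (x \<otimes>\<^bsub>G\<^esub> m))) (\<phi> x \<otimes>\<^bsub>H\<^esub> \<phi> m) w (e q' (\<kappa> y)) (\<phi> y) n"
      using grun_eps m hom_mult[OF hom, of x m] by simp
    ultimately show ?case by (rule grun.grun_eps)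
  next
    case (grun_sym p m q a x w q' y n)
    have m: "m \<in> carrier G" using A(1) grun_sym(1) by (blast dest: valid_gaut_transD)
    have "(e p (\<kappa> (x \<otimes>\<^bsub>G\<^esub> m)), \<phi> m) \<in> trans B (e q (\<kappa> x)) (Some a)"
      using grun_sym m unfolding B_def T_def
      by (force simp: div mod bound step)
    moreover have "grun H B (e p (\<kappa> (x \<otimes>\<^bsub>G\<^esub> m))) (\<phi> x \<otimes>\<^bsub>H\<^esub> \<phi> m) w (e q' (\<kappa> y)) (\<phi> y) n"
      using grun_sym m hom_mult[OF hom, of x m] by simp
    ultimately show ?case by (rule grun.grun_sym)
  qed
  have bwd: "\<exists>q' y. s' = e q' (\<kappa> y) \<and> y' = \<phi> y \<and> y \<in> carrier G \<and> grun G A q x w q' y n"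
    if "grun H B s z w s' y' n" "s = e q (\<kappa> x)" "z = \<phi> x" "x \<in> carrier G" for s z w s' y' n q x
    using that
  proof (induction arbitrary: q x rule: grun.induct)
    case (grun_nil s z)
    then show ?case by (auto intro: grun.intros)
  next
    case (grun_eps s1 m1 s z w s' y' n)
    obtain p m where pm: "(p, m) \<in> trans A q None" "s1 = e p (\<tau> (\<kappa> x) m)" "m1 = \<phi> m"
      using grun_eps.hyps(1) grun_eps.prems by (auto simp: B_def T_def div mod bound)
    have m: "m \<in> carrier G" using A(1) pm(1) by (blast dest: valid_gaut_transD)
    have "s1 = e p (\<kappa> (x \<otimes>\<^bsub>G\<^esub> m))" "z \<otimes>\<^bsub>H\<^esub> m1 = \<phi> (x \<otimes>\<^bsub>G\<^esub> m)"
      using pm m grun_eps.prems step hom_mult[OF hom, of x m] by auto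
    from grun_eps.IH[OF this] m grun_eps.prems pm(1) show ?case
      by (auto intro: grun.intros)
  next
    case (grun_sym s1 m1 s a z w s' y' n)
    obtain p m where pm: "(p, m) \<in> trans A q (Some a)" "s1 = e p (\<tau> (\<kappa> x) m)" "m1 = \<phi> m"
      using grun_sym.hyps(1) grun_sym.prems by (auto simp: B_def T_def div mod bound)
    have m: "m \<in> carrier G" using A(1) pm(1) by (blast dest: valid_gaut_transD)
    have "s1 = e p (\<kappa> (x \<otimes>\<^bsub>G\<^esub> m))" "z \<otimes>\<^bsub>H\<^esub> m1 = \<phi> (x \<otimes>\<^bsub>G\<^esub> m)"
      using pm m grun_sym.prems step hom_mult[OF hom, of x m] by auto
    from grun_sym.IH[OF this] m grun_sym.prems pm(1) show ?case
      by (auto intro: grun.intros)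
  qed
  have vB: "valid_gaut H B"
  proof -
    have fin: "finite (T q s)" for q s
      using A(1) unfolding T_def valid_gaut_def by blast
    have sub: "T q s \<subseteq> case_prod e ` (states A \<times> {..<K}) \<times> carrier H" for q s
    proof -
      have "(e p (\<tau> (q mod K) m), \<phi> m) \<in> case_prod e ` (states A \<times> {..<K}) \<times> carrier H"
        if "(p, m) \<in> trans A (q div K) s" for p m
        using valid_gaut_transD[OF A(1) that] \<tau>[of "q mod K" m] K hom_in_carrier[OF hom, of m]
        by force
      then show ?thesis unfolding T_def by auto
    qed
    have empty: "T q s = {}" if "q \<notin> case_prod e ` (states A \<times> {..<K})" for q s
    proof (rule ccontr)
      assume "T q s \<noteq> {}"
      then have "q div K \<in> states A"
        using A(1) unfolding T_def valid_gaut_def by blast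
      moreover have "q = e (q div K) (q mod K)" unfolding e_def by simp
      moreover have "q mod K < K" using K by simp
      ultimately have "q \<in> case_prod e ` (states A \<times> {..<K})" by force
      then show False using that by simp
    qed
    have "T q (Some a) = {}" if "a \<notin> alph A" for q a
      using A(1) that unfolding T_def valid_gaut_def by simp
    then show ?thesis using A(1) fin sub empty bound[OF G.one_closed] K
      unfolding valid_gaut_def B_def by auto
  qed
  have acc: "accepts_in H B w n \<longleftrightarrow> accepts_in G A w n" for w n
  proof
    assume "accepts_in G A w n"
    then obtain q where q: "q \<in> accst A" "grun G A (init A) \<one>\<^bsub>G\<^esub> w q \<one>\<^bsub>G\<^esub> n"
      unfolding accepts_in_def by blast
    from fwd[OF q(2)] q(1) show "accepts_in H B w n"
      unfolding accepts_in_def by (auto simp: B_def one)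
  next
    assume "accepts_in H B w n"
    then obtain q where q: "q \<in> accst A"
        "grun H B (e (init A) (\<kappa> \<one>\<^bsub>G\<^esub>)) \<one>\<^bsub>H\<^esub> w (e q (\<kappa> \<one>\<^bsub>G\<^esub>)) \<one>\<^bsub>H\<^esub> n"
      unfolding accepts_in_def by (auto simp: B_def)
    from bwd[OF q(2) refl one[symmetric]] obtain q' y where y: "e q (\<kappa> \<one>\<^bsub>G\<^esub>) = e q' (\<kappa> y)"
        "\<one>\<^bsub>H\<^esub> = \<phi> y" "y \<in> carrier G" "grun G A (init A) \<one>\<^bsub>G\<^esub> w q' y n" by auto
    have "q = q'" "\<kappa> y = \<kappa> \<one>\<^bsub>G\<^esub>"
      using y(1,3) div mod bound[OF G.one_closed] bound[of y] by metis+
    with y q(1) inj[of y] show "accepts_in G A w n" unfolding accepts_in_def by auto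
  qed
  show "L \<in> Lw_lin H"
    by (rule Lw_linI[OF vB, of _ C]) (use A(2,3) in \<open>auto simp: acc gaut_lang_def\<close>)
qed

lemma Lw_lin_embed:
  assumes "Group.monoid G" "\<phi> \<in> hom G H" "\<phi> \<one>\<^bsub>G\<^esub> = \<one>\<^bsub>H\<^esub>"
    and "\<And>x. x \<in> carrier G \<Longrightarrow> \<phi> x = \<one>\<^bsub>H\<^esub> \<Longrightarrow> x = \<one>\<^bsub>G\<^esub>"
  shows "Lw_lin G \<subseteq> Lw_lin H"
  by (rule Lw_lin_simulate[where \<kappa> = "\<lambda>_. 0" and K = 1 and \<tau> = "\<lambda>_ _. 0", OF assms(1-3)])
     (use assms(4) in auto)

section \<open>Counting configurations\<close>

primrec ball_of :: "('g, 'b) monoid_scheme \<Rightarrow> 'g set \<Rightarrow> nat \<Rightarrow> 'g set" where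
  "ball_of G M 0 = {\<one>\<^bsub>G\<^esub>}"
| "ball_of G M (Suc n) = ball_of G M n \<union> (\<lambda>(x, m). x \<otimes>\<^bsub>G\<^esub> m) ` (ball_of G M n \<times> M)"

lemma finite_ball_of: "finite M \<Longrightarrow> finite (ball_of G M n)"
  by (induction n) auto

lemma ball_of_mono: "m \<le> n \<Longrightarrow> ball_of G M m \<subseteq> ball_of G M n"
  by (induction rule: dec_induct) auto

lemma ball_of_carrier:
  assumes "Group.monoid G" "M \<subseteq> carrier G"
  shows "ball_of G M n \<subseteq> carrier G"
proof -
  interpret monoid G by fact
  show ?thesis using assms(2) by (induction n) auto
qed

lemma grun_ball_of:
  assumes "grun G A q x w q' y n" "\<And>q s. snd ` trans A q s \<subseteq> M" "x \<in> ball_of G M k"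
  shows "y \<in> ball_of G M (k + n)"
  using assms
proof (induction arbitrary: k rule: grun.induct)
  case (grun_eps p m q x w q' y n)
  have "m \<in> M" using grun_eps by force
  then have "x \<otimes>\<^bsub>G\<^esub> m \<in> ball_of G M (Suc k)" using grun_eps.prems by force
  from grun_eps.IH[OF grun_eps.prems(1) this] show ?case by simp
next
  case (grun_sym p m q a x w q' y n)
  have "m \<in> M" using grun_sym by force
  then have "x \<otimes>\<^bsub>G\<^esub> m \<in> ball_of G M (Suc k)" using grun_sym.prems by force
  from grun_sym.IH[OF grun_sym.prems(1) this] show ?case by simp
qed simp

text \<open>Finitely many labels confine the register to a finitely generated submonoid. This makes
  balls finite even over a group like \<open>Qpos_group\<close> that is not finitely
  generated.\<close>

lemma valid_gaut_labels:
  fixes A :: "('a, 'g) gaut"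
  assumes "valid_gaut G A"
  obtains M where "finite M" "M \<subseteq> carrier G" "\<And>q s. snd ` trans A q s \<subseteq> M"
proof
  let ?M = "\<Union>q\<in>states A. \<Union>s\<in>insert None (Some ` alph A). snd ` trans A q s"
  show "finite ?M" using assms unfolding valid_gaut_def by auto
  show "?M \<subseteq> carrier G" using valid_gaut_transD[OF assms] by force
  show "snd ` trans A q s \<subseteq> ?M" for q s
  proof
    fix x assume "x \<in> snd ` trans A q s"
    then obtain p where p: "(p, x) \<in> trans A q s" by auto
    have "s \<in> insert None (Some ` alph A)"
      using valid_gaut_transD(4)[OF assms p] by (cases s) auto
    then show "x \<in> ?M" using valid_gaut_transD(3)[OF assms p] p by force
  qed
qed

text \<open>The second half is reversed because the inverse of a product is the product of the
  inverses in reverse order, so an automaton can cancel \<open>v\<close> while reading it. The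
  separator 2 makes the two halves unique.\<close>

definition mirror :: "(nat list \<Rightarrow> 'x) \<Rightarrow> nat list set" where
  "mirror f = {w @ 2 # rev v | w v. set w \<subseteq> {0, 1} \<and> set v \<subseteq> {0, 1} \<and> f w = f v}"

lemma mirror_iff:
  assumes "set w \<subseteq> {0, 1}" "set v \<subseteq> {0, 1}"
  shows "w @ 2 # rev v \<in> mirror f \<longleftrightarrow> f w = f v"
proof
  assume "w @ 2 # rev v \<in> mirror f"
  then obtain w' v' where *: "w @ 2 # rev v = w' @ 2 # rev v'" "set w' \<subseteq> {0, 1}"
      "set v' \<subseteq> {0, 1}" "f w' = f v'"
    unfolding mirror_def mem_Collect_eq by (elim exE conjE)
  have "2 \<notin> set w" "2 \<notin> set w'" "2 \<notin> set (rev v)" "2 \<notin> set (rev v')"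
    using assms *(2,3) by auto
  then have "w = w' \<and> rev v = rev v'"
    using *(1) append_Cons_eq_iff[of 2 w "rev v" w' "rev v'"] by blast
  with * show "f w = f v" by simp
next
  assume "f w = f v"
  then show "w @ 2 # rev v \<in> mirror f" unfolding mirror_def mem_Collect_eq using assms
    by (intro exI conjI) (rule refl)
qed

text \<open>After reading the first half of a word of a mirror language, the configuration has to
determine the value of \<open>f\<close>, yet in linear time only a ball of linear radius is reached.\<close>
lemma mirror_count:
  fixes H :: "('h, 'b) monoid_scheme"
  assumes "mirror f \<in> Lw_lin H"
  obtains M c where "finite M" "M \<subseteq> carrier H"
    "\<And>n W. \<lbrakk>\<And>w. w \<in> W \<Longrightarrow> set w \<subseteq> {0, 1} \<and> length w \<le> n; inj_on f W\<rbrakk>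
       \<Longrightarrow> card W \<le> c * card (ball_of H M (c * (n + 1)))"
proof -
  obtain A :: "(nat, 'h) gaut" and C where A: "valid_gaut H A" "gaut_lang H A = mirror f"
      "\<forall>w\<in>mirror f. \<exists>n \<le> C * length w + C. accepts_in H A w n"
    using assms by (rule Lw_linE)
  obtain M where M: "finite M" "M \<subseteq> carrier H" "\<And>q s. snd ` trans A q s \<subseteq> M"
    using valid_gaut_labels[OF A(1)] by blast
  \<comment> \<open>A word \<open>w @ 2 # rev w\<close> has length \<open>2 * length w + 1\<close>,
    so its run takes at most \<open>2 * C * (length w + 1)\<close> steps. Adding
    \<open>card (states A)\<close> lets the same constant bound the number of states.\<close>
  define c where "c = 2 * C + card (states A)"
  show thesis
  proof (rule that[OF M(1,2), of c])
    fix n W assume W: "\<And>w. w \<in> W \<Longrightarrow> set w \<subseteq> {0, 1} \<and> length w \<le> n" and inj: "inj_on f W"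
    let ?B = "ball_of H M (c * (n + 1))"
    let ?P = "\<lambda>w (q, y). (q, y) \<in> states A \<times> ?B \<and> (\<exists>k l. \<exists>q'\<in>accst A.
        grun H A (init A) \<one>\<^bsub>H\<^esub> w q y k \<and> grun H A q y (2 # rev w) q' \<one>\<^bsub>H\<^esub> l)"
    have "\<exists>z. ?P w z" if w: "w \<in> W" for w
    proof -
      have "w @ 2 # rev w \<in> mirror f" using W[OF w] mirror_iff by blast
      then obtain m where m: "m \<le> C * length (w @ 2 # rev w) + C" "accepts_in H A (w @ 2 # rev w) m"
        using A(3) by blast
      then obtain q' where q': "q' \<in> accst A" "grun H A (init A) \<one>\<^bsub>H\<^esub> (w @ 2 # rev w) q' \<one>\<^bsub>H\<^esub> m"
        unfolding accepts_in_def by blast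
      from grun_split[OF q'(2)] obtain q y k l where *: "m = k + l"
          "grun H A (init A) \<one>\<^bsub>H\<^esub> w q y k" "grun H A q y (2 # rev w) q' \<one>\<^bsub>H\<^esub> l"
        by blast
      have "y \<in> ball_of H M (0 + k)" by (rule grun_ball_of[OF *(2) M(3)]) auto
      moreover have "k \<le> c * (n + 1)"
      proof -
        have "k \<le> C * (2 * length w + 1) + C" using m(1) *(1) by (simp add: algebra_simps)
        also have "\<dots> = 2 * C * (length w + 1)" by (simp add: algebra_simps)
        also have "\<dots> \<le> c * (n + 1)" using W[OF w] unfolding c_def by (intro mult_mono) auto
        finally show ?thesis .
      qed
      ultimately have "y \<in> ?B" using ball_of_mono[of k "c * (n + 1)" H M] by auto
      moreover have "q \<in> states A"
        using grun_state[OF *(2) A(1)] A(1) unfolding valid_gaut_def by blast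
      ultimately show ?thesis using * q'(1) by auto
    qed
    then have g: "?P w (SOME z. ?P w z)" if "w \<in> W" for w
      by (rule someI_ex) (rule that)
    define g where "g w = (SOME z. ?P w z)" for w
    note g = g[folded g_def]
    \<comment> \<open>Two words with the same middle configuration may exchange their second halves:
      the start of the run on \<open>w\<close> followed by the end of the run on \<open>v\<close>
      accepts \<open>w @ 2 # rev v\<close>, which forces \<open>f w = f v\<close>.\<close>
    have "inj_on g W"
    proof (rule inj_onI)
      fix w v assume wv: "w \<in> W" "v \<in> W" "g w = g v"
      obtain q y where qy: "g w = (q, y)" by fastforce
      obtain k where k: "grun H A (init A) \<one>\<^bsub>H\<^esub> w q y k" using g[OF wv(1)] qy by auto
      obtain l q' where l: "grun H A q y (2 # rev v) q' \<one>\<^bsub>H\<^esub> l" "q' \<in> accst A"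
        using g[OF wv(2)] wv(3) qy by auto
      have "accepts_in H A (w @ 2 # rev v) (k + l)"
        unfolding accepts_in_def using grun_append[OF k l(1)] l(2) by blast
      then have "w @ 2 # rev v \<in> mirror f" using A(2) unfolding gaut_lang_def by blast
      then have "f w = f v" using mirror_iff W wv(1,2) by blast
      then show "w = v" using inj wv(1,2) by (auto dest: inj_onD)
    qed
    moreover have "g ` W \<subseteq> states A \<times> ?B" using g by fastforce
    moreover have "finite (states A \<times> ?B)"
      using A(1) unfolding valid_gaut_def
      by (intro finite_cartesian_product finite_ball_of M(1)) blast
    ultimately have "card W \<le> card (states A \<times> ?B)" by (rule card_inj_on_le)
    also have "\<dots> \<le> c * card ?B" unfolding c_def card_cartesian_product
      by (intro mult_right_mono) auto
    finally show "card W \<le> c * card ?B" .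
  qed
qed

text \<open>Commutativity collects all factors \<open>a\<close> in front, so an element of the ball
  is a power \<open>a^i\<close> with \<open>i <= n\<close> times an element of the ball over the
  remaining labels. Each label therefore contributes one factor \<open>n + 1\<close>.\<close>

lemma card_ball_of_comm_monoid:
  assumes "comm_monoid G" "finite M" "M \<subseteq> carrier G"
  shows "card (ball_of G M n) \<le> (n + 1) ^ card M"
proof -
  interpret comm_monoid G by fact
  show ?thesis using assms(2,3)
  proof (induction M arbitrary: n rule: finite_induct)
    case empty
    have "ball_of G {} n = {\<one>\<^bsub>G\<^esub>}" by (induction n) auto
    then show ?case by simp
  next
    case (insert a M)
    let ?h = "\<lambda>(i, y). a [^]\<^bsub>G\<^esub> (i :: nat) \<otimes>\<^bsub>G\<^esub> y"
    have cX: "ball_of G M m \<subseteq> carrier G" for m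
      using insert ball_of_carrier[OF monoid_axioms] by auto
    have "ball_of G (insert a M) n \<subseteq> ?h ` ({..n} \<times> ball_of G M n)"
    proof (induction n)
      case (Suc n)
      show ?case
      proof
        fix z assume "z \<in> ball_of G (insert a M) (Suc n)"
        then consider "z \<in> ball_of G (insert a M) n"
          | x m where "z = x \<otimes>\<^bsub>G\<^esub> m" "x \<in> ball_of G (insert a M) n" "m \<in> insert a M"
          by auto
        then show "z \<in> ?h ` ({..Suc n} \<times> ball_of G M (Suc n))"
        proof cases
          case 1
          then show ?thesis using Suc by fastforce
        next
          case 2
          then obtain i y where iy: "i \<le> n" "y \<in> ball_of G M n" "x = a [^]\<^bsub>G\<^esub> i \<otimes>\<^bsub>G\<^esub> y"
            using Suc by fastforce
          have y: "y \<in> carrier G" and a: "a \<in> carrier G" using cX iy insert by auto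
          show ?thesis
          proof (cases "m = a")
            case True
            have "z = ?h (Suc i, y)" using y a 2 iy True by (simp add: m_ac)
            then show ?thesis using iy by (intro image_eqI[of _ _ "(Suc i, y)"]) auto
          next
            case False
            then have m: "m \<in> M" "m \<in> carrier G" using 2 insert by auto
            have "z = ?h (i, y \<otimes>\<^bsub>G\<^esub> m)" using y a m 2 iy by (simp add: m_ac)
            moreover have "y \<otimes>\<^bsub>G\<^esub> m \<in> ball_of G M (Suc n)" using iy m by force
            ultimately show ?thesis using iy by (intro image_eqI[of _ _ "(i, y \<otimes>\<^bsub>G\<^esub> m)"]) auto
          qed
        qed
      qed
    qed auto
    then have "card (ball_of G (insert a M) n) \<le> card ({..n} \<times> ball_of G M n)"
      by (intro surj_card_le finite_cartesian_product finite_ball_of insert.hyps) auto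
    also have "\<dots> \<le> (n + 1) * (n + 1) ^ card M"
      unfolding card_cartesian_product using insert by (intro mult_mono) auto
    finally show ?case using insert by simp
  qed
qed

section \<open>Exponential against polynomial growth\<close>

lemma card_binary_words: "card {w :: nat list. set w \<subseteq> {0, 1} \<and> length w = n} = 2 ^ n"
  by (subst card_lists_length_eq) (auto simp: numeral_2_eq_2)

lemma exp_beats_poly: "\<exists>n. c * (c * (n + 1) + 1) ^ d < (2 :: nat) ^ n"
proof -
  \<comment> \<open>With \<open>n = 2 ^ k\<close> the left side is below
    \<open>2 ^ (b + k * d)\<close>, where \<open>b\<close> gathers the part of the exponent that is
    free of \<open>k\<close>. The choice of \<open>j\<close> gives
    \<open>b + k * d <= j * j\<close>, and \<open>j * j <= 2 ^ j * 2 ^ j = n\<close>.\<close>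
  define b where "b = c + (c + 2) * d"
  define j where "j = 2 * d + b + 1"
  define k where "k = 2 * j"
  define n :: nat where "n = 2 ^ k"
  have c: "c < 2 ^ c" by (rule less_exp)
  have "c * (n + 1) + 1 \<le> 2 ^ c * (2 * n) + 2 ^ c * n"
    using c by (intro add_mono mult_mono) (auto simp: n_def)
  also have "\<dots> \<le> 2 ^ (c + 2 + k)" by (simp add: n_def power_add)
  finally have *: "c * (n + 1) + 1 \<le> 2 ^ (c + 2 + k)" .
  have "c * (c * (n + 1) + 1) ^ d < 2 ^ c * (2 ^ (c + 2 + k)) ^ d"
    using c * by (intro mult_less_le_imp_less power_mono) auto
  also have "\<dots> = 2 ^ (b + k * d)"
    unfolding power_mult[symmetric] power_add[symmetric] b_def
    by (rule arg_cong[of _ _ "\<lambda>x. 2 ^ x"]) (simp add: algebra_simps)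
  also have "\<dots> \<le> 2 ^ n"
  proof (rule power_increasing)
    have "b + k * d \<le> j * j" unfolding k_def by (simp add: j_def algebra_simps)
    also have "\<dots> \<le> 2 ^ j * 2 ^ j" by (intro mult_mono) (auto simp: less_imp_le)
    also have "\<dots> = n" by (simp add: n_def k_def mult_2 power_add)
    finally show "b + k * d \<le> n" .
  qed simp
  finally show ?thesis by blast
qed

lemma mirror_not_comm:
  assumes "comm_monoid G" "\<And>n. inj_on f {w. set w \<subseteq> {0, 1} \<and> length w = n}"
  shows "mirror f \<notin> Lw_lin G"
proof
  assume "mirror f \<in> Lw_lin G"
  then obtain M c where M: "finite M" "M \<subseteq> carrier G"
    "\<And>n W. \<lbrakk>\<And>w. w \<in> W \<Longrightarrow> set w \<subseteq> {0, 1} \<and> length w \<le> n; inj_on f W\<rbrakk>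
       \<Longrightarrow> card W \<le> c * card (ball_of G M (c * (n + 1)))"
    by (rule mirror_count) blast
  obtain n where n: "c * (c * (n + 1) + 1) ^ card M < 2 ^ n" using exp_beats_poly by blast
  have "2 ^ n \<le> c * card (ball_of G M (c * (n + 1)))"
    using M(3)[of "{w. set w \<subseteq> {0, 1} \<and> length w = n}" n] assms(2)
    by (simp only: card_binary_words mem_Collect_eq) blast
  also have "\<dots> \<le> c * (c * (n + 1) + 1) ^ card M"
    using card_ball_of_comm_monoid[OF assms(1) M(1,2)] by simp
  finally show False using n by simp
qed

section \<open>Real-time automata and mirror languages\<close>

text \<open>Deterministic automata without empty moves, run as a partial function. All languages
  that are shown to be recognizable by an explicit automaton use this form, so that acceptance
  becomes an equation instead of an existential statement about computations.\<close>

primrec drun :: "('g, 'b) monoid_scheme \<Rightarrow> (nat \<Rightarrow> nat \<Rightarrow> (nat \<times> 'g) option) \<Rightarrow>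
    nat \<Rightarrow> 'g \<Rightarrow> nat list \<Rightarrow> (nat \<times> 'g) option" where
  "drun G e q x [] = Some (q, x)" for q x
| "drun G e q x (a # w) = (case e q a of None \<Rightarrow> None | Some (p, m) \<Rightarrow> drun G e p (x \<otimes>\<^bsub>G\<^esub> m) w)"

lemma Lw_lin_realtime:
  fixes G :: "('g, 'b) monoid_scheme"
  assumes "finite Q" "finite \<Sigma>" "q0 \<in> Q" "F \<subseteq> Q"
    and e: "\<And>q a p m. e q a = Some (p, m) \<Longrightarrow> q \<in> Q \<and> a \<in> \<Sigma> \<and> p \<in> Q \<and> m \<in> carrier G"
  shows "{w. \<exists>q\<in>F. drun G e q0 \<one>\<^bsub>G\<^esub> w = Some (q, \<one>\<^bsub>G\<^esub>)} \<in> Lw_lin G"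
proof -
  define T where "T q s = (case s of None \<Rightarrow> {} | Some a \<Rightarrow> set_option (e q a))" for q s
  define A where "A = \<lparr>states = Q, alph = \<Sigma>, trans = T, init = q0, accst = F\<rparr>"
  have T: "finite (T q s)" "T q s \<subseteq> Q \<times> carrier G" for q s
    using e by (auto simp: T_def split: option.splits)
  have T0: "q \<notin> Q \<Longrightarrow> T q s = {}" "a \<notin> \<Sigma> \<Longrightarrow> T q (Some a) = {}" for q s a
    using e by (fastforce simp: T_def split: option.splits)+
  have valid: "valid_gaut G A"
    using assms(1-4) T T0 unfolding valid_gaut_def A_def by auto
  have "n = length w \<and> drun G e q x w = Some (q', y)" if "grun G A q x w q' y n" for q x w q' y n
    using that by (induction rule: grun.induct) (auto simp: A_def T_def)
  moreover have "grun G A q x w q' y (length w)" if "drun G e q x w = Some (q', y)" for q x w q' y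
    using that
  proof (induction w arbitrary: q x)
    case (Cons a w)
    then show ?case
      by (auto simp: A_def T_def split: option.splits intro: grun.intros)
  qed (auto intro: grun.intros)
  ultimately have iff: "grun G A q x w q' y n \<longleftrightarrow> n = length w \<and> drun G e q x w = Some (q', y)"
    for q x w q' y n by blast
  show ?thesis
    by (rule Lw_linI[OF valid, of _ 1]) (auto simp: accepts_in_def iff, auto simp: A_def)
qed

section \<open>Products along words and the recognition of mirror languages\<close>

primrec word_prod :: "('g, 'b) monoid_scheme \<Rightarrow> ('a \<Rightarrow> 'g) \<Rightarrow> 'a list \<Rightarrow> 'g" where
  "word_prod G g [] = \<one>\<^bsub>G\<^esub>"
| "word_prod G g (c # w) = g c \<otimes>\<^bsub>G\<^esub> word_prod G g w"

context monoid
begin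

lemma word_prod_closed [simp]: "(\<And>c. c \<in> set w \<Longrightarrow> g c \<in> carrier G) \<Longrightarrow> word_prod G g w \<in> carrier G"
  by (induction w) auto

lemma word_prod_append:
  "(\<And>c. c \<in> set u \<union> set v \<Longrightarrow> g c \<in> carrier G) \<Longrightarrow>
     word_prod G g (u @ v) = word_prod G g u \<otimes> word_prod G g v"
  by (induction u) (auto simp: m_assoc)

lemma word_prod_inverse:
  assumes "\<And>c. g c \<in> carrier G" "\<And>c. h c \<in> carrier G" "\<And>c. g c \<otimes> h c = \<one>"
  shows "word_prod G g (rev v) \<otimes> word_prod G h v = \<one>"
proof (induction v)
  case (Cons c v)
  have "word_prod G g (rev (c # v)) \<otimes> word_prod G h (c # v)
      = word_prod G g (rev v) \<otimes> (g c \<otimes> h c) \<otimes> word_prod G h v"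
    using assms(1,2) by (simp add: word_prod_append m_assoc)
  then show ?case using Cons assms by simp
qed simp

end

text \<open>State 0 multiplies by \<open>g\<close> before the separator and state 1 by
  \<open>h\<close> after it. The inverses are supplied by \<open>h\<close>, so that \<open>G\<close>
  may be given as a monoid; the matrix groups enter in this way.\<close>

lemma mirror_in_Lw_lin:
  fixes G :: "('a, 'b) monoid_scheme" (structure)
  assumes "Group.monoid G" and g: "\<And>c. g c \<in> carrier G" and h: "\<And>c. h c \<in> carrier G"
    and gh: "\<And>c. g c \<otimes>\<^bsub>G\<^esub> h c = \<one>\<^bsub>G\<^esub>" and hg: "\<And>c. h c \<otimes>\<^bsub>G\<^esub> g c = \<one>\<^bsub>G\<^esub>"
  shows "mirror (word_prod G g) \<in> Lw_lin G"
proof -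
  interpret monoid G by fact
  define e :: "nat \<Rightarrow> nat \<Rightarrow> (nat \<times> 'a) option" where "e q a = (if q = 0 \<and> a \<in> {0, 1} then Some (0, g a) else
      if q = 0 \<and> a = 2 then Some (1, \<one>) else
      if q = 1 \<and> a \<in> {0, 1} then Some (1, h a) else None)" for q a
  have run1: "drun G e 1 x w = Some (q', y) \<longleftrightarrow> q' = 1 \<and> set w \<subseteq> {0, 1} \<and> y = x \<otimes> word_prod G h w"
    if "x \<in> carrier G" for x w q' y
    using that
  proof (induction w arbitrary: x)
    case (Cons a w)
    show ?case
    proof (cases "a \<in> {0, 1}")
      case True
      then have "e 1 a = Some (1, h a)" unfolding e_def by auto
      then show ?thesis using Cons True h by (simp add: m_assoc)
    next
      case False
      then have "e 1 a = None" unfolding e_def by auto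
      then show ?thesis using False by simp
    qed
  qed auto
  have run0: "drun G e 0 x w = Some (1, y) \<longleftrightarrow> (\<exists>u v. w = u @ 2 # v \<and> set u \<subseteq> {0, 1} \<and>
      set v \<subseteq> {0, 1} \<and> y = x \<otimes> (word_prod G g u \<otimes> word_prod G h v))"
    (is "_ \<longleftrightarrow> ?R x w") if "x \<in> carrier G" for x w y
    using that
  proof (induction w arbitrary: x)
    case (Cons a w)
    consider "a \<in> {0, 1}" | "a = 2" | "a \<notin> {0, 1, 2}" by blast
    then show ?case
    proof cases
      case 1
      then have "e 0 a = Some (0, g a)" unfolding e_def by auto
      then have "drun G e 0 x (a # w) = Some (1, y) \<longleftrightarrow> ?R (x \<otimes> g a) w"
        using Cons g by simp
      also have "\<dots> \<longleftrightarrow> ?R x (a # w)"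
      proof
        assume "?R (x \<otimes> g a) w"
        then obtain u v where "w = u @ 2 # v" "set u \<subseteq> {0, 1}" "set v \<subseteq> {0, 1}"
            "y = (x \<otimes> g a) \<otimes> (word_prod G g u \<otimes> word_prod G h v)" by blast
        then show "?R x (a # w)" using 1 Cons.prems g h
          by (intro exI[of _ "a # u"] exI[of _ v]) (auto simp: m_assoc)
      next
        assume "?R x (a # w)"
        then obtain u v where uv: "a # w = u @ 2 # v" "set u \<subseteq> {0, 1}" "set v \<subseteq> {0, 1}"
            "y = x \<otimes> (word_prod G g u \<otimes> word_prod G h v)" by blast
        with 1 obtain u' where u': "u = a # u'" by (cases u) auto
        show "?R (x \<otimes> g a) w" using uv Cons.prems g h unfolding u'
          by (intro exI[of _ u'] exI[of _ v]) (auto simp: m_assoc)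
      qed
      finally show ?thesis .
    next
      case 2
      then have "e 0 a = Some (1, \<one>)" unfolding e_def by auto
      then have "drun G e 0 x (a # w) = Some (1, y) \<longleftrightarrow> set w \<subseteq> {0, 1} \<and> y = x \<otimes> word_prod G h w"
        using run1[of x w] Cons.prems by simp
      also have "\<dots> \<longleftrightarrow> ?R x (a # w)"
      proof
        assume "set w \<subseteq> {0, 1} \<and> y = x \<otimes> word_prod G h w"
        then show "?R x (a # w)" using 2 h
          by (intro exI[of _ "[]"] exI[of _ w]) auto
      next
        assume "?R x (a # w)"
        then obtain u v where uv: "a # w = u @ 2 # v" "set u \<subseteq> {0, 1}" "set v \<subseteq> {0, 1}"
            "y = x \<otimes> (word_prod G g u \<otimes> word_prod G h v)" by blast
        with 2 have "u = []" by (cases u) auto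
        with uv h show "set w \<subseteq> {0, 1} \<and> y = x \<otimes> word_prod G h w" by simp
      qed
      finally show ?thesis .
    next
      case 3
      then have "e 0 a = None" unfolding e_def by auto
      moreover have "\<not> ?R x (a # w)" using 3 by (auto simp: Cons_eq_append_conv)
      ultimately show ?thesis by simp
    qed
  qed auto
  have inv: "word_prod G g u \<otimes> word_prod G h v = \<one> \<longleftrightarrow> word_prod G g u = word_prod G g (rev v)"
    for u v
  proof
    assume *: "word_prod G g u \<otimes> word_prod G h v = \<one>"
    have "word_prod G g u = word_prod G g u \<otimes> (word_prod G h v \<otimes> word_prod G g (rev v))"
      using word_prod_inverse[of h g "rev v"] g h hg by simp
    also have "\<dots> = (word_prod G g u \<otimes> word_prod G h v) \<otimes> word_prod G g (rev v)"
      using g h by (simp add: m_assoc)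
    finally show "word_prod G g u = word_prod G g (rev v)" using * g by simp
  qed (use word_prod_inverse[of g h v] g h gh in simp)
  have "drun G e 0 \<one> w = Some (1, \<one>) \<longleftrightarrow> w \<in> mirror (word_prod G g)" for w
  proof -
    have "drun G e 0 \<one> w = Some (1, \<one>) \<longleftrightarrow> (\<exists>u v. w = u @ 2 # v \<and> set u \<subseteq> {0, 1} \<and>
      set v \<subseteq> {0, 1} \<and> word_prod G g u \<otimes> word_prod G h v = \<one>)"
      using run0[of \<one> w \<one>] g h by (simp add: eq_commute[of \<one>])
    also have "\<dots> \<longleftrightarrow> w \<in> mirror (word_prod G g)"
      unfolding mirror_def mem_Collect_eq inv by (metis rev_rev_ident set_rev)
    finally show ?thesis .
  qed
  moreover have "{w. \<exists>q\<in>{1}. drun G e 0 \<one> w = Some (q, \<one>)} \<in> Lw_lin G"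
    by (rule Lw_lin_realtime[of "{0, 1}" "{0, 1, 2}"])
       (use g h in \<open>auto simp: e_def split: if_splits\<close>)
  ultimately show ?thesis by simp
qed

section \<open>Grammars, and palindromes with a centre marker\<close>

inductive_cases cfg_gen_NilE: "cfg_gen P [] w"
inductive_cases cfg_gen_NontermE: "cfg_gen P (Inl B # r) w"

primrec form_lang :: "(nat \<Rightarrow> 'a list set) \<Rightarrow> (nat + 'a) list \<Rightarrow> 'a list set" where
  "form_lang T [] = {[]}"
| "form_lang T (s # r) = {u @ w | u w. u \<in> (case s of Inl B \<Rightarrow> T B | Inr a \<Rightarrow> {[a]}) \<and> w \<in> form_lang T r}"

text \<open>The generated languages form the least assignment that is closed under the productions;
  any closed assignment \<open>T\<close> therefore bounds them from above. Soundness of a grammar is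
  thus checked production by production.\<close>

lemma cfg_gen_sound:
  assumes "cfg_gen P \<alpha> w" "\<And>B rhs. (B, rhs) \<in> P \<Longrightarrow> form_lang T rhs \<subseteq> T B"
  shows "w \<in> form_lang T \<alpha>"
  using assms
proof (induction rule: cfg_gen.induct)
  case (cfg_term r w a)
  then show ?case by force
next
  case (cfg_nonterm B rhs u r w)
  then have "u \<in> T B" by blast
  with cfg_nonterm show ?case by auto
qed simp

text \<open>For the identity the mirror language consists of the palindromes with a centre marker.
  It is context-free, yet its words of length \<open>2 * n + 1\<close> require \<open>2 ^ n\<close>
  middle configurations, too many for commutative groups.\<close>

lemma mirror_id_CF: "mirror (\<lambda>w. w) \<in> CF"
proof -
  let ?P = "{(0, [Inr 0, Inl 0, Inr 0]), (0, [Inr 1, Inl 0, Inr 1]), (0, [Inr 2])}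
    :: (nat \<times> (nat + nat) list) set"
  have 1: "w @ 2 # rev w \<in> {w. cfg_gen ?P [Inl 0] w}" if "set w \<subseteq> {0, 1}" for w
    using that
  proof (induction w)
    case Nil
    have "cfg_gen ?P [Inl 0] ([2] @ [])"
      by (rule cfg_nonterm[of _ "[Inr 2]"]) (auto intro: cfg_gen.intros)
    then show ?case by simp
  next
    case (Cons a w)
    have "cfg_gen ?P [Inr a] [a]" by (intro cfg_gen.intros)
    with Cons have "cfg_gen ?P [Inl 0, Inr a] ((w @ 2 # rev w) @ [a])"
    proof -
      have "cfg_gen ?P [Inl 0] (w @ 2 # rev w)" using Cons by auto
      then obtain rhs u where *: "(0, rhs) \<in> ?P" "cfg_gen ?P rhs u" "w @ 2 # rev w = u"
        by (elim cfg_gen_NontermE) (auto elim: cfg_gen_NilE simp del: insert_iff)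
      show ?thesis unfolding *(3)
        by (rule cfg_nonterm[OF *(1,2)]) (intro cfg_gen.intros)
    qed
    then have "cfg_gen ?P [Inr a, Inl 0, Inr a] (a # (w @ 2 # rev w) @ [a])" by (rule cfg_term)
    from cfg_nonterm[OF _ this cfg_nil, of 0] show ?case using Cons.prems by auto
  qed
  have 2: "w \<in> mirror (\<lambda>w. w)" if "cfg_gen ?P [Inl 0] w" for w
  proof -
    have "w \<in> form_lang (\<lambda>_. mirror (\<lambda>w. w)) [Inl 0]"
    proof (rule cfg_gen_sound[OF that])
      fix B rhs assume "(B, rhs) \<in> ?P"
      moreover have "a # u @ [a] \<in> mirror (\<lambda>w. w)" if "u \<in> mirror (\<lambda>w. w)" "a \<in> {0, 1}" for u a
      proof -
        from that(1) obtain w where w: "u = w @ 2 # rev w" "set w \<subseteq> {0, 1}"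
          unfolding mirror_def by blast
        have "(a # w) @ 2 # rev (a # w) \<in> mirror (\<lambda>w. w)"
          using w(2) that(2) by (subst mirror_iff) auto
        then show ?thesis using w(1) by simp
      qed
      moreover have "[2] \<in> mirror (\<lambda>w. w)" using mirror_iff[of "[]" "[]"] by simp
      ultimately show "form_lang (\<lambda>_. mirror (\<lambda>w. w)) rhs \<subseteq> mirror (\<lambda>w. w)"
        by fastforce
    qed
    then show ?thesis by simp
  qed
  have "mirror (\<lambda>w. w) = {w. cfg_gen ?P [Inl 0] w}"
  proof
    show "mirror (\<lambda>w. w) \<subseteq> {w. cfg_gen ?P [Inl 0] w}"
    proof
      fix z :: "nat list" assume "z \<in> mirror (\<lambda>w. w)"
      then obtain w where "z = w @ 2 # rev w" "set w \<subseteq> {0, 1}"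
        unfolding mirror_def by auto
      then show "z \<in> {w. cfg_gen ?P [Inl 0] w}" using 1 by simp
    qed
    show "{w. cfg_gen ?P [Inl 0] w} \<subseteq> mirror (\<lambda>w. w)" by (rule subsetI) (rule 2, erule CollectD)
  qed
  then show ?thesis unfolding CF_def by (intro CollectI exI[of _ ?P] exI[of _ 0]) auto
qed

section \<open>Languages that are not context-free\<close>

text \<open>The number counts applied productions. It measures derivations even when empty or unit
  productions leave the word unchanged, so a shortest derivation can be selected for arbitrary
  grammars.\<close>

inductive cfg_sized :: "(nat \<times> (nat + 'a) list) set \<Rightarrow> (nat + 'a) list \<Rightarrow> 'a list \<Rightarrow> nat \<Rightarrow> bool"
  for P where
  sized_nil: "cfg_sized P [] [] 0"
| sized_term: "cfg_sized P r w n \<Longrightarrow> cfg_sized P (Inr a # r) (a # w) n"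
| sized_nonterm: "(B, rhs) \<in> P \<Longrightarrow> cfg_sized P rhs u m \<Longrightarrow> cfg_sized P r w n \<Longrightarrow>
    cfg_sized P (Inl B # r) (u @ w) (Suc (m + n))"

inductive_cases cfg_sized_NilE: "cfg_sized P [] w n"
inductive_cases cfg_sized_NontermE: "cfg_sized P (Inl B # r) w n"

lemma cfg_gen_iff_sized: "cfg_gen P \<alpha> w \<longleftrightarrow> (\<exists>n. cfg_sized P \<alpha> w n)"
proof
  show "\<exists>n. cfg_sized P \<alpha> w n" if "cfg_gen P \<alpha> w"
    using that by (induction rule: cfg_gen.induct) (blast intro: cfg_sized.intros)+
next
  assume "\<exists>n. cfg_sized P \<alpha> w n"
  then obtain n where "cfg_sized P \<alpha> w n" by blast
  then show "cfg_gen P \<alpha> w"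
    by (induction rule: cfg_sized.induct) (blast intro: cfg_gen.intros)+
qed

text \<open>Derivations in which no nonterminal repeats along a path of the tree; \<open>F\<close> collects the
nonterminals above the current position.\<close>
inductive cfg_norep :: "(nat \<times> (nat + 'a) list) set \<Rightarrow> nat set \<Rightarrow> (nat + 'a) list \<Rightarrow> 'a list \<Rightarrow> bool"
  for P where
  norep_nil: "cfg_norep P F [] []"
| norep_term: "cfg_norep P F r w \<Longrightarrow> cfg_norep P F (Inr a # r) (a # w)"
| norep_nonterm: "B \<notin> F \<Longrightarrow> (B, rhs) \<in> P \<Longrightarrow> cfg_norep P (insert B F) rhs u \<Longrightarrow> cfg_norep P F r w \<Longrightarrow>
    cfg_norep P F (Inl B # r) (u @ w)"

lemma cfg_norep_length:
  assumes "cfg_norep P F \<alpha> w" "finite P" "K \<ge> 1" "\<And>B rhs. (B, rhs) \<in> P \<Longrightarrow> length rhs \<le> K"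
  shows "length w \<le> length \<alpha> * K ^ card (fst ` P - F)"
  using assms
proof (induction rule: cfg_norep.induct)
  case (norep_term F r w a)
  have "1 \<le> K ^ card (fst ` P - F)" using norep_term.prems by simp
  moreover have "length w \<le> length r * K ^ card (fst ` P - F)" using norep_term by blast
  ultimately show ?case by simp
next
  case (norep_nonterm B F rhs u r w)
  have B: "B \<in> fst ` P - F" using norep_nonterm by force
  have "length u \<le> length rhs * K ^ card (fst ` P - insert B F)" using norep_nonterm by blast
  also have "\<dots> \<le> K * K ^ card (fst ` P - insert B F)"
    using norep_nonterm by (intro mult_right_mono) auto
  also have "\<dots> = K ^ card (fst ` P - F)"
  proof -
    have "card (fst ` P - F) = Suc (card (fst ` P - F - {B}))"
      using B norep_nonterm.prems(1) by (subst card.remove[of _ B]) auto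
    moreover have "fst ` P - F - {B} = fst ` P - insert B F" by blast
    ultimately show ?thesis by simp
  qed
  finally have "length u \<le> K ^ card (fst ` P - F)" .
  moreover have "length w \<le> length r * K ^ card (fst ` P - F)" using norep_nonterm by blast
  ultimately show ?case by simp
qed simp

text \<open>A derivation tree with a hole at \<open>B\<close>, represented by its effect on the
  derivations put into the hole: \<open>u\<close> and \<open>y\<close> are the yields on either
  side, \<open>k\<close> the number of productions outside.\<close>

definition cfg_ctx :: "(nat \<times> (nat + 'a) list) set \<Rightarrow> (nat + 'a) list \<Rightarrow> nat \<Rightarrow> 'a list \<Rightarrow> 'a list \<Rightarrow> nat \<Rightarrow> bool" where
  "cfg_ctx P \<alpha> B u y k \<longleftrightarrow> (\<forall>w m. cfg_sized P [Inl B] w m \<longrightarrow> cfg_sized P \<alpha> (u @ w @ y) (k + m))"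

lemma cfg_ctx_term: "cfg_ctx P r B u y k \<Longrightarrow> cfg_ctx P (Inr a # r) B (a # u) y k"
  unfolding cfg_ctx_def by (auto intro: cfg_sized.intros)

lemma cfg_ctx_right:
  assumes "cfg_ctx P r C u1 y k" "(B, rhs) \<in> P" "cfg_sized P rhs u m"
  shows "cfg_ctx P (Inl B # r) C (u @ u1) y (Suc (m + k))"
  unfolding cfg_ctx_def
proof (intro allI impI)
  fix w l assume "cfg_sized P [Inl C] w l"
  then have "cfg_sized P r (u1 @ w @ y) (k + l)" using assms(1) unfolding cfg_ctx_def by blast
  from sized_nonterm[OF assms(2,3) this]
  show "cfg_sized P (Inl B # r) ((u @ u1) @ w @ y) (Suc (m + k) + l)"
    by (simp add: add.assoc)
qed

lemma cfg_ctx_left: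
  assumes "cfg_ctx P rhs C u y k" "(B, rhs) \<in> P" "cfg_sized P r w n"
  shows "cfg_ctx P (Inl B # r) C u (y @ w) (Suc (k + n))"
  unfolding cfg_ctx_def
proof (intro allI impI)
  fix w' l assume "cfg_sized P [Inl C] w' l"
  then have "cfg_sized P rhs (u @ w' @ y) (k + l)" using assms(1) unfolding cfg_ctx_def by blast
  from sized_nonterm[OF assms(2) this assms(3)]
  show "cfg_sized P (Inl B # r) (u @ w' @ y @ w) (Suc (k + n) + l)"
    by (simp add: ac_simps)
qed

lemma cfg_ctx_here:
  assumes "cfg_sized P r w n"
  shows "cfg_ctx P (Inl B # r) B [] w n"
  unfolding cfg_ctx_def
proof (intro allI impI)
  fix w' l assume "cfg_sized P [Inl B] w' l"
  then obtain rhs m where "(B, rhs) \<in> P" "cfg_sized P rhs w' m" "l = Suc m"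
    by (elim cfg_sized_NontermE) (auto elim: cfg_sized_NilE)
  with sized_nonterm[OF this(1,2) assms]
  show "cfg_sized P (Inl B # r) ([] @ w' @ w) (n + l)" by (simp add: ac_simps)
qed

inductive cfg_above where
  aboveI: "B \<in> F \<Longrightarrow> w = u @ w' @ y \<Longrightarrow> n = k + m \<Longrightarrow> cfg_sized P [Inl B] w' m \<Longrightarrow>
    cfg_ctx P \<alpha> B u y k \<Longrightarrow> cfg_above P F \<alpha> w n"

inductive cfg_pumpable where
  pumpableI: "l > 0 \<Longrightarrow> w = u @ v @ w' @ x @ y \<Longrightarrow> n = k + l + m \<Longrightarrow> cfg_sized P [Inl B] w' m \<Longrightarrow>
    cfg_ctx P \<alpha> B u y k \<Longrightarrow> cfg_ctx P [Inl B] B v x l \<Longrightarrow> cfg_pumpable P \<alpha> w n"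

text \<open>\<open>F\<close> records the nonterminals passed on the way down. Either nothing
  repeats, or a nonterminal of \<open>F\<close> shows up again (\<open>cfg_above\<close>), or a loop
  has already closed further down (\<open>cfg_pumpable\<close>). A repetition is handed upwards
  until it reaches the ancestor that entered it into \<open>F\<close>, where it becomes a
  loop.\<close>

lemma cfg_sized_trichotomy:
  assumes "cfg_sized P \<alpha> w n"
  shows "cfg_norep P F \<alpha> w \<or> cfg_above P F \<alpha> w n \<or> cfg_pumpable P \<alpha> w n"
  using assms
proof (induction arbitrary: F rule: cfg_sized.induct)
  case sized_nil
  then show ?case by (blast intro: cfg_norep.intros)
next
  case (sized_term r w n a)
  from sized_term.IH[of F] consider "cfg_norep P F r w" | "cfg_above P F r w n" | "cfg_pumpable P r w n" by blast
  then show ?case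
  proof cases
    case 1
    then show ?thesis by (blast intro: cfg_norep.intros)
  next
    case 2
    then obtain B u w' y m k where *: "B \<in> F" "w = u @ w' @ y" "n = k + m" "cfg_sized P [Inl B] w' m"
      "cfg_ctx P r B u y k" by (rule cfg_above.cases) blast
    have "a # w = (a # u) @ w' @ y" using * by simp
    from aboveI[OF *(1) this *(3,4) cfg_ctx_term[OF *(5)]] show ?thesis by simp
  next
    case 3
    then obtain B u v w' x y m l k where *: "l > 0" "w = u @ v @ w' @ x @ y" "n = k + l + m"
      "cfg_sized P [Inl B] w' m" "cfg_ctx P r B u y k" "cfg_ctx P [Inl B] B v x l" by (rule cfg_pumpable.cases) blast
    have "a # w = (a # u) @ v @ w' @ x @ y" using * by simp
    from pumpableI[OF *(1) this *(3,4) cfg_ctx_term[OF *(5)] *(6)] show ?thesis by simp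
  qed
next
  case (sized_nonterm B rhs u m r w n)
  note B = sized_nonterm.hyps(1) and rhs = sized_nonterm.hyps(2) and r = sized_nonterm.hyps(3)
  from sized_nonterm.IH(2)[of F] consider "cfg_norep P F r w" | "cfg_above P F r w n" | "cfg_pumpable P r w n"
    by blast
  then show ?case
  proof cases
    case 2
    then obtain C u1 w' y m1 k where *: "C \<in> F" "w = u1 @ w' @ y" "n = k + m1" "cfg_sized P [Inl C] w' m1"
      "cfg_ctx P r C u1 y k" by (rule cfg_above.cases) blast
    have "u @ w = (u @ u1) @ w' @ y" "Suc (m + n) = Suc (m + k) + m1" using * by simp_all
    from aboveI[OF *(1) this *(4) cfg_ctx_right[OF *(5) B rhs]] show ?thesis by simp
  next
    case 3
    then obtain C u1 v w' x y m1 l k where *: "l > 0" "w = u1 @ v @ w' @ x @ y" "n = k + l + m1"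
      "cfg_sized P [Inl C] w' m1" "cfg_ctx P r C u1 y k" "cfg_ctx P [Inl C] C v x l" by (rule cfg_pumpable.cases) blast
    have "u @ w = (u @ u1) @ v @ w' @ x @ y" "Suc (m + n) = Suc (m + k) + l + m1" using * by simp_all
    from pumpableI[OF *(1) this *(4) cfg_ctx_right[OF *(5) B rhs] *(6)] show ?thesis by simp
  next
    case 1
    show ?thesis
    proof (cases "B \<in> F")
      case True
      have "u @ w = [] @ u @ w" "Suc (m + n) = n + Suc m" by simp_all
      moreover have "cfg_sized P [Inl B] u (Suc m)"
        using cfg_sized.sized_nonterm[OF B rhs cfg_sized.sized_nil] by simp
      ultimately show ?thesis using aboveI[OF True _ _ _ cfg_ctx_here[OF r]] by blast
    next
      case False
      from sized_nonterm.IH(1)[of "insert B F"]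
      consider "cfg_norep P (insert B F) rhs u" | "cfg_above P (insert B F) rhs u m" | "cfg_pumpable P rhs u m" by blast
      then show ?thesis
      proof cases
        case a: 1
        then show ?thesis using cfg_norep.norep_nonterm[OF False B a 1] by blast
      next
        case 2
        then obtain C u1 w' y m1 k where *: "C \<in> insert B F" "u = u1 @ w' @ y" "m = k + m1"
          "cfg_sized P [Inl C] w' m1" "cfg_ctx P rhs C u1 y k" by (rule cfg_above.cases) blast
        show ?thesis
        proof (cases "C = B")
          case True
          \<comment> \<open>\<open>B\<close> recurs below its own production, so the context closes
            to a loop. The production itself is counted by \<open>Suc k\<close>, which makes the
            size of the loop positive.\<close>
          have "cfg_ctx P [Inl B] B u1 (y @ []) (Suc (k + 0))"
            using cfg_ctx_left[OF *(5) B cfg_sized.sized_nil] True by simp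
          then have "cfg_ctx P [Inl B] B u1 y (Suc k)" by simp
          moreover have "u @ w = [] @ u1 @ w' @ y @ w" "Suc (m + n) = n + Suc k + m1"
            using * by simp_all
          moreover have "0 < Suc k" by simp
          ultimately show ?thesis
            using pumpableI[OF _ _ _ _ cfg_ctx_here[OF r]] *(4) True by blast
        next
          case False
          have "u @ w = u1 @ w' @ (y @ w)" "Suc (m + n) = Suc (k + n) + m1" using * by simp_all
          from aboveI[OF _ this *(4) cfg_ctx_left[OF *(5) B r]] show ?thesis using *(1) False by simp
        qed
      next
        case 3
        then obtain C u1 v w' x y m1 l k where *: "l > 0" "u = u1 @ v @ w' @ x @ y" "m = k + l + m1"
          "cfg_sized P [Inl C] w' m1" "cfg_ctx P rhs C u1 y k" "cfg_ctx P [Inl C] C v x l" by (rule cfg_pumpable.cases) blast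
        have "u @ w = u1 @ v @ w' @ x @ (y @ w)" "Suc (m + n) = Suc (k + n) + l + m1"
          using * by simp_all
        from pumpableI[OF *(1) this *(4) cfg_ctx_left[OF *(5) B r] *(6)] show ?thesis by simp
      qed
    qed
  qed
qed

lemma CF_pumping:
  assumes "L \<in> CF"
  obtains p where "\<And>z. z \<in> L \<Longrightarrow> p \<le> length z \<Longrightarrow> \<exists>u v w x y. z = u @ v @ w @ x @ y \<and> v @ x \<noteq> [] \<and>
    (\<forall>i. u @ concat (replicate i v) @ w @ concat (replicate i x) @ y \<in> L)"
proof -
  obtain P S where P: "finite P" and L: "L = {w. cfg_gen P [Inl S] w}"
    using assms unfolding CF_def by blast
  \<comment> \<open>\<open>Suc\<close> secures \<open>K >= 1\<close>, and \<open>insert 0\<close>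
    keeps the maximum defined for an empty set of productions.\<close>
  define K where "K = Suc (Max (insert 0 ((\<lambda>(B, rhs). length rhs) ` P)))"
  have K: "length rhs \<le> K" if "(B, rhs) \<in> P" for B rhs
  proof -
    have "length rhs \<le> Max (insert 0 ((\<lambda>(B, rhs). length rhs) ` P))"
      using P that by (intro Max_ge) force+
    then show ?thesis by (simp add: K_def)
  qed
  show thesis
  proof (rule that[of "Suc (K ^ card (fst ` P))"])
    fix z assume z: "z \<in> L" "Suc (K ^ card (fst ` P)) \<le> length z"
    \<comment> \<open>Minimality makes the pumped part nonempty: a loop of positive size with empty
      yield could be cut out, leaving a shorter derivation of \<open>z\<close>.\<close>
    define n where "n = (LEAST n. cfg_sized P [Inl S] z n)"
    have ex: "\<exists>n. cfg_sized P [Inl S] z n" using z(1) L cfg_gen_iff_sized by blast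
    have n: "cfg_sized P [Inl S] z n" unfolding n_def using ex by (rule LeastI_ex)
    have min: "n \<le> n'" if "cfg_sized P [Inl S] z n'" for n'
      unfolding n_def using that by (rule Least_le)
    have "\<not> cfg_norep P {} [Inl S] z"
    proof
      assume "cfg_norep P {} [Inl S] z"
      from cfg_norep_length[OF this P _ K] show False using z(2) by (simp add: K_def)
    qed
    then have "cfg_pumpable P [Inl S] z n"
      using cfg_sized_trichotomy[OF n, of "{}"] by (auto elim: cfg_above.cases)
    then obtain B u v w x y m l k where *: "l > 0"
      "z = u @ v @ w @ x @ y" "n = k + l + m" "cfg_sized P [Inl B] w m"
      "cfg_ctx P [Inl S] B u y k" "cfg_ctx P [Inl B] B v x l" by (rule cfg_pumpable.cases) blast
    have "v @ x \<noteq> []"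
    proof
      assume "v @ x = []"
      then have "cfg_sized P [Inl S] z (k + m)" using * unfolding cfg_ctx_def by auto
      from min[OF this] *(1,3) show False by simp
    qed
    moreover have "u @ concat (replicate i v) @ w @ concat (replicate i x) @ y \<in> L" for i
    proof -
      have "\<exists>m. cfg_sized P [Inl B] (concat (replicate i v) @ w @ concat (replicate i x)) m"
      proof (induction i)
        case (Suc i)
        then obtain m where "cfg_sized P [Inl B] (concat (replicate i v) @ w @ concat (replicate i x)) m"
          by blast
        then have "cfg_sized P [Inl B] (v @ (concat (replicate i v) @ w @ concat (replicate i x)) @ x) (l + m)"
          using *(6) unfolding cfg_ctx_def by blast
        moreover have "concat (replicate i x) @ x = concat (replicate (Suc i) x)"
          by (induction i) auto
        ultimately show ?case by auto
      qed (use * in auto)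
      then obtain m where "cfg_sized P [Inl B] (concat (replicate i v) @ w @ concat (replicate i x)) m"
        by blast
      then have "cfg_sized P [Inl S] (u @ (concat (replicate i v) @ w @ concat (replicate i x)) @ y) (k + m)"
        using *(5) unfolding cfg_ctx_def by blast
      then show ?thesis unfolding L using cfg_gen_iff_sized by auto
    qed
    ultimately show "\<exists>u v w x y. z = u @ v @ w @ x @ y \<and> v @ x \<noteq> [] \<and>
        (\<forall>i. u @ concat (replicate i v) @ w @ concat (replicate i x) @ y \<in> L)"
      using *(2) by blast
  qed
qed

section \<open>Two languages that are not context-free\<close>

lemma count_list_replicate: "count_list (replicate n a) b = (if a = b then n else 0)"
  by (induction n) auto

definition abc_lang :: "nat list set" where
  "abc_lang = {w. sorted w \<and> set w \<subseteq> {0, 1, 2} \<and>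
     count_list w 0 = count_list w 1 \<and> count_list w 0 = count_list w 2}"

text \<open>Pumping twice keeps the word sorted, so \<open>v @ v\<close> and \<open>x @ x\<close>
  are sorted and each of \<open>v\<close>, \<open>x\<close> consists of a single repeated letter.
  Hence one of the three letters is missing from \<open>v @ x\<close>, while pumping has to add
  equally many of each.\<close>

lemma abc_lang_not_CF: "abc_lang \<notin> CF"
proof
  assume "abc_lang \<in> CF"
  then obtain p where p: "\<And>z. z \<in> abc_lang \<Longrightarrow> p \<le> length z \<Longrightarrow>
    \<exists>u v w x y. z = u @ v @ w @ x @ y \<and> v @ x \<noteq> [] \<and>
    (\<forall>i. u @ concat (replicate i v) @ w @ concat (replicate i x) @ y \<in> abc_lang)"
    by (rule CF_pumping) blast
  let ?z = "replicate p 0 @ replicate p 1 @ replicate p (2 :: nat)"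
  have "?z \<in> abc_lang" unfolding abc_lang_def by (simp add: sorted_append count_list_replicate set_replicate_conv_if)
  from p[OF this] obtain u v w x y where z: "?z = u @ v @ w @ x @ y" "v @ x \<noteq> []"
      "\<And>i. u @ concat (replicate i v) @ w @ concat (replicate i x) @ y \<in> abc_lang" by auto
  have one: "u @ v @ w @ x @ y \<in> abc_lang" using z(3)[of 1] by simp
  have two: "u @ v @ v @ w @ x @ x @ y \<in> abc_lang" using z(3)[of 2] by (simp add: numeral_2_eq_2)
  have "sorted (v @ v)" "sorted (x @ x)" using two unfolding abc_lang_def
    by (auto simp: sorted_append)
  then have const: "\<And>a b. a \<in> set v \<Longrightarrow> b \<in> set v \<Longrightarrow> a = b" "\<And>a b. a \<in> set x \<Longrightarrow> b \<in> set x \<Longrightarrow> a = b"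
    unfolding sorted_append by (auto intro: antisym)
  have sub: "set (v @ x) \<subseteq> {0, 1, 2}" using one unfolding abc_lang_def by auto
  have eq: "count_list (v @ x) 0 = count_list (v @ x) 1" "count_list (v @ x) 0 = count_list (v @ x) 2"
    using one two unfolding abc_lang_def by (auto simp: count_list_append)
  have "\<exists>c\<in>{0, 1, 2}. c \<notin> set (v @ x)"
  proof (rule ccontr)
    assume "\<not> ?thesis"
    then have "0 \<in> set v \<union> set x" "1 \<in> set v \<union> set x" "2 \<in> set v \<union> set x" by auto
    then show False using const(1)[of 0 1] const(1)[of 0 2] const(1)[of 1 2]
        const(2)[of 0 1] const(2)[of 0 2] const(2)[of 1 2] by auto
  qed
  then have "count_list (v @ x) 0 = 0" using eq count_list_0_iff by fastforce
  with eq have "0 \<notin> set (v @ x)" "1 \<notin> set (v @ x)" "2 \<notin> set (v @ x)"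
    using count_list_0_iff[of "v @ x"] by auto
  then have "a \<notin> set (v @ x)" for a using subsetD[OF sub, of a] by fastforce
  from this[of "hd (v @ x)"] show False using hd_in_set[OF z(2)] by (rule notE)
qed

text \<open>With \<open>n >= 1\<close> there is always a letter 1, on which an automaton without
  empty moves can multiply by the generator \<open>a\<close> between the powers of
  \<open>b\<close>.\<close>

definition exp_lang :: "nat list set" where
  "exp_lang = {replicate n 0 @ replicate n 1 @ replicate (2 ^ n) 2 | n. n \<ge> 1}"

text \<open>Only lengths matter: pumping produces an arithmetic progression \<open>l + i * d\<close>
  inside the values of \<open>f n = 2 * n + 2 ^ n\<close>, but the gaps between consecutive values
  of \<open>f\<close> outgrow \<open>d\<close>.\<close>

lemma exp_lang_not_CF: "exp_lang \<notin> CF"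
proof
  assume "exp_lang \<in> CF"
  then obtain p where p: "\<And>z. z \<in> exp_lang \<Longrightarrow> p \<le> length z \<Longrightarrow>
    \<exists>u v w x y. z = u @ v @ w @ x @ y \<and> v @ x \<noteq> [] \<and>
    (\<forall>i. u @ concat (replicate i v) @ w @ concat (replicate i x) @ y \<in> exp_lang)"
    by (rule CF_pumping) blast
  define f :: "nat \<Rightarrow> nat" where "f n = 2 * n + 2 ^ n" for n
  have f: "f M \<le> f N" if "M \<le> N" for M N using that unfolding f_def by (intro add_mono) auto
  let ?z = "replicate (Suc p) 0 @ replicate (Suc p) 1 @ replicate (2 ^ Suc p) (2 :: nat)"
  have "?z \<in> exp_lang" unfolding exp_lang_def mem_Collect_eq
    by (intro exI[of _ "Suc p"] conjI refl) simp
  moreover have "p \<le> length ?z" by simp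
  ultimately have "\<exists>u v w x y. ?z = u @ v @ w @ x @ y \<and> v @ x \<noteq> [] \<and>
    (\<forall>i. u @ concat (replicate i v) @ w @ concat (replicate i x) @ y \<in> exp_lang)" by (rule p)
  then obtain u v w x y where z: "v @ x \<noteq> []"
      "\<And>i. u @ concat (replicate i v) @ w @ concat (replicate i x) @ y \<in> exp_lang" by (elim exE conjE) blast
  define l where "l = length (u @ w @ y)"
  define d where "d = length (v @ x)"
  have d: "d > 0" using z(1) unfolding d_def by blast
  have len: "\<exists>n. l + i * d = f n" for i
  proof -
    have "length (u @ concat (replicate i v) @ w @ concat (replicate i x) @ y) = l + i * d"
      unfolding l_def d_def by (simp add: length_concat sum_list_replicate algebra_simps)
    moreover have "\<exists>n. length z = f n" if "z \<in> exp_lang" for z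
      using that unfolding exp_lang_def f_def by (auto simp: mult_2 add.assoc)
    ultimately show ?thesis using z(2) by metis
  qed
  \<comment> \<open>The index \<open>f (Suc d)\<close> makes the length at least
    \<open>f (Suc d)\<close>, so that \<open>N > d\<close>. Beyond this point the gap
    \<open>f (Suc N) - f N\<close> exceeds \<open>N\<close> and thus \<open>d\<close>, and the next
    term of the progression cannot be a value of \<open>f\<close>.\<close>
  obtain N where N: "l + f (Suc d) * d = f N" using len by blast
  obtain M where M: "l + Suc (f (Suc d)) * d = f M" using len by blast
  have "f (Suc d) * 1 \<le> f (Suc d) * d" using d by (intro mult_left_mono) auto
  with N have "f (Suc d) \<le> f N" by linarith
  moreover have "f d < f (Suc d)" unfolding f_def by simp
  ultimately have "f d < f N" by simp
  then have "d < N" using f[of N d] by (cases "d < N") auto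
  have "f M = f N + d" using N M by simp
  then have "N < M" using d f[of M N] by (cases "N < M") auto
  then have "f (Suc N) \<le> f M" using f by simp
  moreover have "f N + N < f (Suc N)"
  proof -
    define t :: nat where "t = 2 ^ N"
    have "N < t" unfolding t_def by (rule less_exp)
    then show ?thesis unfolding f_def power_Suc t_def[symmetric] by simp
  qed
  ultimately show False using \<open>f M = f N + d\<close> \<open>d < N\<close> by simp
qed

text \<open>One coordinate of the register compares the letters 0 and 1, the other the letters 0 and
  2. The state is the last letter read, which enforces sortedness.\<close>

lemma abc_lang_Zk2: "abc_lang \<in> Lw_lin (Zk 2)"
proof -
  define lab :: "nat \<Rightarrow> nat \<Rightarrow> int" where "lab a = (if a = 0 then (\<lambda>i. if i < 2 then 1 else 0)
     else if a = 1 then (\<lambda>i. if i = 0 then -1 else 0) else (\<lambda>i. if i = 1 then -1 else 0))" for a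
  define e where "e q a = (if q \<le> a \<and> a \<le> 2 then Some (a, lab a) else None)" for q a :: nat
  define \<nu> :: "nat list \<Rightarrow> nat \<Rightarrow> int" where "\<nu> w i = (if i = 0 then int (count_list w 0) - int (count_list w 1)
     else if i = 1 then int (count_list w 0) - int (count_list w 2) else 0)" for w i
  have run: "drun (Zk 2) e q x w = Some (q', y) \<longleftrightarrow>
      sorted (q # w) \<and> set w \<subseteq> {..2} \<and> q' = last (q # w) \<and> y = (\<lambda>i. x i + \<nu> w i)" for q x w q' y
  proof (induction w arbitrary: q x)
    case Nil
    then show ?case by (auto simp: \<nu>_def)
  next
    case (Cons a w)
    have eq: "(\<lambda>i. x i + lab a i + \<nu> w i) = (\<lambda>i. x i + \<nu> (a # w) i)" if "a \<le> 2"
    proof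
      fix i
      have "a = 0 \<or> a = 1 \<or> a = 2" using that by auto
      then show "x i + lab a i + \<nu> w i = x i + \<nu> (a # w) i"
        by (elim disjE) (simp_all add: lab_def \<nu>_def)
    qed
    show ?case
    proof (cases "q \<le> a \<and> a \<le> 2")
      case True
      then have "drun (Zk 2) e q x (a # w) = drun (Zk 2) e a (\<lambda>i. x i + lab a i) w"
        by (simp add: e_def Zk_def)
      then have "drun (Zk 2) e q x (a # w) = Some (q', y) \<longleftrightarrow> sorted (a # w) \<and> set w \<subseteq> {..2} \<and> q' = last (a # w) \<and>
          y = (\<lambda>i. x i + \<nu> (a # w) i)"
        using True eq by (simp only: Cons.IH)
      also have "\<dots> \<longleftrightarrow> sorted (q # a # w) \<and> set (a # w) \<subseteq> {..2} \<and> q' = last (q # a # w) \<and>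
          y = (\<lambda>i. x i + \<nu> (a # w) i)"
        unfolding sorted2 using True by simp
      finally show ?thesis .
    next
      case False
      then have "drun (Zk 2) e q x (a # w) = None" by (auto simp: e_def)
      with False show ?thesis by auto
    qed
  qed
  have "{w. \<exists>q\<in>{0, 1, 2}. drun (Zk 2) e 0 \<one>\<^bsub>Zk 2\<^esub> w = Some (q, \<one>\<^bsub>Zk 2\<^esub>)} \<in> Lw_lin (Zk 2)"
    by (rule Lw_lin_realtime[of "{0, 1, 2}" "{0, 1, 2}"])
       (auto simp: e_def Zk_def lab_def split: if_splits)
  moreover have "(\<exists>q\<in>{0, 1, 2}. drun (Zk 2) e 0 \<one>\<^bsub>Zk 2\<^esub> w = Some (q, \<one>\<^bsub>Zk 2\<^esub>)) \<longleftrightarrow> w \<in> abc_lang"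
    for w
  proof -
    have three: "{..2} = {0, 1, 2 :: nat}" by auto
    have \<nu>: "\<nu> w = (\<lambda>_. 0) \<longleftrightarrow> count_list w 0 = count_list w 1 \<and> count_list w 0 = count_list w 2"
    proof
      assume "\<nu> w = (\<lambda>_. 0)"
      then have "\<nu> w 0 = 0" "\<nu> w 1 = 0" by auto
      then show "count_list w 0 = count_list w 1 \<and> count_list w 0 = count_list w 2"
        unfolding \<nu>_def by simp
    qed (auto simp: \<nu>_def)
    have last: "last (0 # w) \<in> {0, 1, 2}" if "set w \<subseteq> {0, 1, 2}"
      using that by (cases w rule: rev_cases) auto
    have one: "\<one>\<^bsub>Zk 2\<^esub> = (\<lambda>_. 0)" by (simp add: Zk_def)
    have zero: "(\<lambda>_. 0) = (\<lambda>i. 0 + \<nu> w i) \<longleftrightarrow> \<nu> w = (\<lambda>_. 0)" by (auto simp: fun_eq_iff)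
    have sorted: "sorted (0 # w) \<longleftrightarrow> sorted w" by simp
    show ?thesis unfolding run abc_lang_def three one zero sorted \<nu> mem_Collect_eq
      by (metis last)
  qed
  ultimately show ?thesis by simp
qed

section \<open>Free groups\<close>

lemma inv_letter_inv_letter [simp]: "inv_letter (inv_letter l) = l"
  by (simp add: inv_letter_def)

lemma freely_reduced_Nil [simp]: "freely_reduced []"
  by (simp add: freely_reduced_def)

lemma freely_reduced_Cons:
  "freely_reduced (l # w) \<longleftrightarrow> freely_reduced w \<and> (w = [] \<or> hd w \<noteq> inv_letter l)"
proof (cases w)
  case (Cons y w')
  have split: "(\<forall>i. P i) \<longleftrightarrow> P 0 \<and> (\<forall>i. P (Suc i))" for P :: "nat \<Rightarrow> bool" by (metis nat.exhaust)
  show ?thesis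
    unfolding freely_reduced_def Cons by (subst split) auto
qed (simp add: freely_reduced_def)

lemma red_cons_reduced: "freely_reduced w \<Longrightarrow> freely_reduced (red_cons l w)"
  by (cases w) (auto simp: red_cons_def freely_reduced_Cons)

lemma red_cons_inverse: "freely_reduced w \<Longrightarrow> red_cons (inv_letter l) (red_cons l w) = w"
  by (cases w; cases "tl w") (auto simp: red_cons_def freely_reduced_Cons)

lemma foldr_red_cons_reduced: "freely_reduced w \<Longrightarrow> freely_reduced (foldr red_cons u w)"
  by (induction u) (auto intro: red_cons_reduced)

lemma free_reduce_reduced: "freely_reduced (free_reduce u)"
  unfolding free_reduce_def by (rule foldr_red_cons_reduced) simp

lemma free_reduce_id: "freely_reduced w \<Longrightarrow> free_reduce w = w"
  unfolding free_reduce_def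
proof (induction w)
  case (Cons l w)
  then show ?case by (cases w) (auto simp: freely_reduced_Cons red_cons_def)
qed simp

text \<open>Letters act on reduced words through \<open>red_cons\<close>, inverse letters by inverse
  permutations. A cancellation inside a word therefore does not change its action, and associativity
  of the free group becomes composition of actions (the trick of van der Waerden).\<close>

lemma foldr_red_cons_red_cons:
  assumes "freely_reduced w"
  shows "foldr red_cons (red_cons l u) w = red_cons l (foldr red_cons u w)"
proof (cases u)
  case (Cons y u')
  show ?thesis
  proof (cases "y = inv_letter l")
    case True
    have "red_cons l (red_cons (inv_letter l) (foldr red_cons u' w)) = foldr red_cons u' w"
      using red_cons_inverse[of "foldr red_cons u' w" "inv_letter l"] assms
      by (simp add: foldr_red_cons_reduced)
    with True Cons show ?thesis by (simp add: red_cons_def)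
  qed (use Cons in \<open>simp add: red_cons_def\<close>)
qed (simp add: red_cons_def)

lemma foldr_free_reduce:
  "freely_reduced w \<Longrightarrow> foldr red_cons (free_reduce u) w = foldr red_cons u w"
  unfolding free_reduce_def by (induction u) (auto simp: foldr_red_cons_red_cons)

lemma free_reduce_append: "free_reduce (u @ v) = foldr red_cons u (free_reduce v)"
  by (simp add: free_reduce_def)

lemma free_reduce_append_left: "free_reduce (free_reduce u @ v) = free_reduce (u @ v)"
  by (simp add: free_reduce_append foldr_free_reduce free_reduce_reduced)

lemma free_reduce_append_right: "free_reduce (u @ free_reduce v) = free_reduce (u @ v)"
  by (simp add: free_reduce_append free_reduce_id free_reduce_reduced)

lemma set_free_reduce: "set (free_reduce u) \<subseteq> set u"
proof -
  have "set (red_cons l w) \<subseteq> insert l (set w)" for l w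
    by (cases w) (auto simp: red_cons_def)
  then show ?thesis unfolding free_reduce_def by (induction u) force+
qed

lemma foldr_red_cons_inverse:
  "freely_reduced w \<Longrightarrow> foldr red_cons (rev (map inv_letter u)) (foldr red_cons u w) = w"
proof (induction u arbitrary: w)
  case (Cons l u)
  then show ?case by (simp add: red_cons_inverse foldr_red_cons_reduced)
qed simp

lemma group_free_group: "group (free_group r)"
proof (rule groupI)
  fix x y assume "x \<in> carrier (free_group r)" "y \<in> carrier (free_group r)"
  then show "x \<otimes>\<^bsub>free_group r\<^esub> y \<in> carrier (free_group r)"
    using set_free_reduce[of "x @ y"] by (auto simp: free_group_def free_reduce_reduced)
next
  fix x y z
  show "x \<otimes>\<^bsub>free_group r\<^esub> y \<otimes>\<^bsub>free_group r\<^esub> z = x \<otimes>\<^bsub>free_group r\<^esub> (y \<otimes>\<^bsub>free_group r\<^esub> z)"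
    by (simp add: free_group_def free_reduce_append_left free_reduce_append_right)
next
  fix x assume x: "x \<in> carrier (free_group r)"
  then show "\<one>\<^bsub>free_group r\<^esub> \<otimes>\<^bsub>free_group r\<^esub> x = x"
    by (simp add: free_group_def free_reduce_id)
  let ?y = "free_reduce (rev (map inv_letter x))"
  have "set ?y \<subseteq> set (rev (map inv_letter x))" by (rule set_free_reduce)
  moreover have "\<forall>l\<in>set (rev (map inv_letter x)). snd l < r"
    using x by (auto simp: free_group_def inv_letter_def)
  ultimately have "\<forall>l\<in>set ?y. snd l < r" by blast
  then have "?y \<in> carrier (free_group r)" by (simp add: free_group_def free_reduce_reduced)
  moreover have "?y \<otimes>\<^bsub>free_group r\<^esub> x = \<one>\<^bsub>free_group r\<^esub>"
    using foldr_red_cons_inverse[of "[]" x]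
    by (simp add: free_group_def free_reduce_append_left) (simp add: free_reduce_def)
  ultimately show "\<exists>y\<in>carrier (free_group r). y \<otimes>\<^bsub>free_group r\<^esub> x = \<one>\<^bsub>free_group r\<^esub>" by blast
qed (simp add: free_group_def)

definition letter_val :: "('h, 'b) monoid_scheme \<Rightarrow> (nat \<Rightarrow> 'h) \<Rightarrow> bool \<times> nat \<Rightarrow> 'h" where
  "letter_val H g l = (if fst l then g (snd l) else inv\<^bsub>H\<^esub> g (snd l))"

lemma free_group_lift_hom:
  assumes "group H" "\<And>i. g i \<in> carrier H"
  shows "word_prod H (letter_val H g) \<in> hom (free_group r) H"
proof -
  interpret group H by fact
  have val: "letter_val H g l \<in> carrier H" for l using assms(2) by (simp add: letter_val_def)
  have inv: "letter_val H g l \<otimes>\<^bsub>H\<^esub> letter_val H g (inv_letter l) = \<one>\<^bsub>H\<^esub>" for l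
    using assms(2) by (simp add: letter_val_def inv_letter_def)
  have cons: "word_prod H (letter_val H g) (red_cons l w) =
      letter_val H g l \<otimes>\<^bsub>H\<^esub> word_prod H (letter_val H g) w" for l w
  proof (cases w)
    case (Cons y w')
    show ?thesis
    proof (cases "y = inv_letter l")
      case True
      have "letter_val H g l \<otimes>\<^bsub>H\<^esub> (letter_val H g y \<otimes>\<^bsub>H\<^esub> word_prod H (letter_val H g) w')
          = word_prod H (letter_val H g) w'"
        using inv[of l] val True by (simp flip: m_assoc)
      with True Cons show ?thesis by (simp add: red_cons_def)
    qed (use Cons in \<open>simp add: red_cons_def\<close>)
  qed (simp add: red_cons_def)
  have red: "word_prod H (letter_val H g) (free_reduce w) = word_prod H (letter_val H g) w" for w
    unfolding free_reduce_def by (induction w) (simp_all add: cons)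
  show ?thesis
    unfolding hom_def using val by (auto simp: free_group_def red word_prod_append)
qed

lemma hom_word_prod:
  assumes "group G" "group H" "\<phi> \<in> hom G H" "\<And>c. c \<in> set w \<Longrightarrow> g c \<in> carrier G"
  shows "\<phi> (word_prod G g w) = word_prod H (\<lambda>c. \<phi> (g c)) w"
proof -
  interpret group_hom G H \<phi> using assms(1-3) by (simp add: group_hom_def group_hom_axioms_def)
  show ?thesis using assms(4) by (induction w) auto
qed

section \<open>Free submonoids detected by affine maps of the rationals\<close>

lemma comm_monoid_integer_group: "comm_monoid integer_group"
  by (rule comm_monoidI) (auto simp: integer_group_def)

lemma Lw_lin_integer_group_subset:
  fixes G (structure)
  assumes "group G" "x \<in> carrier G" "\<And>n :: nat. x [^]\<^bsub>G\<^esub> n = \<one>\<^bsub>G\<^esub> \<Longrightarrow> n = 0"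
  shows "Lw_lin integer_group \<subseteq> Lw_lin G"
proof -
  interpret group G by fact
  show ?thesis
  proof (rule Lw_lin_embed)
    show "Group.monoid integer_group" by (simp add: group.is_monoid)
    show "(\<lambda>n :: int. x [^]\<^bsub>G\<^esub> n) \<in> hom integer_group G"
      using assms(2) by (auto simp: hom_def int_pow_mult)
    fix n :: int assume "x [^]\<^bsub>G\<^esub> n = \<one>\<^bsub>G\<^esub>"
    then have *: "(if n < 0 then inv (x [^] nat (- n)) else x [^] nat n) = \<one>"
      by (simp only: int_pow_def2)
    have "x [^] nat (- n) \<in> carrier G" using assms(2) by simp
    then have "nat n = 0 \<and> nat (- n) = 0"
      using * assms(3)[of "nat n"] assms(3)[of "nat (- n)"] inv_eq_1_iff[of "x [^] nat (- n)"]
      by (cases "n < 0") simp_all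
    then show "n = \<one>\<^bsub>integer_group\<^esub>" by simp
  qed simp
qed

text \<open>The pair \<open>(u, s)\<close> stands for the map t -> u + s t, and the multiplication
  is composition. In this picture \<open>BS12\<close> acts with \<open>a\<close> as t -> t + 1 and
  \<open>b\<close> as t -> 2t.\<close>

definition affine_group :: "(rat \<times> rat) monoid" where
  "affine_group = \<lparr>carrier = {z. snd z \<noteq> 0},
     mult = (\<lambda>x y. (fst x + snd x * fst y, snd x * snd y)), one = (0, 1)\<rparr>"

lemma group_affine_group: "group affine_group"
proof (rule groupI)
  fix x assume x: "x \<in> carrier affine_group"
  show "\<exists>y\<in>carrier affine_group. y \<otimes>\<^bsub>affine_group\<^esub> x = \<one>\<^bsub>affine_group\<^esub>"
    using x by (intro bexI[of _ "(- fst x / snd x, 1 / snd x)"]) (auto simp: affine_group_def field_simps)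
qed (auto simp: affine_group_def algebra_simps)

lemma inv_affine_group: "s \<noteq> 0 \<Longrightarrow> inv\<^bsub>affine_group\<^esub> (u, s) = (- u / s, 1 / s)"
  by (rule group.inv_equality[OF group_affine_group]) (auto simp: affine_group_def field_simps)

text \<open>Ping-pong for monoids: products stay in \<open>S\<close>, and the disjoint images of
  \<open>S\<close> under the two generators reveal the first letter, which is then cancelled. Equal
  lengths exclude the comparison of the empty word with a longer one.\<close>

lemma word_prod_inj_on:
  assumes "Group.monoid G" and g: "\<And>c. g c \<in> carrier G"
    and cancel: "\<And>c x y. x \<in> carrier G \<Longrightarrow> y \<in> carrier G \<Longrightarrow> g c \<otimes>\<^bsub>G\<^esub> x = g c \<otimes>\<^bsub>G\<^esub> y \<Longrightarrow> x = y"
    and S: "\<one>\<^bsub>G\<^esub> \<in> S" "\<And>c s. c \<in> {0, 1} \<Longrightarrow> s \<in> S \<Longrightarrow> g c \<otimes>\<^bsub>G\<^esub> s \<in> S"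
    and disj: "\<And>s t. s \<in> S \<Longrightarrow> t \<in> S \<Longrightarrow> g 0 \<otimes>\<^bsub>G\<^esub> s \<noteq> g 1 \<otimes>\<^bsub>G\<^esub> t"
  shows "inj_on (word_prod G g) {w :: nat list. set w \<subseteq> {0, 1} \<and> length w = n}"
proof -
  interpret monoid G by fact
  have mem: "word_prod G g w \<in> S" if "set w \<subseteq> {0, 1}" for w
    using that by (induction w) (auto intro: S)
  have "w = v" if "set w \<subseteq> {0, 1}" "set v \<subseteq> {0, 1}" "length w = length v"
    "word_prod G g w = word_prod G g v" for w v
    using that
  proof (induction w arbitrary: v)
    case (Cons c w)
    then obtain d v' where v: "v = d # v'" by (cases v) auto
    have "c = d"
    proof (rule ccontr)
      assume "c \<noteq> d"
      then have "c = 0 \<and> d = 1 \<or> c = 1 \<and> d = 0" using Cons.prems v by auto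
      then show False
        using disj[OF mem[of w] mem[of v']] disj[OF mem[of v'] mem[of w]] Cons.prems v by auto
    qed
    then have "g c \<otimes>\<^bsub>G\<^esub> word_prod G g w = g c \<otimes>\<^bsub>G\<^esub> word_prod G g v'"
      using Cons.prems(4) v by simp
    then have "word_prod G g w = word_prod G g v'"
      by (rule cancel[rotated 2]) (simp_all add: g)
    with Cons.IH[of v'] Cons.prems(1-3) v \<open>c = d\<close> show ?case by simp
  qed simp
  then show ?thesis by (intro inj_onI) auto
qed

text \<open>A product of t -> 2t and t -> 2t + 1 has as its translation part the number whose binary
  digits, least significant first, are the letters. The parity of this integer is the first letter.
  Distinct images under \<open>\<phi>\<close> have distinct preimages, so all words of length
  \<open>n\<close> have different values in \<open>G\<close> as well.\<close>

lemma not_subset_Lw_lin_comm: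
  fixes G (structure)
  assumes "group G" "\<phi> \<in> hom G affine_group" "x \<in> carrier G" "y \<in> carrier G"
    "\<phi> x = (0, 2)" "\<phi> y = (1, 2)" "comm_monoid H"
  shows "\<not> Lw_lin G \<subseteq> Lw_lin H"
proof -
  interpret group G by fact
  define g where "g c = (if c = 0 then x else y)" for c :: nat
  have g: "g c \<in> carrier G" for c using assms by (simp add: g_def)
  interpret A: group affine_group by (rule group_affine_group)
  have \<phi>g: "\<phi> (g c) = (if c = 0 then (0, 2) else (1, 2))" for c
    using assms by (simp add: g_def)
  have injA: "inj_on (word_prod affine_group (\<lambda>c. \<phi> (g c))) {w :: nat list. set w \<subseteq> {0, 1} \<and> length w = n}" for n
  proof (rule word_prod_inj_on[OF A.is_monoid, where S = "{z. fst z \<in> \<int>}"])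
    show "\<phi> (g c) \<in> carrier affine_group" for c by (simp add: \<phi>g affine_group_def)
    then show "a = b" if "a \<in> carrier affine_group" "b \<in> carrier affine_group"
      "\<phi> (g c) \<otimes>\<^bsub>affine_group\<^esub> a = \<phi> (g c) \<otimes>\<^bsub>affine_group\<^esub> b" for c a b
      using that A.l_cancel by blast
    fix s t :: "rat \<times> rat" assume "s \<in> {z. fst z \<in> \<int>}" "t \<in> {z. fst z \<in> \<int>}"
    then obtain i j where ij: "fst s = of_int i" "fst t = of_int j" by (auto elim!: Ints_cases)
    have "2 * i \<noteq> 1 + 2 * j" by presburger
    then have "(2 * of_int i :: rat) \<noteq> 1 + 2 * of_int j"
      by (metis of_int_1 of_int_add of_int_eq_iff of_int_mult of_int_numeral)
    then show "\<phi> (g 0) \<otimes>\<^bsub>affine_group\<^esub> s \<noteq> \<phi> (g 1) \<otimes>\<^bsub>affine_group\<^esub> t"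
      using ij by (simp add: \<phi>g affine_group_def)
  qed (auto simp: \<phi>g affine_group_def)
  have eq: "word_prod affine_group (\<lambda>c. \<phi> (g c)) = \<phi> \<circ> word_prod G g"
  proof
    fix w
    show "word_prod affine_group (\<lambda>c. \<phi> (g c)) w = (\<phi> \<circ> word_prod G g) w"
      using hom_word_prod[OF assms(1) group_affine_group assms(2), of w g] g by simp
  qed
  have inj: "inj_on (word_prod G g) {w :: nat list. set w \<subseteq> {0, 1} \<and> length w = n}" for n
    using injA[of n] unfolding eq by (rule inj_on_imageI2)
  have "mirror (word_prod G g) \<notin> Lw_lin H"
    by (rule mirror_not_comm[OF assms(7) inj])
  moreover have "mirror (word_prod G g) \<in> Lw_lin G"
    by (rule mirror_in_Lw_lin[where h = "\<lambda>c. inv g c"]) (use g in auto)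
  ultimately show ?thesis by blast
qed

section \<open>The Baumslag--Solitar group\<close>

text \<open>Everything that is later drawn from the presentation: the relation yields equalities in
  the quotient, and the homomorphism \<open>\<psi>\<close> to affine maps yields
  inequalities.\<close>

lemma BS12_affine:
  obtains a b \<psi> where "group BS12" "a \<in> carrier BS12" "b \<in> carrier BS12"
    "\<psi> \<in> hom BS12 affine_group" "\<psi> a = (1, 1)" "\<psi> b = (0, 2)"
    "b \<otimes>\<^bsub>BS12\<^esub> a = a \<otimes>\<^bsub>BS12\<^esub> a \<otimes>\<^bsub>BS12\<^esub> b"
proof -
  define F where "F = free_group 2"
  interpret F: group F unfolding F_def by (rule group_free_group)
  define R where "R = {g \<otimes>\<^bsub>F\<^esub> BS12_relator \<otimes>\<^bsub>F\<^esub> inv\<^bsub>F\<^esub> g | g. g \<in> carrier F}"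
  define N where "N = generate F R"
  have BS: "BS12 = F Mod N" by (simp add: BS12_def F_def N_def R_def)
  have r: "BS12_relator \<in> carrier F"
    by (simp add: F_def free_group_def BS12_relator_def freely_reduced_Cons inv_letter_def)
  have RF: "R \<subseteq> carrier F" unfolding R_def using r by auto
  have "N \<lhd> F" unfolding N_def
  proof (rule F.normal_generateI[OF RF])
    fix h g assume "h \<in> R" and g: "g \<in> carrier F"
    then obtain k where k: "h = k \<otimes>\<^bsub>F\<^esub> BS12_relator \<otimes>\<^bsub>F\<^esub> inv\<^bsub>F\<^esub> k" "k \<in> carrier F"
      unfolding R_def by blast
    have "g \<otimes>\<^bsub>F\<^esub> h \<otimes>\<^bsub>F\<^esub> inv\<^bsub>F\<^esub> g = (g \<otimes>\<^bsub>F\<^esub> k) \<otimes>\<^bsub>F\<^esub> BS12_relator \<otimes>\<^bsub>F\<^esub> inv\<^bsub>F\<^esub> (g \<otimes>\<^bsub>F\<^esub> k)"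
      using g k r by (simp add: F.m_assoc F.inv_mult_group)
    then show "g \<otimes>\<^bsub>F\<^esub> h \<otimes>\<^bsub>F\<^esub> inv\<^bsub>F\<^esub> g \<in> R" unfolding R_def using g k(2) F.m_closed by blast
  qed
  then interpret N: normal N F .
  have gBS: "group BS12" unfolding BS by (rule N.factorgroup_is_group)
  define c where "c = (\<lambda>w. N #>\<^bsub>F\<^esub> w)"
  have c: "c \<in> hom F BS12" unfolding BS c_def by (rule N.r_coset_hom_Mod)
  interpret A: group affine_group by (rule group_affine_group)
  define g :: "nat \<Rightarrow> rat \<times> rat" where "g i = (if i = 0 then (1, 1) else (0, 2))" for i
  define \<theta> where "\<theta> = word_prod affine_group (letter_val affine_group g)"
  have gA: "g i \<in> carrier affine_group" for i by (simp add: g_def affine_group_def)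
  have \<theta>: "\<theta> \<in> hom F affine_group"
    unfolding \<theta>_def F_def by (rule free_group_lift_hom[OF group_affine_group gA])
  interpret \<theta>: group_hom F affine_group \<theta>
    using \<theta> by unfold_locales
  have "\<theta> BS12_relator = \<one>\<^bsub>affine_group\<^esub>"
    by (simp add: \<theta>_def BS12_relator_def letter_val_def g_def inv_affine_group)
       (simp add: affine_group_def)
  then have "R \<subseteq> kernel F affine_group \<theta>" using r RF by (auto simp: R_def kernel_def)
  then have "N \<subseteq> kernel F affine_group \<theta>" unfolding N_def
    by (rule F.generate_subgroup_incl) (rule \<theta>.subgroup_kernel)
  from \<theta>.FactGroup_universal_kernel[OF \<open>N \<lhd> F\<close> this] obtain \<psi> where
    \<psi>: "\<psi> \<in> hom BS12 affine_group" "\<And>x. x \<in> carrier F \<Longrightarrow> \<psi> (c x) = \<theta> x"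
    unfolding BS c_def by blast
  let ?a = "[(True, 0)] :: (bool \<times> nat) list" and ?b = "[(True, 1)] :: (bool \<times> nat) list"
  have ab: "?a \<in> carrier F" "?b \<in> carrier F"
    by (simp_all add: F_def free_group_def freely_reduced_Cons)
  \<comment> \<open>Already in the free group \<open>b a\<close> equals the relator times
    \<open>a a b\<close>, so the relation of the quotient follows as soon as the relator becomes
    trivial.\<close>
  have fr: "?b \<otimes>\<^bsub>F\<^esub> ?a = BS12_relator \<otimes>\<^bsub>F\<^esub> (?a \<otimes>\<^bsub>F\<^esub> ?a \<otimes>\<^bsub>F\<^esub> ?b)"
    by (simp add: F_def free_group_def BS12_relator_def free_reduce_def red_cons_def inv_letter_def)
  have "BS12_relator \<in> R"
    unfolding R_def using r by (intro CollectI exI[of _ "\<one>\<^bsub>F\<^esub>"]) auto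
  then have "BS12_relator \<in> N" unfolding N_def by (rule generate.incl)
  then have "c BS12_relator = N" unfolding c_def
    by (rule F.coset_join2[OF r N.subgroup_axioms])
  then have cr: "c BS12_relator = \<one>\<^bsub>BS12\<^esub>" unfolding BS by (simp add: FactGroup_def)
  interpret B: group BS12 by (rule gBS)
  have cc: "c x \<in> carrier BS12" if "x \<in> carrier F" for x using c that by (rule hom_in_carrier)
  have "c (?b \<otimes>\<^bsub>F\<^esub> ?a) = c BS12_relator \<otimes>\<^bsub>BS12\<^esub> c (?a \<otimes>\<^bsub>F\<^esub> ?a \<otimes>\<^bsub>F\<^esub> ?b)"
    unfolding fr by (rule hom_mult[OF c]) (use r ab in auto)
  then have "c ?b \<otimes>\<^bsub>BS12\<^esub> c ?a = c ?a \<otimes>\<^bsub>BS12\<^esub> c ?a \<otimes>\<^bsub>BS12\<^esub> c ?b"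
    using ab cc by (simp add: cr hom_mult[OF c])
  moreover have "\<psi> (c ?a) = (1, 1)" "\<psi> (c ?b) = (0, 2)"
    using ab by (simp_all add: \<psi>(2) \<theta>_def letter_val_def g_def affine_group_def)
  ultimately show thesis using that[OF gBS _ _ \<psi>(1)] cc ab by blast
qed

lemma affine_group_pow:
  "(1, 1) [^]\<^bsub>affine_group\<^esub> (n :: nat) = (of_nat n, 1)"
  "(0, 2) [^]\<^bsub>affine_group\<^esub> (n :: nat) = (0, 2 ^ n)"
proof -
  interpret A: group affine_group by (rule group_affine_group)
  show "(1, 1) [^]\<^bsub>affine_group\<^esub> n = (of_nat n, 1)"
    by (induction n) (auto simp: affine_group_def)
  show "(0, 2) [^]\<^bsub>affine_group\<^esub> n = (0, 2 ^ n)"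
    by (induction n) (auto simp: affine_group_def)
qed

lemma Lw_lin_integer_group_psubset_BS12: "Lw_lin integer_group \<subset> Lw_lin BS12"
proof -
  obtain a b \<psi> where *: "group BS12" "a \<in> carrier BS12" "b \<in> carrier BS12"
    "\<psi> \<in> hom BS12 affine_group" "\<psi> a = (1, 1)" "\<psi> b = (0, 2)"
    "b \<otimes>\<^bsub>BS12\<^esub> a = a \<otimes>\<^bsub>BS12\<^esub> a \<otimes>\<^bsub>BS12\<^esub> b"
    by (rule BS12_affine)
  interpret B: group BS12 by fact
  interpret \<psi>: group_hom BS12 affine_group \<psi>
    using *(4) group_affine_group by (intro group_hom.intro) (auto simp: group_hom_axioms_def B.is_group)
  have "n = 0" if "a [^]\<^bsub>BS12\<^esub> (n :: nat) = \<one>\<^bsub>BS12\<^esub>" for n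
  proof -
    have "\<psi> (a [^]\<^bsub>BS12\<^esub> n) = (of_nat n, 1)"
      using *(2) by (simp add: \<psi>.hom_nat_pow *(5) affine_group_pow)
    then show ?thesis using that by (simp add: affine_group_def)
  qed
  then have "Lw_lin integer_group \<subseteq> Lw_lin BS12"
    by (rule Lw_lin_integer_group_subset[OF *(1,2)])
  moreover have "\<not> Lw_lin BS12 \<subseteq> Lw_lin integer_group"
  proof (rule not_subset_Lw_lin_comm[OF *(1,4)])
    show "\<psi> (a \<otimes>\<^bsub>BS12\<^esub> b) = (1, 2)"
      using *(2,3) by (simp add: *(5,6)) (simp add: affine_group_def)
    show "comm_monoid integer_group" by (rule comm_monoid_integer_group)
  qed (use * in auto)
  ultimately show ?thesis by blast
qed

text \<open>The input \<open>0^n 1^m 2^k\<close> leaves the register at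
  \<open>b^n a b^-m a^-k\<close>. As \<open>b^n a = a^(2^n) b^n\<close>, this is the identity
  exactly if \<open>a^(2^n) b^n = a^k b^m\<close>.\<close>

lemma exp_lang_BS12: "exp_lang \<in> Lw_lin BS12"
proof -
  obtain a b \<psi> where *: "group BS12" "a \<in> carrier BS12" "b \<in> carrier BS12"
    "\<psi> \<in> hom BS12 affine_group" "\<psi> a = (1, 1)" "\<psi> b = (0, 2)"
    "b \<otimes>\<^bsub>BS12\<^esub> a = a \<otimes>\<^bsub>BS12\<^esub> a \<otimes>\<^bsub>BS12\<^esub> b"
    by (rule BS12_affine)
  define G where "G = BS12"
  note * = *[folded G_def]
  interpret group G by (rule *(1))
  interpret \<psi>: group_hom G affine_group \<psi>
    using *(4) group_affine_group by (intro group_hom.intro) (auto simp: group_hom_axioms_def is_group)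
  note [simp] = *(2,3)
  have pc: "c \<otimes>\<^bsub>G\<^esub> c [^]\<^bsub>G\<^esub> (k :: nat) = c [^]\<^bsub>G\<^esub> k \<otimes>\<^bsub>G\<^esub> c" if "c \<in> carrier G" for c k
    using that by (metis nat_pow_Suc nat_pow_Suc2)
  have pc2: "c \<otimes>\<^bsub>G\<^esub> (c [^]\<^bsub>G\<^esub> (k :: nat) \<otimes>\<^bsub>G\<^esub> z) = c [^]\<^bsub>G\<^esub> k \<otimes>\<^bsub>G\<^esub> (c \<otimes>\<^bsub>G\<^esub> z)"
    if "c \<in> carrier G" "z \<in> carrier G" for c z k
    using that by (simp add: pc flip: m_assoc)
  let ?a = "inv\<^bsub>G\<^esub> a" and ?b = "inv\<^bsub>G\<^esub> b"
  \<comment> \<open>The single factor \<open>a\<close> is multiplied in together with the first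
    \<open>b^-1\<close>, on the transition from state 0 to state 1; this keeps the automaton free of
    empty moves.\<close>
  define e :: "nat \<Rightarrow> nat \<Rightarrow> (nat \<times> (bool \<times> nat) list set) option" where
    "e q s = (if q = 0 \<and> s = 0 then Some (0, b) else if q = 0 \<and> s = 1 then Some (1, a \<otimes>\<^bsub>G\<^esub> ?b)
      else if q = 1 \<and> s = 1 then Some (1, ?b) else if q \<in> {1, 2} \<and> s = 2 then Some (2, ?a) else None)" for q s
  have e: "e 0 0 = Some (0, b)" "e 0 (Suc 0) = Some (1, a \<otimes>\<^bsub>G\<^esub> ?b)" "e (Suc 0) (Suc 0) = Some (1, ?b)"
    "e (Suc 0) 2 = Some (2, ?a)" "e 2 2 = Some (2, ?a)" by (simp_all add: e_def)
  have run2: "drun G e 2 x w = Some (2, y) \<longleftrightarrow> (\<exists>k. w = replicate k 2 \<and> y = x \<otimes>\<^bsub>G\<^esub> ?a [^]\<^bsub>G\<^esub> k)"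
    if "x \<in> carrier G" for x y w
    using that
  proof (induction w arbitrary: x)
    case (Cons s w)
    show ?case
    proof (cases "s = 2")
      case True
      have "drun G e 2 x (s # w) = Some (2, y) \<longleftrightarrow>
          (\<exists>k. w = replicate k 2 \<and> y = (x \<otimes>\<^bsub>G\<^esub> ?a) \<otimes>\<^bsub>G\<^esub> ?a [^]\<^bsub>G\<^esub> k)"
        using Cons by (simp add: True e)
      also have "\<dots> \<longleftrightarrow> (\<exists>k. s # w = replicate (Suc k) 2 \<and> y = x \<otimes>\<^bsub>G\<^esub> ?a [^]\<^bsub>G\<^esub> Suc k)"
        using Cons.prems by (simp add: True m_assoc pc pc2)
      also have "\<dots> \<longleftrightarrow> (\<exists>k. s # w = replicate k 2 \<and> y = x \<otimes>\<^bsub>G\<^esub> ?a [^]\<^bsub>G\<^esub> k)"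
        by (metis list.distinct(1) not0_implies_Suc replicate_0)
      finally show ?thesis .
    next
      case False
      then have "e 2 s = None" by (simp add: e_def)
      moreover have "s # w \<noteq> replicate k 2" for k using False by (cases k) auto
      ultimately show ?thesis by simp
    qed
  qed auto
  have run1: "drun G e 1 x w = Some (2, y) \<longleftrightarrow> (\<exists>m k. k \<ge> 1 \<and> w = replicate m 1 @ replicate k 2 \<and>
      y = x \<otimes>\<^bsub>G\<^esub> (?b [^]\<^bsub>G\<^esub> m \<otimes>\<^bsub>G\<^esub> ?a [^]\<^bsub>G\<^esub> k))" (is "_ \<longleftrightarrow> ?R x w")
    if "x \<in> carrier G" for x y w
    using that
  proof (induction w arbitrary: x)
    case (Cons s w)
    consider "s = 1" | "s = 2" | "s \<noteq> 1 \<and> s \<noteq> 2" by blast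
    then show ?case
    proof cases
      case 1
      have "drun G e 1 x (s # w) = Some (2, y) \<longleftrightarrow> ?R (x \<otimes>\<^bsub>G\<^esub> ?b) w"
        using Cons by (simp add: 1 e)
      also have "\<dots> \<longleftrightarrow> ?R x (s # w)"
      proof
        assume "?R (x \<otimes>\<^bsub>G\<^esub> ?b) w"
        then obtain m k where "k \<ge> 1" "w = replicate m 1 @ replicate k 2"
          "y = (x \<otimes>\<^bsub>G\<^esub> ?b) \<otimes>\<^bsub>G\<^esub> (?b [^]\<^bsub>G\<^esub> m \<otimes>\<^bsub>G\<^esub> ?a [^]\<^bsub>G\<^esub> k)" by blast
        then show "?R x (s # w)" using Cons.prems
          by (intro exI[of _ "Suc m"] exI[of _ k]) (simp add: 1 m_assoc pc pc2)
      next
        assume "?R x (s # w)"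
        then obtain m k where mk: "k \<ge> 1" "s # w = replicate m 1 @ replicate k 2"
          "y = x \<otimes>\<^bsub>G\<^esub> (?b [^]\<^bsub>G\<^esub> m \<otimes>\<^bsub>G\<^esub> ?a [^]\<^bsub>G\<^esub> k)" by blast
        with 1 obtain m' where "m = Suc m'" by (cases m; cases k) auto
        with mk show "?R (x \<otimes>\<^bsub>G\<^esub> ?b) w" using Cons.prems
          by (intro exI[of _ m'] exI[of _ k]) (simp add: m_assoc pc pc2)
      qed
      finally show ?thesis .
    next
      case 2
      have "drun G e 1 x (s # w) = Some (2, y) \<longleftrightarrow>
          (\<exists>k. w = replicate k 2 \<and> y = (x \<otimes>\<^bsub>G\<^esub> ?a) \<otimes>\<^bsub>G\<^esub> ?a [^]\<^bsub>G\<^esub> k)"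
        using Cons.prems by (simp add: 2 e run2)
      also have "\<dots> \<longleftrightarrow> ?R x (s # w)"
      proof
        assume "\<exists>k. w = replicate k 2 \<and> y = (x \<otimes>\<^bsub>G\<^esub> ?a) \<otimes>\<^bsub>G\<^esub> ?a [^]\<^bsub>G\<^esub> k"
        then obtain k where "w = replicate k 2" "y = (x \<otimes>\<^bsub>G\<^esub> ?a) \<otimes>\<^bsub>G\<^esub> ?a [^]\<^bsub>G\<^esub> k" by blast
        then show "?R x (s # w)" using Cons.prems
          by (intro exI[of _ 0] exI[of _ "Suc k"]) (simp add: 2 m_assoc pc pc2)
      next
        assume "?R x (s # w)"
        then obtain m k where mk: "k \<ge> 1" "s # w = replicate m 1 @ replicate k 2"
          "y = x \<otimes>\<^bsub>G\<^esub> (?b [^]\<^bsub>G\<^esub> m \<otimes>\<^bsub>G\<^esub> ?a [^]\<^bsub>G\<^esub> k)" by blast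
        with 2 have "m = 0" by (cases m) auto
        moreover from mk(1) obtain k' where "k = Suc k'" by (cases k) auto
        ultimately show "\<exists>k. w = replicate k 2 \<and> y = (x \<otimes>\<^bsub>G\<^esub> ?a) \<otimes>\<^bsub>G\<^esub> ?a [^]\<^bsub>G\<^esub> k"
          using mk Cons.prems by (intro exI[of _ k']) (simp add: m_assoc pc pc2)
      qed
      finally show ?thesis .
    next
      case 3
      then have "drun G e 1 x (s # w) = None" by (auto simp: e_def)
      moreover have "\<not> ?R x (s # w)"
      proof
        assume "?R x (s # w)"
        then obtain m k where "s # w = replicate m 1 @ replicate k 2" by blast
        then have "s \<in> set (replicate m 1 @ replicate k 2)" by (metis list.set_intros(1))
        with 3 show False by auto
      qed
      ultimately show ?thesis by simp
    qed
  qed auto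
  have run0: "drun G e 0 x w = Some (2, y) \<longleftrightarrow> (\<exists>n m k. k \<ge> 1 \<and> m \<ge> 1 \<and>
      w = replicate n 0 @ replicate m 1 @ replicate k 2 \<and>
      y = x \<otimes>\<^bsub>G\<^esub> (b [^]\<^bsub>G\<^esub> n \<otimes>\<^bsub>G\<^esub> (a \<otimes>\<^bsub>G\<^esub> (?b [^]\<^bsub>G\<^esub> m \<otimes>\<^bsub>G\<^esub> ?a [^]\<^bsub>G\<^esub> k))))" (is "_ \<longleftrightarrow> ?R x w")
    if "x \<in> carrier G" for x y w
    using that
  proof (induction w arbitrary: x)
    case (Cons s w)
    consider "s = 0" | "s = 1" | "s \<noteq> 0 \<and> s \<noteq> 1" by blast
    then show ?case
    proof cases
      case 1
      have "drun G e 0 x (s # w) = Some (2, y) \<longleftrightarrow> ?R (x \<otimes>\<^bsub>G\<^esub> b) w"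
        using Cons by (simp add: 1 e)
      also have "\<dots> \<longleftrightarrow> ?R x (s # w)"
      proof
        assume "?R (x \<otimes>\<^bsub>G\<^esub> b) w"
        then obtain n m k where "k \<ge> 1" "m \<ge> 1" "w = replicate n 0 @ replicate m 1 @ replicate k 2"
          "y = (x \<otimes>\<^bsub>G\<^esub> b) \<otimes>\<^bsub>G\<^esub> (b [^]\<^bsub>G\<^esub> n \<otimes>\<^bsub>G\<^esub> (a \<otimes>\<^bsub>G\<^esub> (?b [^]\<^bsub>G\<^esub> m \<otimes>\<^bsub>G\<^esub> ?a [^]\<^bsub>G\<^esub> k)))" by blast
        then show "?R x (s # w)" using Cons.prems
          by (intro exI[of _ "Suc n"] exI[of _ m] exI[of _ k])
             (simp add: 1 m_assoc pc pc2)
      next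
        assume "?R x (s # w)"
        then obtain n m k where mk: "k \<ge> 1" "m \<ge> 1" "s # w = replicate n 0 @ replicate m 1 @ replicate k 2"
          "y = x \<otimes>\<^bsub>G\<^esub> (b [^]\<^bsub>G\<^esub> n \<otimes>\<^bsub>G\<^esub> (a \<otimes>\<^bsub>G\<^esub> (?b [^]\<^bsub>G\<^esub> m \<otimes>\<^bsub>G\<^esub> ?a [^]\<^bsub>G\<^esub> k)))" by blast
        with 1 obtain n' where "n = Suc n'" by (cases n; cases m) auto
        with mk show "?R (x \<otimes>\<^bsub>G\<^esub> b) w" using Cons.prems
          by (intro exI[of _ n'] exI[of _ m] exI[of _ k])
             (simp add: m_assoc pc pc2)
      qed
      finally show ?thesis .
    next
      case 2
      have "drun G e 0 x (s # w) = Some (2, y) \<longleftrightarrow> drun G e 1 (x \<otimes>\<^bsub>G\<^esub> (a \<otimes>\<^bsub>G\<^esub> ?b)) w = Some (2, y)"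
        by (simp add: 2 e)
      also have "\<dots> \<longleftrightarrow> (\<exists>m k. k \<ge> 1 \<and> w = replicate m 1 @ replicate k 2 \<and>
          y = (x \<otimes>\<^bsub>G\<^esub> (a \<otimes>\<^bsub>G\<^esub> ?b)) \<otimes>\<^bsub>G\<^esub> (?b [^]\<^bsub>G\<^esub> m \<otimes>\<^bsub>G\<^esub> ?a [^]\<^bsub>G\<^esub> k))"
        by (rule run1) (use Cons.prems in simp)
      also have "\<dots> \<longleftrightarrow> ?R x (s # w)" (is "?L \<longleftrightarrow> _")
      proof
        assume ?L
        then obtain m k where "k \<ge> 1" "w = replicate m 1 @ replicate k 2"
          "y = (x \<otimes>\<^bsub>G\<^esub> (a \<otimes>\<^bsub>G\<^esub> ?b)) \<otimes>\<^bsub>G\<^esub> (?b [^]\<^bsub>G\<^esub> m \<otimes>\<^bsub>G\<^esub> ?a [^]\<^bsub>G\<^esub> k)" by blast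
        then show "?R x (s # w)" using Cons.prems
          by (intro exI[of _ 0] exI[of _ "Suc m"] exI[of _ k])
             (simp add: 2 m_assoc pc pc2)
      next
        assume "?R x (s # w)"
        then obtain n m k where mk: "k \<ge> 1" "m \<ge> 1" "s # w = replicate n 0 @ replicate m 1 @ replicate k 2"
          "y = x \<otimes>\<^bsub>G\<^esub> (b [^]\<^bsub>G\<^esub> n \<otimes>\<^bsub>G\<^esub> (a \<otimes>\<^bsub>G\<^esub> (?b [^]\<^bsub>G\<^esub> m \<otimes>\<^bsub>G\<^esub> ?a [^]\<^bsub>G\<^esub> k)))" by blast
        with 2 have "n = 0" by (cases n) auto
        moreover from mk(2) obtain m' where "m = Suc m'" by (cases m) auto
        ultimately show ?L using mk Cons.prems
          by (intro exI[of _ m'] exI[of _ k]) (simp add: m_assoc pc pc2)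
      qed
      finally show ?thesis .
    next
      case 3
      then have "drun G e 0 x (s # w) = None" by (auto simp: e_def)
      moreover have "\<not> ?R x (s # w)"
      proof
        assume "?R x (s # w)"
        then obtain n m k where mk: "m \<ge> 1" "s # w = replicate n 0 @ replicate m 1 @ replicate k 2" by blast
        then show False using 3 by (cases n; cases m) auto
      qed
      ultimately show ?thesis by simp
    qed
  qed auto
  have ba: "b [^]\<^bsub>G\<^esub> n \<otimes>\<^bsub>G\<^esub> a = a [^]\<^bsub>G\<^esub> ((2 :: nat) ^ n) \<otimes>\<^bsub>G\<^esub> b [^]\<^bsub>G\<^esub> n" for n :: nat
  proof -
    have b1: "b \<otimes>\<^bsub>G\<^esub> a [^]\<^bsub>G\<^esub> j = a [^]\<^bsub>G\<^esub> (2 * j) \<otimes>\<^bsub>G\<^esub> b" for j :: nat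
    proof (induction j)
      case (Suc j)
      have "b \<otimes>\<^bsub>G\<^esub> a [^]\<^bsub>G\<^esub> Suc j = (b \<otimes>\<^bsub>G\<^esub> a [^]\<^bsub>G\<^esub> j) \<otimes>\<^bsub>G\<^esub> a" by (simp add: m_assoc)
      also have "\<dots> = a [^]\<^bsub>G\<^esub> (2 * j) \<otimes>\<^bsub>G\<^esub> (b \<otimes>\<^bsub>G\<^esub> a)" by (simp add: Suc m_assoc)
      also have "\<dots> = a [^]\<^bsub>G\<^esub> (2 * Suc j) \<otimes>\<^bsub>G\<^esub> b" by (simp add: *(7) m_assoc)
      finally show ?case .
    qed simp
    show ?thesis
    proof (induction n)
      case (Suc n)
      have "b [^]\<^bsub>G\<^esub> Suc n \<otimes>\<^bsub>G\<^esub> a = b \<otimes>\<^bsub>G\<^esub> (b [^]\<^bsub>G\<^esub> n \<otimes>\<^bsub>G\<^esub> a)"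
        by (simp add: m_assoc pc pc2)
      also have "\<dots> = (b \<otimes>\<^bsub>G\<^esub> a [^]\<^bsub>G\<^esub> ((2 :: nat) ^ n)) \<otimes>\<^bsub>G\<^esub> b [^]\<^bsub>G\<^esub> n"
        by (simp add: Suc m_assoc)
      also have "\<dots> = a [^]\<^bsub>G\<^esub> ((2 :: nat) ^ Suc n) \<otimes>\<^bsub>G\<^esub> b [^]\<^bsub>G\<^esub> Suc n"
        by (simp add: b1 m_assoc pc pc2)
      finally show ?case .
    qed simp
  qed
  have eq_one: "x \<otimes>\<^bsub>G\<^esub> inv\<^bsub>G\<^esub> y = \<one>\<^bsub>G\<^esub> \<longleftrightarrow> x = y" if "x \<in> carrier G" "y \<in> carrier G" for x y
    using inv_equality[of x "inv\<^bsub>G\<^esub> y"] that by auto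
  have key: "b [^]\<^bsub>G\<^esub> n \<otimes>\<^bsub>G\<^esub> (a \<otimes>\<^bsub>G\<^esub> (?b [^]\<^bsub>G\<^esub> m \<otimes>\<^bsub>G\<^esub> ?a [^]\<^bsub>G\<^esub> k)) = \<one>\<^bsub>G\<^esub> \<longleftrightarrow> m = n \<and> k = 2 ^ n"
    for n m k :: nat
  proof -
    have "b [^]\<^bsub>G\<^esub> n \<otimes>\<^bsub>G\<^esub> (a \<otimes>\<^bsub>G\<^esub> (?b [^]\<^bsub>G\<^esub> m \<otimes>\<^bsub>G\<^esub> ?a [^]\<^bsub>G\<^esub> k))
        = (b [^]\<^bsub>G\<^esub> n \<otimes>\<^bsub>G\<^esub> a) \<otimes>\<^bsub>G\<^esub> inv\<^bsub>G\<^esub> (a [^]\<^bsub>G\<^esub> k \<otimes>\<^bsub>G\<^esub> b [^]\<^bsub>G\<^esub> m)"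
      by (simp add: m_assoc inv_mult_group nat_pow_inv)
    also have "\<dots> = \<one>\<^bsub>G\<^esub> \<longleftrightarrow> b [^]\<^bsub>G\<^esub> n \<otimes>\<^bsub>G\<^esub> a = a [^]\<^bsub>G\<^esub> k \<otimes>\<^bsub>G\<^esub> b [^]\<^bsub>G\<^esub> m"
      by (rule eq_one) simp_all
    also have "\<dots> \<longleftrightarrow> a [^]\<^bsub>G\<^esub> ((2 :: nat) ^ n) \<otimes>\<^bsub>G\<^esub> b [^]\<^bsub>G\<^esub> n = a [^]\<^bsub>G\<^esub> k \<otimes>\<^bsub>G\<^esub> b [^]\<^bsub>G\<^esub> m"
      by (simp only: ba)
    also have "\<dots> \<longleftrightarrow> m = n \<and> k = 2 ^ n"
    proof
      \<comment> \<open>The image of \<open>a^i b^j\<close> is the map t -> i + 2^j t, from which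
        both exponents can be read off. This gives the direction that the relation alone cannot
        give.\<close>
      have \<psi>ab: "\<psi> (a [^]\<^bsub>G\<^esub> i \<otimes>\<^bsub>G\<^esub> b [^]\<^bsub>G\<^esub> j) = (of_nat i, 2 ^ j)" for i j :: nat
        by (simp add: \<psi>.hom_nat_pow *(5,6) affine_group_pow) (simp add: affine_group_def)
      assume "a [^]\<^bsub>G\<^esub> ((2 :: nat) ^ n) \<otimes>\<^bsub>G\<^esub> b [^]\<^bsub>G\<^esub> n = a [^]\<^bsub>G\<^esub> k \<otimes>\<^bsub>G\<^esub> b [^]\<^bsub>G\<^esub> m"
      from arg_cong[OF this, of \<psi>]
      have "(of_nat (2 ^ n) :: rat, (2 :: rat) ^ n) = (of_nat k, 2 ^ m)" by (simp only: \<psi>ab)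
      then have "(of_nat (2 ^ n) :: rat) = of_nat k" "(2 :: rat) ^ n = 2 ^ m"
        by (simp_all only: prod.inject)
      then have "2 ^ n = k" "n = m" by (simp_all only: of_nat_eq_iff) simp
      then show "m = n \<and> k = 2 ^ n" by simp
    qed simp
    finally show ?thesis .
  qed
  have "drun G e 0 \<one>\<^bsub>G\<^esub> w = Some (2, \<one>\<^bsub>G\<^esub>) \<longleftrightarrow> w \<in> exp_lang" for w
  proof -
    have "drun G e 0 \<one>\<^bsub>G\<^esub> w = Some (2, \<one>\<^bsub>G\<^esub>) \<longleftrightarrow> (\<exists>n m k. k \<ge> 1 \<and> m \<ge> 1 \<and>
      w = replicate n 0 @ replicate m 1 @ replicate k 2 \<and> m = n \<and> k = 2 ^ n)"
      using run0[of "\<one>\<^bsub>G\<^esub>" w "\<one>\<^bsub>G\<^esub>"] by (simp add: key eq_commute[of "\<one>\<^bsub>G\<^esub>"])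
    also have "\<dots> \<longleftrightarrow> w \<in> exp_lang" unfolding exp_lang_def by auto
    finally show ?thesis .
  qed
  moreover have "{w. \<exists>q\<in>{2}. drun G e 0 \<one>\<^bsub>G\<^esub> w = Some (q, \<one>\<^bsub>G\<^esub>)} \<in> Lw_lin G"
    by (rule Lw_lin_realtime[of "{0, 1, 2}" "{0, 1, 2}"])
       (auto simp: e_def split: if_splits)
  ultimately show ?thesis by (simp add: G_def)
qed

section \<open>Abelian groups and free groups\<close>

lemma comm_monoid_Zk: "comm_monoid (Zk k)"
  by (rule comm_monoidI) (auto simp: Zk_def algebra_simps)

lemma Lw_lin_Zk_mono: "k \<le> l \<Longrightarrow> Lw_lin (Zk k) \<subseteq> Lw_lin (Zk l)"
  by (rule Lw_lin_embed[where \<phi> = "\<lambda>f. f"])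
     (use comm_monoid_Zk[of k] in \<open>auto simp: comm_monoid_def Zk_def hom_def\<close>)

lemma Lw_lin_free_group_mono: "r \<le> s \<Longrightarrow> Lw_lin (free_group r) \<subseteq> Lw_lin (free_group s)"
  by (rule Lw_lin_embed[where \<phi> = "\<lambda>w. w"])
     (use group_free_group[of r] in \<open>auto simp: group_def free_group_def hom_def free_reduce_reduced
        intro: order_less_le_trans dest!: subsetD[OF set_free_reduce]\<close>)

lemma carrier_free_group_0: "carrier (free_group 0) = {[]}"
proof
  show "carrier (free_group 0) \<subseteq> {[]}"
  proof
    fix w assume "w \<in> carrier (free_group 0)"
    then show "w \<in> {[]}" by (cases w) (auto simp: free_group_def)
  qed
qed (simp add: free_group_def)

lemma freely_reduced_one_generator:
  assumes "freely_reduced w" "\<forall>l\<in>set w. snd l = 0"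
  shows "\<exists>n b. w = replicate n (b, 0)"
  using assms
proof (induction w)
  case (Cons l w)
  then obtain n b where w: "w = replicate n (b, 0)" by (auto simp: freely_reduced_Cons)
  obtain c where l: "l = (c, 0)" using Cons.prems by (cases l) auto
  show ?case
  proof (cases n)
    case 0
    then show ?thesis using w l by (intro exI[of _ 1] exI[of _ c]) simp
  next
    case (Suc n')
    then have "b = c" using Cons.prems w l by (auto simp: freely_reduced_Cons inv_letter_def)
    then show ?thesis using w l by (intro exI[of _ "Suc n"] exI[of _ c]) simp
  qed
qed simp

lemma Lw_lin_free_group_1: "Lw_lin (free_group 1) = Lw_lin integer_group"
proof
  interpret F: group "free_group 1" by (rule group_free_group)
  let ?\<phi> = "word_prod integer_group (letter_val integer_group (\<lambda>_. 1))"
  have \<phi>: "?\<phi> \<in> hom (free_group 1) integer_group"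
    by (rule free_group_lift_hom) simp_all
  interpret \<phi>: group_hom "free_group 1" integer_group ?\<phi>
    by (intro group_hom.intro group_hom_axioms.intro F.is_group group_integer_group \<phi>)
  have inv1: "inv\<^bsub>integer_group\<^esub> 1 = (- 1 :: int)"
    by (rule group.inv_equality) simp_all
  have val: "?\<phi> (replicate n (b, 0)) = (if b then int n else - int n)" for n b
    by (induction n) (auto simp: letter_val_def inv1)
  show "Lw_lin (free_group 1) \<subseteq> Lw_lin integer_group"
  proof (rule Lw_lin_embed[OF F.is_monoid \<phi>])
    fix w assume w: "w \<in> carrier (free_group 1)" "?\<phi> w = \<one>\<^bsub>integer_group\<^esub>"
    then have "freely_reduced w" "\<forall>l\<in>set w. snd l = 0" by (auto simp: free_group_def)
    then obtain n b where nb: "w = replicate n (b, 0)" using freely_reduced_one_generator by blast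
    with w(2) have "n = 0" by (simp add: val split: if_splits)
    with nb show "w = \<one>\<^bsub>free_group 1\<^esub>" by (simp add: free_group_def)
  qed (simp add: free_group_def)
  let ?x = "[(True, 0)] :: (bool \<times> nat) list"
  have x: "?x \<in> carrier (free_group 1)" by (simp add: free_group_def freely_reduced_Cons)
  show "Lw_lin integer_group \<subseteq> Lw_lin (free_group 1)"
  proof (rule Lw_lin_integer_group_subset[OF F.is_group x])
    fix n :: nat assume "?x [^]\<^bsub>free_group 1\<^esub> n = \<one>\<^bsub>free_group 1\<^esub>"
    then have "?\<phi> ?x [^]\<^bsub>integer_group\<^esub> n = \<one>\<^bsub>integer_group\<^esub>"
      using x \<phi>.hom_nat_pow[of ?x n] \<phi>.hom_one by simp
    moreover have "(1 :: int) [^]\<^bsub>integer_group\<^esub> n = int n"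
      by (induction n) (auto simp: nat_pow_def)
    ultimately show "n = 0" by (simp add: letter_val_def)
  qed
qed

lemma Lw_lin_integer_group_psubset_free_group_2: "Lw_lin integer_group \<subset> Lw_lin (free_group 2)"
proof -
  have "Lw_lin integer_group \<subseteq> Lw_lin (free_group 2)"
    unfolding Lw_lin_free_group_1[symmetric] by (rule Lw_lin_free_group_mono) simp
  moreover have "\<not> Lw_lin (free_group 2) \<subseteq> Lw_lin integer_group"
  proof -
    \<comment> \<open>The same affine maps as for \<open>BS12\<close>, t -> t + 1 and t -> 2t; the
      required map t -> 2t + 1 is the image of the product of the two generators.\<close>
    define g :: "nat \<Rightarrow> rat \<times> rat" where "g i = (if i = 0 then (1, 1) else (0, 2))" for i
    have g: "g i \<in> carrier affine_group" for i by (simp add: g_def affine_group_def)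
    show ?thesis
    proof (rule not_subset_Lw_lin_comm[OF group_free_group free_group_lift_hom[OF group_affine_group g]])
      show "comm_monoid integer_group" by (rule comm_monoid_integer_group)
      show "word_prod affine_group (letter_val affine_group g) [(True, 1)] = (0, 2)"
        "word_prod affine_group (letter_val affine_group g) [(True, 0), (True, 1)] = (1, 2)"
        by (simp_all add: letter_val_def g_def affine_group_def)
    qed (simp_all add: free_group_def freely_reduced_Cons inv_letter_def)
  qed
  ultimately show ?thesis by blast
qed

lemma Lw_lin_free_group_0_psubset_1: "Lw_lin (free_group 0) \<subset> Lw_lin (free_group 1)"
proof -
  define f where "f = word_prod integer_group (\<lambda>_ :: nat. 1)"
  have f: "f w = int (length w)" for w unfolding f_def by (induction w) auto
  have "mirror f \<in> Lw_lin integer_group" unfolding f_def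
    by (rule mirror_in_Lw_lin[where h = "\<lambda>_. -1"]) (simp_all add: group.is_monoid)
  moreover have "mirror f \<notin> Lw_lin (free_group 0)"
  proof
    assume "mirror f \<in> Lw_lin (free_group 0)"
    then obtain M c where M: "M \<subseteq> carrier (free_group 0)" and
      count: "\<And>n W. \<lbrakk>\<And>w. w \<in> W \<Longrightarrow> set w \<subseteq> {0, 1} \<and> length w \<le> n; inj_on f W\<rbrakk>
         \<Longrightarrow> card W \<le> c * card (ball_of (free_group 0) M (c * (n + 1)))"
      by (rule mirror_count) blast
    \<comment> \<open>These are \<open>c + 1\<close> words of pairwise different lengths at most
      \<open>c\<close>. A ball in the trivial group is a single point, so at most \<open>c\<close>
      of them can be told apart.\<close>
    define W where "W = (\<lambda>i. replicate i (0 :: nat)) ` {..c}"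
    have "card W = Suc c" unfolding W_def by (subst card_image) (auto simp: inj_on_def)
    moreover have "card W \<le> c * card (ball_of (free_group 0) M (c * (c + 1)))"
      by (rule count) (auto simp: W_def f inj_on_def)
    moreover have "card (ball_of (free_group 0) M (c * (c + 1))) \<le> 1"
    proof -
      have "ball_of (free_group 0) M (c * (c + 1)) \<subseteq> carrier (free_group 0)"
        by (rule ball_of_carrier[OF _ M]) (simp add: group.is_monoid group_free_group)
      then have "card (ball_of (free_group 0) M (c * (c + 1))) \<le> card {[] :: (bool \<times> nat) list}"
        by (intro card_mono) (simp_all only: carrier_free_group_0 finite.intros)
      then show ?thesis by simp
    qed
    then have "c * card (ball_of (free_group 0) M (c * (c + 1))) \<le> c * 1" by (rule mult_le_mono2)
    ultimately show False by linarith
  qed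
  ultimately show ?thesis
    using Lw_lin_free_group_mono[of 0 1] Lw_lin_free_group_1 by blast
qed

lemma CF_Zk_incomparable:
  assumes "k \<ge> 2"
  shows "\<not> CF \<subseteq> Lw_lin (Zk k)" "\<not> Lw_lin (Zk k) \<subseteq> CF"
proof -
  have "mirror (\<lambda>w. w) \<notin> Lw_lin (Zk k)"
    by (rule mirror_not_comm[OF comm_monoid_Zk]) (simp add: inj_on_def)
  then show "\<not> CF \<subseteq> Lw_lin (Zk k)" using mirror_id_CF by blast
  show "\<not> Lw_lin (Zk k) \<subseteq> CF"
    using abc_lang_not_CF abc_lang_Zk2 Lw_lin_Zk_mono[OF assms] by blast
qed

section \<open>Matrix groups\<close>

definition mat2 :: "'a \<Rightarrow> 'a \<Rightarrow> 'a \<Rightarrow> 'a \<Rightarrow> 'a :: comm_ring_1 ^ 2 ^ 2" where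
  "mat2 a b c d = vector [vector [a, b], vector [c, d]]"

lemma mat2_nth [simp]:
  "mat2 a b c d $ 1 $ 1 = a" "mat2 a b c d $ 1 $ 2 = b"
  "mat2 a b c d $ 2 $ 1 = c" "mat2 a b c d $ 2 $ 2 = d"
  by (simp_all add: mat2_def)

lemma mat2_eta: "mat2 (A $ 1 $ 1) (A $ 1 $ 2) (A $ 2 $ 1) (A $ 2 $ 2) = A"
  by (simp add: vec_eq_iff forall_2)

lemma mat2_cases: obtains a b c d where "A = mat2 a b c d"
  using mat2_eta[of A] by metis

lemma mat2_eq_iff [simp]: "mat2 a b c d = mat2 a' b' c' d' \<longleftrightarrow> a = a' \<and> b = b' \<and> c = c' \<and> d = d'"
  by (auto simp: vec_eq_iff forall_2)

lemma mat2_mult [simp]: "mat2 a b c d ** mat2 a' b' c' d' =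
    mat2 (a * a' + b * c') (a * b' + b * d') (c * a' + d * c') (c * b' + d * d')"
  by (simp add: vec_eq_iff forall_2 matrix_matrix_mult_def sum_2)

lemma det_mat2 [simp]: "det (mat2 a b c d) = a * d - b * c"
  by (simp add: det_2)

lemma mat_1_mat2: "mat 1 = mat2 1 0 0 1"
  by (simp add: vec_eq_iff forall_2 mat_def)

definition mat3 :: "'a \<Rightarrow> 'a \<Rightarrow> 'a \<Rightarrow> 'a \<Rightarrow> 'a \<Rightarrow> 'a \<Rightarrow> 'a \<Rightarrow> 'a \<Rightarrow> 'a \<Rightarrow> 'a :: comm_ring_1 ^ 3 ^ 3" where
  "mat3 a b c d e f g h i = vector [vector [a, b, c], vector [d, e, f], vector [g, h, i]]"

lemma mat3_nth [simp]:
  "mat3 a b c d e f g h i $ 1 $ 1 = a" "mat3 a b c d e f g h i $ 1 $ 2 = b" "mat3 a b c d e f g h i $ 1 $ 3 = c"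
  "mat3 a b c d e f g h i $ 2 $ 1 = d" "mat3 a b c d e f g h i $ 2 $ 2 = e" "mat3 a b c d e f g h i $ 2 $ 3 = f"
  "mat3 a b c d e f g h i $ 3 $ 1 = g" "mat3 a b c d e f g h i $ 3 $ 2 = h" "mat3 a b c d e f g h i $ 3 $ 3 = i"
  by (simp_all add: mat3_def)

lemma mat3_eq_iff [simp]: "mat3 a b c d e f g h i = mat3 a' b' c' d' e' f' g' h' i' \<longleftrightarrow>
    a = a' \<and> b = b' \<and> c = c' \<and> d = d' \<and> e = e' \<and> f = f' \<and> g = g' \<and> h = h' \<and> i = i'"
  by (auto simp: vec_eq_iff forall_3)

lemma mat3_mult [simp]: "mat3 a b c d e f g h i ** mat3 a' b' c' d' e' f' g' h' i' =
    mat3 (a * a' + b * d' + c * g') (a * b' + b * e' + c * h') (a * c' + b * f' + c * i')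
         (d * a' + e * d' + f * g') (d * b' + e * e' + f * h') (d * c' + e * f' + f * i')
         (g * a' + h * d' + i * g') (g * b' + h * e' + i * h') (g * c' + h * f' + i * i')"
  by (simp add: vec_eq_iff forall_3 matrix_matrix_mult_def sum_3)

lemma mat_1_mat3: "mat 1 = mat3 1 0 0 0 1 0 0 0 1"
  by (simp add: vec_eq_iff forall_3 mat_def)

section \<open>Comparisons between linear groups\<close>

lemma monoid_matrix:
  fixes P :: "'a :: comm_ring_1 ^ 'n ^ 'n \<Rightarrow> bool"
  assumes "P (mat 1)" "\<And>A B. P A \<Longrightarrow> P B \<Longrightarrow> P (A ** B)"
  shows "Group.monoid \<lparr>carrier = {A. P A}, mult = (**), one = mat 1\<rparr>"
  by (rule monoidI) (use assms in \<open>auto simp: matrix_mul_assoc\<close>)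

lemma monoid_SL2Q: "Group.monoid SL2Q" unfolding SL2Q_def
  by (rule monoid_matrix) (simp_all add: det_mul)

lemma monoid_SL2Z: "Group.monoid SL2Z" unfolding SL2Z_def
  by (rule monoid_matrix) (simp_all add: det_mul)

lemma monoid_SL3Z: "Group.monoid SL3Z" unfolding SL3Z_def
  by (rule monoid_matrix) (simp_all add: det_mul)

lemma monoid_GL3Z: "Group.monoid GL3Z" unfolding GL3Z_def
  by (rule monoid_matrix) (auto simp: det_mul)

lemma comm_monoid_Qpos: "comm_monoid Qpos_group"
  by (rule comm_monoidI) (auto simp: Qpos_group_def)

lemma Lw_lin_Qpos_psubset_SL2Q: "Lw_lin Qpos_group \<subset> Lw_lin SL2Q"
proof -
  have "Lw_lin Qpos_group \<subseteq> Lw_lin SL2Q"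
  proof (rule Lw_lin_embed)
    show "Group.monoid Qpos_group" using comm_monoid_Qpos by (simp add: comm_monoid_def)
    show "(\<lambda>q. mat2 q 0 0 (1 / q)) \<in> hom Qpos_group SL2Q"
      by (auto simp: hom_def Qpos_group_def SL2Q_def)
  qed (auto simp: Qpos_group_def SL2Q_def mat_1_mat2)
  moreover have "\<not> Lw_lin SL2Q \<subseteq> Lw_lin Qpos_group"
  proof -
    define g where "g c = (if c = 0 then mat2 1 1 0 1 else mat2 1 0 1 (1 :: rat))" for c :: nat
    define h where "h c = (if c = 0 then mat2 1 (-1) 0 1 else mat2 1 0 (-1) (1 :: rat))" for c :: nat
    interpret monoid SL2Q by (rule monoid_SL2Q)
    have g: "g c \<in> carrier SL2Q" and h: "h c \<in> carrier SL2Q" for c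
      by (simp_all add: g_def h_def SL2Q_def)
    have gh: "g c \<otimes>\<^bsub>SL2Q\<^esub> h c = \<one>\<^bsub>SL2Q\<^esub>" and hg: "h c \<otimes>\<^bsub>SL2Q\<^esub> g c = \<one>\<^bsub>SL2Q\<^esub>" for c
      by (simp_all add: g_def h_def SL2Q_def mat_1_mat2)
    \<comment> \<open>Matrices with nonnegative entries and no zero row. The first generator adds
      the second row to the first, so that the first row has the larger sum; the second generator
      does the opposite. Positive row sums make these inequalities strict, hence the images
      disjoint.\<close>
    define S :: "(rat ^ 2 ^ 2) set" where
      "S = {mat2 a b c d | a b c d. a \<ge> 0 \<and> b \<ge> 0 \<and> c \<ge> 0 \<and> d \<ge> 0 \<and> a + b > 0 \<and> c + d > 0}"
    have inj: "inj_on (word_prod SL2Q g) {w. set w \<subseteq> {0, 1} \<and> length w = n}" for n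
    proof (rule word_prod_inj_on[OF monoid_SL2Q g, where S = S])
      fix c x y assume *: "x \<in> carrier SL2Q" "y \<in> carrier SL2Q" "g c \<otimes>\<^bsub>SL2Q\<^esub> x = g c \<otimes>\<^bsub>SL2Q\<^esub> y"
      then have "(h c \<otimes>\<^bsub>SL2Q\<^esub> g c) \<otimes>\<^bsub>SL2Q\<^esub> x = (h c \<otimes>\<^bsub>SL2Q\<^esub> g c) \<otimes>\<^bsub>SL2Q\<^esub> y"
        using g h by (simp add: m_assoc)
      then show "x = y" using * hg by simp
    next
      show "\<one>\<^bsub>SL2Q\<^esub> \<in> S"
        unfolding S_def SL2Q_def by (simp add: mat_1_mat2)
    next
      fix c :: nat and s assume "s \<in> S"
      then obtain x y z w where "s = mat2 x y z w" "x \<ge> 0" "y \<ge> 0" "z \<ge> 0" "w \<ge> 0" "x + y > 0" "z + w > 0"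
        unfolding S_def by blast
      then show "g c \<otimes>\<^bsub>SL2Q\<^esub> s \<in> S" by (simp add: S_def SL2Q_def g_def)
    next
      fix s t assume "s \<in> S" "t \<in> S"
      then obtain x y z w x' y' z' w' where
        "s = mat2 x y z w" "x \<ge> 0" "y \<ge> 0" "z \<ge> 0" "w \<ge> 0" "x + y > 0" "z + w > 0"
        "t = mat2 x' y' z' w'" "x' \<ge> 0" "y' \<ge> 0" "z' \<ge> 0" "w' \<ge> 0" "x' + y' > 0" "z' + w' > 0"
        unfolding S_def by blast
      then show "g 0 \<otimes>\<^bsub>SL2Q\<^esub> s \<noteq> g 1 \<otimes>\<^bsub>SL2Q\<^esub> t" by (auto simp: SL2Q_def g_def)
    qed
    have "mirror (word_prod SL2Q g) \<in> Lw_lin SL2Q"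
      by (rule mirror_in_Lw_lin[OF monoid_SL2Q g h gh hg])
    moreover have "mirror (word_prod SL2Q g) \<notin> Lw_lin Qpos_group"
      by (rule mirror_not_comm[OF comm_monoid_Qpos inj])
    ultimately show ?thesis by blast
  qed
  ultimately show ?thesis by blast
qed

lemma Lw_lin_SL2Z_subset_SL3Z: "Lw_lin SL2Z \<subseteq> Lw_lin SL3Z"
proof (rule Lw_lin_embed[OF monoid_SL2Z])
  let ?\<phi> = "\<lambda>A :: int ^ 2 ^ 2. mat3 (A $ 1 $ 1) (A $ 1 $ 2) 0 (A $ 2 $ 1) (A $ 2 $ 2) 0 0 0 1"
  show "?\<phi> \<in> hom SL2Z SL3Z"
  proof (rule homI)
    fix A assume "A \<in> carrier SL2Z"
    then show "?\<phi> A \<in> carrier SL3Z" by (simp add: SL2Z_def SL3Z_def det_2 det_3)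
  next
    fix A B assume "A \<in> carrier SL2Z" "B \<in> carrier SL2Z"
    show "?\<phi> (A \<otimes>\<^bsub>SL2Z\<^esub> B) = ?\<phi> A \<otimes>\<^bsub>SL3Z\<^esub> ?\<phi> B"
      by (cases A rule: mat2_cases; cases B rule: mat2_cases) (simp add: SL2Z_def SL3Z_def)
  qed
  fix A assume "?\<phi> A = \<one>\<^bsub>SL3Z\<^esub>"
  then show "A = \<one>\<^bsub>SL2Z\<^esub>"
    by (cases A rule: mat2_cases) (simp add: SL2Z_def SL3Z_def mat_1_mat3 mat_1_mat2)
qed (simp add: SL2Z_def SL3Z_def mat_1_mat3 mat_1_mat2)

lemma Lw_lin_Zk2_subset_SL3Z: "Lw_lin (Zk 2) \<subseteq> Lw_lin SL3Z"
proof (rule Lw_lin_embed)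
  let ?\<phi> = "\<lambda>f :: nat \<Rightarrow> int. mat3 1 0 0 0 1 0 (f 0) (f 1) 1"
  show "Group.monoid (Zk 2)" using comm_monoid_Zk[of 2] by (simp add: comm_monoid_def)
  show "?\<phi> \<in> hom (Zk 2) SL3Z"
    by (rule homI) (simp_all add: Zk_def SL3Z_def det_3)
  fix f assume "f \<in> carrier (Zk 2)" "?\<phi> f = \<one>\<^bsub>SL3Z\<^esub>"
  then have "f i = 0" for i by (cases "i \<ge> 2") (auto simp: Zk_def SL3Z_def mat_1_mat3 less_2_cases_iff not_le)
  then show "f = \<one>\<^bsub>Zk 2\<^esub>" by (auto simp: Zk_def)
qed (simp add: Zk_def SL3Z_def mat_1_mat3)

text \<open>In odd dimension the scalar -1 has determinant -1, so \<open>A\<close> times its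
  determinant \<open>d\<close> has determinant \<open>d^3 * d = 1\<close>, and this is
  multiplicative in \<open>A\<close>. The lost sign is a bit that the states carry along: it flips
  with each label of determinant -1.\<close>

lemma Lw_lin_SL3Z_eq_GL3Z: "Lw_lin SL3Z = Lw_lin GL3Z"
proof
  show "Lw_lin SL3Z \<subseteq> Lw_lin GL3Z"
    by (rule Lw_lin_embed[OF monoid_SL3Z, where \<phi> = "\<lambda>A. A"]) (auto simp: SL3Z_def GL3Z_def hom_def)
  let ?\<phi> = "\<lambda>A :: int ^ 3 ^ 3. (\<chi> i j. det A * A $ i $ j)"
  let ?\<kappa> = "\<lambda>A :: int ^ 3 ^ 3. if det A = 1 then 0 else 1 :: nat"
  show "Lw_lin GL3Z \<subseteq> Lw_lin SL3Z"
  proof (rule Lw_lin_simulate[OF monoid_GL3Z, where K = 2 and \<phi> = ?\<phi> and \<kappa> = ?\<kappa>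
        and \<tau> = "\<lambda>k A. if det A = 1 then k else 1 - k"])
    show "?\<phi> \<in> hom GL3Z SL3Z"
    proof (rule homI)
      fix A assume "A \<in> carrier GL3Z"
      then have "det A = 1 \<or> det A = -1" by (simp add: GL3Z_def)
      then have "det (?\<phi> A) = 1" by (elim disjE) (simp_all add: det_3)
      then show "?\<phi> A \<in> carrier SL3Z" by (simp add: SL3Z_def)
    next
      fix A B assume "A \<in> carrier GL3Z" "B \<in> carrier GL3Z"
      show "?\<phi> (A \<otimes>\<^bsub>GL3Z\<^esub> B) = ?\<phi> A \<otimes>\<^bsub>SL3Z\<^esub> ?\<phi> B"
      proof -
        have "(\<chi> i j. x * y * (A ** B) $ i $ j) = (\<chi> i j. x * A $ i $ j) ** (\<chi> i j. y * B $ i $ j)" for x y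
          by (simp add: vec_eq_iff matrix_matrix_mult_def sum_3 algebra_simps)
        from this[of "det A" "det B"] show ?thesis by (simp add: GL3Z_def SL3Z_def det_mul)
      qed
    qed
    show "?\<phi> \<one>\<^bsub>GL3Z\<^esub> = \<one>\<^bsub>SL3Z\<^esub>" by (simp add: GL3Z_def SL3Z_def vec_eq_iff)
    fix A assume "A \<in> carrier GL3Z" "?\<phi> A = \<one>\<^bsub>SL3Z\<^esub>" "?\<kappa> A = ?\<kappa> \<one>\<^bsub>GL3Z\<^esub>"
    then show "A = \<one>\<^bsub>GL3Z\<^esub>" by (simp add: GL3Z_def SL3Z_def split: if_splits)
  qed (auto simp: GL3Z_def det_mul)
qed

section \<open>The Heisenberg group\<close>

text \<open>In the index type \<open>3\<close> the numeral \<open>3\<close> denotes \<open>0\<close>, so the indices are ordered as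
\<open>3 < 1 < 2\<close>.\<close>
lemma less_index_3: "(3 :: 3) < 1" "(1 :: 3) < 2" "(3 :: 3) < 2"
  by (simp_all add: less_bit1_def bit1.Rep_1 bit1.Rep_numeral)

text \<open>With the order \<open>3 < 1 < 2\<close> of the indices, the entries above the diagonal
  are those at (3,1), (1,2) and (3,2). So \<open>x\<close> and \<open>y\<close> are the two entries
  next to the diagonal, and \<open>z\<close> is the central corner entry.\<close>

definition heis :: "int \<Rightarrow> int \<Rightarrow> int \<Rightarrow> int ^ 3 ^ 3" where
  "heis x y z = mat3 1 y 0 0 1 0 x z 1"

lemma heis_mult [simp]: "heis x y z ** heis x' y' z' = heis (x + x') (y + y') (z + z' + x * y')"
  by (simp add: heis_def)

lemma heis_eq_iff [simp]: "heis x y z = heis x' y' z' \<longleftrightarrow> x = x' \<and> y = y' \<and> z = z'"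
  by (simp add: heis_def conj_comms)

lemma heis_in_Heis [simp]: "heis x y z \<in> carrier Heis"
  using less_index_3 less_asym by (fastforce simp: Heis_def heis_def forall_3)

lemma Heis_cases:
  assumes "A \<in> carrier Heis"
  obtains x y z where "A = heis x y z"
proof -
  have "A = heis (A $ 3 $ 1) (A $ 1 $ 2) (A $ 3 $ 2)"
    using assms less_index_3 by (simp add: Heis_def heis_def vec_eq_iff forall_3)
  then show thesis by (rule that)
qed

lemma Heis_simps [simp]: "A \<otimes>\<^bsub>Heis\<^esub> B = A ** B" "\<one>\<^bsub>Heis\<^esub> = heis 0 0 0"
  by (simp_all add: Heis_def heis_def mat_1_mat3)

lemma monoid_Heis: "Group.monoid Heis"
  by (rule monoidI) (auto elim!: Heis_cases simp: algebra_simps)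

text \<open>\<open>card_ball_of_comm_monoid\<close> has the exponent \<open>card M\<close>, which is
  useless against cubic growth when there are many labels. Bounding both coordinates puts the ball
  into a square, with exponent 2 for every \<open>M\<close>; the labels affect only the constant
  \<open>K\<close>.\<close>

lemma card_ball_of_Zk2:
  assumes "finite M" "M \<subseteq> carrier (Zk 2)"
  shows "\<exists>K. \<forall>T. card (ball_of (Zk 2) M T) \<le> (2 * K * T + 1) ^ 2"
proof -
  define K where "K = nat (Max (insert 0 ((\<lambda>f. \<bar>f 0\<bar>) ` M \<union> (\<lambda>f. \<bar>f 1\<bar>) ` M)))"
  have K: "\<bar>f 0\<bar> \<le> int K \<and> \<bar>f 1\<bar> \<le> int K" if "f \<in> M" for f
  proof -
    have "i \<le> int K" if "i \<in> (\<lambda>f. \<bar>f 0\<bar>) ` M \<union> (\<lambda>f. \<bar>f 1\<bar>) ` M" for i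
    proof -
      have "i \<le> Max (insert 0 ((\<lambda>f. \<bar>f 0\<bar>) ` M \<union> (\<lambda>f. \<bar>f 1\<bar>) ` M))"
        using assms(1) that by (intro Max_ge) auto
      then show ?thesis unfolding K_def by linarith
    qed
    then show ?thesis using that by blast
  qed
  have ball: "\<bar>f 0\<bar> \<le> int (K * T) \<and> \<bar>f 1\<bar> \<le> int (K * T)" if "f \<in> ball_of (Zk 2) M T" for f T
    using that
  proof (induction T arbitrary: f)
    case (Suc T)
    then consider "f \<in> ball_of (Zk 2) M T" | g m where "f = (\<lambda>i. g i + m i)" "g \<in> ball_of (Zk 2) M T" "m \<in> M"
      by (auto simp: Zk_def)
    then show ?case
    proof cases
      case 1
      then show ?thesis using Suc.IH[of f] by auto
    next
      case 2
      then show ?thesis using Suc.IH[of g] K[of m] by (auto simp: algebra_simps)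
    qed
  qed (simp add: Zk_def)
  have "card (ball_of (Zk 2) M T) \<le> (2 * K * T + 1) ^ 2" for T
  proof -
    let ?I = "{- int (K * T)..int (K * T)}"
    have "card (ball_of (Zk 2) M T) \<le> card (?I \<times> ?I)"
    proof (rule card_inj_on_le)
      have "ball_of (Zk 2) M T \<subseteq> carrier (Zk 2)"
        using comm_monoid_Zk[of 2] assms(2) by (intro ball_of_carrier) (simp_all add: comm_monoid_def)
      then show "inj_on (\<lambda>f. (f 0, f 1)) (ball_of (Zk 2) M T)"
      proof (intro inj_onI ext)
        fix f g i assume sub: "ball_of (Zk 2) M T \<subseteq> carrier (Zk 2)"
          and *: "f \<in> ball_of (Zk 2) M T" "g \<in> ball_of (Zk 2) M T" "(f 0, f 1) = (g 0, g 1)"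
        show "f i = g i"
        proof (cases "i < 2")
          case True
          then show ?thesis using *(3) by (auto simp: less_2_cases_iff)
        next
          case False
          moreover have "f \<in> carrier (Zk 2)" "g \<in> carrier (Zk 2)" using *(1,2) sub by blast+
          ultimately show ?thesis by (simp add: Zk_def)
        qed
      qed
      show "(\<lambda>f. (f 0, f 1)) ` ball_of (Zk 2) M T \<subseteq> ?I \<times> ?I"
      proof (rule image_subsetI)
        fix f assume "f \<in> ball_of (Zk 2) M T"
        from ball[OF this] show "(f 0, f 1) \<in> ?I \<times> ?I"
          unfolding mem_Times_iff fst_conv snd_conv atLeastAtMost_iff abs_le_iff by linarith
      qed
    qed simp
    also have "card ?I = 2 * K * T + 1" by (simp add: nat_add_distrib nat_mult_distrib)
    then have "card (?I \<times> ?I) = (2 * K * T + 1) ^ 2" by (simp only: card_cartesian_product power2_eq_square)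
    finally show ?thesis .
  qed
  then show ?thesis by blast
qed

lemma Lw_lin_Zk2_psubset_Heis: "Lw_lin (Zk 2) \<subset> Lw_lin Heis"
proof -
  have "Lw_lin (Zk 2) \<subseteq> Lw_lin Heis"
  proof (rule Lw_lin_embed)
    show "Group.monoid (Zk 2)" using comm_monoid_Zk[of 2] by (simp add: comm_monoid_def)
    show "(\<lambda>f. heis (f 0) 0 (f 1)) \<in> hom (Zk 2) Heis"
      by (rule homI) (simp_all add: Zk_def)
    fix f assume "f \<in> carrier (Zk 2)" "heis (f 0) 0 (f 1) = \<one>\<^bsub>Heis\<^esub>"
    then have "f i = 0" for i by (cases "i \<ge> 2") (auto simp: Zk_def less_2_cases_iff not_le)
    then show "f = \<one>\<^bsub>Zk 2\<^esub>" by (auto simp: Zk_def)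
  qed (simp add: Zk_def)
  moreover have "\<not> Lw_lin Heis \<subseteq> Lw_lin (Zk 2)"
  proof -
    define g where "g c = (if c = 0 then heis 1 0 0 else heis 0 1 0)" for c :: nat
    define h where "h c = (if c = 0 then heis (-1) 0 0 else heis 0 (-1) 0)" for c :: nat
    define f where "f = word_prod Heis g"
    interpret monoid Heis by (rule monoid_Heis)
    have g: "g c \<in> carrier Heis" and h: "h c \<in> carrier Heis" for c
      by (simp_all add: g_def h_def)
    have "mirror f \<in> Lw_lin Heis" unfolding f_def
      by (rule mirror_in_Lw_lin[OF monoid_Heis, where h = h]) (simp_all add: g_def h_def)
    moreover have "mirror f \<notin> Lw_lin (Zk 2)"
    proof
      assume "mirror f \<in> Lw_lin (Zk 2)"
      then obtain M c where M: "finite M" "M \<subseteq> carrier (Zk 2)" and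
        count: "\<And>n W. \<lbrakk>\<And>w. w \<in> W \<Longrightarrow> set w \<subseteq> {0, 1} \<and> length w \<le> n; inj_on f W\<rbrakk>
           \<Longrightarrow> card W \<le> c * card (ball_of (Zk 2) M (c * (n + 1)))"
        by (rule mirror_count) blast
      obtain K where K: "\<And>T. card (ball_of (Zk 2) M T) \<le> (2 * K * T + 1) ^ 2"
        using card_ball_of_Zk2[OF M] by blast
      \<comment> \<open>Chosen so that \<open>n\<close> exceeds the coefficient
        \<open>c * (8 * K * c + 1) ^ 2\<close> of the quadratic upper bound. The 8 comes from
        replacing \<open>3 * n + 1\<close> by \<open>4 * n\<close> in
        \<open>2 * K * c * (3 * n + 1)\<close>.\<close>
      define n where "n = c * (8 * K * c + 1) ^ 2 + 1"
      have n: "n \<ge> 1" by (simp add: n_def)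
      \<comment> \<open>The word \<open>0^i 1^(j+1) 0^k\<close> has the value
        \<open>heis (i + k) (j + 1) (i * (j + 1))\<close>. Having \<open>j + 1\<close> instead of
        \<open>j\<close> keeps the middle entry nonzero, so that \<open>i\<close> can be recovered
        from the corner. This gives \<open>n ^ 3\<close> values on words of length at most
        \<open>3 * n\<close>.\<close>
      define w where "w = (\<lambda>(i, j, k). replicate i 0 @ replicate (Suc j) 1 @ replicate k (0 :: nat))"
      define I where "I = {..<n} \<times> {..<n} \<times> {..<n}"
      have f0: "f (replicate i 0) = heis (int i) 0 0" for i
        unfolding f_def by (induction i) (simp_all add: g_def)
      have f1: "f (replicate i (Suc 0)) = heis 0 (int i) 0" for i
        unfolding f_def by (induction i) (simp_all add: g_def)
      have f_app: "f (u @ v) = f u ** f v" for u v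
        unfolding f_def using word_prod_append[of u v g] g by simp
      have fw: "f (w (i, j, k)) = heis (int i + int k) (int (Suc j)) (int i * int (Suc j))" for i j k
        by (simp add: w_def f_app f0 f1 del: replicate_Suc)
      have inj: "inj_on (f \<circ> w) I"
      proof (rule inj_onI)
        fix s t assume *: "(f \<circ> w) s = (f \<circ> w) t"
        obtain i j k i' j' k' where st: "s = (i, j, k)" "t = (i', j', k')"
          by (cases s; cases t) blast
        have eq: "int i + int k = int i' + int k'" "int (Suc j) = int (Suc j')"
          "int i * int (Suc j) = int i' * int (Suc j')"
          using * unfolding comp_apply st fw heis_eq_iff by blast+
        have "j = j'" using eq(2) by simp
        then have "i = i'" using eq(3) by simp
        with \<open>j = j'\<close> eq(1) st show "s = t" by simp
      qed
      have "card (w ` I) = n ^ 3"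
        using card_image[OF inj_on_imageI2[OF inj]] by (simp add: I_def card_cartesian_product power3_eq_cube)
      moreover have "card (w ` I) \<le> c * card (ball_of (Zk 2) M (c * (3 * n + 1)))"
        by (rule count[OF _ inj_on_imageI[OF inj]]) (auto simp: w_def I_def)
      moreover have "card (ball_of (Zk 2) M (c * (3 * n + 1))) \<le> ((8 * K * c + 1) * n) ^ 2"
      proof -
        have "card (ball_of (Zk 2) M (c * (3 * n + 1))) \<le> (2 * K * (c * (3 * n + 1)) + 1) ^ 2" by (rule K)
        also have "\<dots> \<le> ((8 * K * c + 1) * n) ^ 2"
        proof (rule power_mono)
          have "2 * K * (c * (3 * n + 1)) + 1 \<le> 2 * K * (c * (4 * n)) + n"
            using n by (intro add_mono mult_left_mono) auto
          also have "\<dots> = (8 * K * c + 1) * n" by (simp add: algebra_simps)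
          finally show "2 * K * (c * (3 * n + 1)) + 1 \<le> (8 * K * c + 1) * n" .
        qed simp
        finally show ?thesis .
      qed
      ultimately have "n ^ 3 \<le> c * ((8 * K * c + 1) * n) ^ 2"
        by (metis mult_le_mono2 order_trans)
      also have "\<dots> = (c * (8 * K * c + 1) ^ 2) * n ^ 2" by (simp only: power_mult_distrib mult.assoc)
      also have "\<dots> < n * n ^ 2" using n by (intro mult_strict_right_mono) (simp_all add: n_def)
      finally show False by (simp add: power3_eq_cube power2_eq_square)
    qed
    ultimately show ?thesis by blast
  qed
  ultimately show ?thesis by blast
qed

section \<open>Regular languages\<close>

lemma REG_subset_Lw_lin_free_group_0: "REG \<subseteq> Lw_lin (free_group 0)"
proof
  fix L assume "L \<in> REG"
  then obtain Q \<Sigma> :: "nat set" and \<delta> :: "nat \<Rightarrow> nat \<Rightarrow> nat" and q0 F where *: "finite Q" "finite \<Sigma>" "q0 \<in> Q" "F \<subseteq> Q"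
      "\<And>q a. q \<in> Q \<Longrightarrow> a \<in> \<Sigma> \<Longrightarrow> \<delta> q a \<in> Q"
      and L: "L = {w. set w \<subseteq> \<Sigma> \<and> fold (\<lambda>a q. \<delta> q a) w q0 \<in> F}"
    unfolding REG_def by blast
  define e where "e q a = (if q \<in> Q \<and> a \<in> \<Sigma> then Some (\<delta> q a, [] :: (bool \<times> nat) list) else None)" for q a
  have run: "drun (free_group 0) e q [] w = Some (q', y) \<longleftrightarrow>
      set w \<subseteq> \<Sigma> \<and> q' = fold (\<lambda>a q. \<delta> q a) w q \<and> y = []" if "q \<in> Q" for q w q' y
    using that
  proof (induction w arbitrary: q)
    case (Cons a w)
    then show ?case by (auto simp: e_def *(5) free_group_def free_reduce_def)
  qed auto
  have "{w. \<exists>q\<in>F. drun (free_group 0) e q0 \<one>\<^bsub>free_group 0\<^esub> w = Some (q, \<one>\<^bsub>free_group 0\<^esub>)}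
      \<in> Lw_lin (free_group 0)"
    by (rule Lw_lin_realtime[OF *(1-4)]) (auto simp: e_def *(5) free_group_def split: if_splits)
  moreover have "\<one>\<^bsub>free_group 0\<^esub> = []" by (simp add: free_group_def)
  ultimately show "L \<in> Lw_lin (free_group 0)" using run[OF *(3)] by (simp add: L conj_commute)
qed

lemma REG_I:
  fixes Q \<Sigma> :: "nat set" and \<delta> :: "nat \<Rightarrow> nat \<Rightarrow> nat"
  assumes "finite Q" "finite \<Sigma>" "q0 \<in> Q" "F \<subseteq> Q" "\<And>q a. q \<in> Q \<Longrightarrow> a \<in> \<Sigma> \<Longrightarrow> \<delta> q a \<in> Q"
  shows "{w. set w \<subseteq> \<Sigma> \<and> fold (\<lambda>a q. \<delta> q a) w q0 \<in> F} \<in> REG"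
  unfolding REG_def mem_Collect_eq
  by (rule exI[of _ Q], rule exI[of _ \<Sigma>], rule exI[of _ \<delta>], rule exI[of _ q0], rule exI[of _ F])
     (simp add: assms)

text \<open>The register of the trivial group never changes, which leaves a finite automaton with
  empty moves. The subset construction determinizes it, with sets of states coded as natural numbers
  by \<open>set_encode\<close>.\<close>

lemma Lw_lin_free_group_0_subset_REG: "Lw_lin (free_group 0) \<subseteq> REG"
proof
  define G where "G = free_group 0"
  fix L assume "L \<in> Lw_lin (free_group 0)"
  then obtain A :: "(nat, (bool \<times> nat) list) gaut" and C where A: "valid_gaut G A" "gaut_lang G A = L"
      unfolding G_def by (rule Lw_linE) blast
  have one: "\<one>\<^bsub>G\<^esub> = []" by (simp add: G_def free_group_def)
  have G: "Group.monoid G" unfolding G_def by (simp add: group.is_monoid group_free_group)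
  have trivial: "y = []" if "grun G A q [] w q' y n" for q w q' y n
  proof -
    have "y \<in> carrier G"
      using grun_carrier[OF that A(1) G] by (simp add: G_def carrier_free_group_0)
    then show ?thesis by (simp add: G_def carrier_free_group_0)
  qed
  define reach where "reach P w = {q'. \<exists>q\<in>P. \<exists>n. grun G A q [] w q' [] n}" for P w
  have reach_sub: "reach P w \<subseteq> states A" if "P \<subseteq> states A" for P w
    using grun_state[OF _ A(1)] that unfolding reach_def by blast
  have reach_append: "reach P (u @ v) = reach (reach P u) v" for P u v
  proof
    show "reach P (u @ v) \<subseteq> reach (reach P u) v"
    proof
      fix q' assume "q' \<in> reach P (u @ v)"
      then obtain q n where q: "q \<in> P" "grun G A q [] (u @ v) q' [] n" unfolding reach_def by blast
      from grun_split[OF q(2)] obtain p z k m where "grun G A q [] u p z k" "grun G A p z v q' [] m"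
        by blast
      moreover from this(1) have "z = []" by (rule trivial)
      ultimately show "q' \<in> reach (reach P u) v" using q(1) unfolding reach_def by blast
    qed
    show "reach (reach P u) v \<subseteq> reach P (u @ v)"
      unfolding reach_def using grun_append by fast
  qed
  \<comment> \<open>The start set is closed under empty moves. This gives
    \<open>reach S0 [] = S0\<close>, the base case of the correspondence between \<open>fold\<close>
    and \<open>reach\<close>.\<close>
  define S0 where "S0 = reach {init A} []"
  have fin: "finite (states A)" and i: "init A \<in> states A" using A(1) unfolding valid_gaut_def by auto
  have S0: "S0 \<subseteq> states A" unfolding S0_def using i by (intro reach_sub) simp
  define \<delta> where "\<delta> q a = set_encode (reach (set_decode q) [a])" for q a
  define F where "F = set_encode ` {P. P \<subseteq> states A \<and> P \<inter> accst A \<noteq> {}}"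
  have dec: "set_decode (set_encode P) = P" if "P \<subseteq> states A" for P
    using that fin finite_subset by (intro set_encode_inverse) blast
  have fold: "fold (\<lambda>a q. \<delta> q a) w (set_encode P) = set_encode (reach P w)"
    if "P \<subseteq> states A" "reach P [] = P" for P w
  proof (induction w rule: rev_induct)
    case Nil
    then show ?case using that by simp
  next
    case (snoc a w)
    then show ?case using dec[OF reach_sub[OF that(1)]] by (simp add: \<delta>_def reach_append)
  qed
  have S0_reach: "reach S0 w = reach {init A} w" for w
    unfolding S0_def by (simp flip: reach_append)
  have F_iff: "set_encode P \<in> F \<longleftrightarrow> P \<inter> accst A \<noteq> {}" if "P \<subseteq> states A" for P
  proof
    assume "set_encode P \<in> F"
    then obtain R where R: "R \<subseteq> states A" "R \<inter> accst A \<noteq> {}" "set_encode P = set_encode R"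
      unfolding F_def by blast
    have "P = R" using arg_cong[OF R(3), of set_decode] unfolding dec[OF that] dec[OF R(1)] .
    with R(2) show "P \<inter> accst A \<noteq> {}" by simp
  next
    assume "P \<inter> accst A \<noteq> {}"
    then show "set_encode P \<in> F" unfolding F_def using that by blast
  qed
  have "w \<in> L \<longleftrightarrow> set w \<subseteq> alph A \<and> fold (\<lambda>a q. \<delta> q a) w (set_encode S0) \<in> F" for w
  proof -
    have "w \<in> L \<longleftrightarrow> (\<exists>q\<in>accst A. \<exists>n. grun G A (init A) [] w q [] n)"
      unfolding A(2)[symmetric] gaut_lang_def accepts_in_def one by blast
    also have "\<dots> \<longleftrightarrow> set w \<subseteq> alph A \<and> (\<exists>q\<in>accst A. \<exists>n. grun G A (init A) [] w q [] n)"
      using grun_alph[OF _ A(1)] by blast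
    also have "(\<exists>q\<in>accst A. \<exists>n. grun G A (init A) [] w q [] n) \<longleftrightarrow> reach {init A} w \<inter> accst A \<noteq> {}"
      unfolding reach_def by blast
    also have "\<dots> \<longleftrightarrow> set_encode (reach S0 w) \<in> F"
      using F_iff[of "reach S0 w"] reach_sub[OF S0] by (simp add: S0_reach)
    also have "set_encode (reach S0 w) = fold (\<lambda>a q. \<delta> q a) w (set_encode S0)"
      using fold[OF S0, of w] S0_reach[of "[]"] by (simp add: S0_def)
    finally show ?thesis .
  qed
  then have L: "L = {w. set w \<subseteq> alph A \<and> fold (\<lambda>a q. \<delta> q a) w (set_encode S0) \<in> F}" by blast
  show "L \<in> REG" unfolding L
  proof (rule REG_I[where Q = "set_encode ` Pow (states A)" and \<delta> = \<delta> and F = F and \<Sigma> = "alph A"])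
    show "finite (set_encode ` Pow (states A))" "finite (alph A)"
      using A(1) unfolding valid_gaut_def by auto
    show "set_encode S0 \<in> set_encode ` Pow (states A)" "F \<subseteq> set_encode ` Pow (states A)"
      using S0 unfolding F_def by auto
    show "\<delta> q a \<in> set_encode ` Pow (states A)" if "q \<in> set_encode ` Pow (states A)" for q a
      using that dec reach_sub unfolding \<delta>_def by auto
  qed
qed

section \<open>Automata over groups with a splitting property\<close>

text \<open>Paths keep the list of their group labels instead of its product, because the splitting
  hypothesis below says where this list can be cut.\<close>

inductive fine_path :: "('s \<times> 'a list \<times> 'g \<times> 's) set \<Rightarrow> 's \<Rightarrow> 'g list \<Rightarrow> 'a list \<Rightarrow> 's \<Rightarrow> bool"
  for \<Delta> where
  fine_nil: "fine_path \<Delta> s [] [] s"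
| fine_step: "(s, u, x, r) \<in> \<Delta> \<Longrightarrow> fine_path \<Delta> r xs w t \<Longrightarrow> fine_path \<Delta> s (x # xs) (u @ w) t"

inductive_cases fine_path_NilE: "fine_path \<Delta> s [] w t"
inductive_cases fine_path_ConsE: "fine_path \<Delta> s (x # xs) w t"

lemma fine_path_append:
  "fine_path \<Delta> s xs w r \<Longrightarrow> fine_path \<Delta> r ys v t \<Longrightarrow> fine_path \<Delta> s (xs @ ys) (w @ v) t"
  by (induction rule: fine_path.induct) (auto intro: fine_path.intros)

lemma fine_path_split:
  "fine_path \<Delta> s (xs @ ys) w t \<Longrightarrow> \<exists>r u v. w = u @ v \<and> fine_path \<Delta> s xs u r \<and> fine_path \<Delta> r ys v t"
proof (induction xs arbitrary: s w)
  case Nil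
  then show ?case
    by (intro exI[of _ s] exI[of _ "[]"] exI[of _ w]) (simp add: fine_path.fine_nil)
next
  case (Cons x xs)
  then have "fine_path \<Delta> s (x # xs @ ys) w t" by simp
  then obtain u r w' where *: "w = u @ w'" "(s, u, x, r) \<in> \<Delta>" "fine_path \<Delta> r (xs @ ys) w' t"
    by (rule fine_path_ConsE) blast
  from Cons.IH[OF *(3)] obtain r' u' v where "w' = u' @ v" "fine_path \<Delta> r xs u' r'" "fine_path \<Delta> r' ys v t"
    by blast
  with * fine_step[OF *(2), of xs u' r'] show ?case
    by (intro exI[of _ r'] exI[of _ "u @ u'"] exI[of _ v]) simp
qed

lemma cfg_gen_terminals: "cfg_gen P (map Inr w) w"
  by (induction w) (auto intro: cfg_gen.intros)

lemma cfg_gen_single: "(B, rhs) \<in> P \<Longrightarrow> cfg_gen P rhs w \<Longrightarrow> cfg_gen P [Inl B] w"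
  using cfg_nonterm[of B rhs P w "[]" "[]"] by (auto intro: cfg_gen.intros)

lemma cfg_gen_Cons_nonterm:
  assumes "cfg_gen P [Inl B] u" "cfg_gen P r v"
  shows "cfg_gen P (Inl B # r) (u @ v)"
proof -
  from assms(1) obtain rhs where "(B, rhs) \<in> P" "cfg_gen P rhs u"
    by (elim cfg_gen_NontermE) (auto elim: cfg_gen_NilE)
  then show ?thesis by (rule cfg_nonterm[OF _ _ assms(2)])
qed

lemma form_lang_terminals: "form_lang T (map Inr w) = {w}"
  by (induction w) auto

text \<open>Nonterminals are triples \<open>(s, g, t)\<close> with \<open>g\<close> in a finite set \<open>K\<close>, deriving the words that
label a path from \<open>s\<close> to \<open>t\<close> with group value \<open>g\<close>. The splitting hypothesis says that every
path with value in \<open>K\<close> decomposes into two shorter ones of the same kind, as in the triangulation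
of closed paths in the Cayley graph of a virtually free group.\<close>
lemma fine_path_lang_CF:
  fixes G :: "('g, 'b) monoid_scheme" (structure) and \<Delta> :: "('s \<times> nat list \<times> 'g \<times> 's) set"
  assumes G: "Group.monoid G" and K: "finite K" "K \<subseteq> carrier G" "\<one> \<in> K" and M: "M \<subseteq> K"
    and split: "\<And>xs. set xs \<subseteq> M \<Longrightarrow> 2 \<le> length xs \<Longrightarrow> word_prod G (\<lambda>x. x) xs \<in> K \<Longrightarrow>
      \<exists>us vs. xs = us @ vs \<and> us \<noteq> [] \<and> vs \<noteq> [] \<and> word_prod G (\<lambda>x. x) us \<in> K \<and> word_prod G (\<lambda>x. x) vs \<in> K"
    and S: "finite S" "finite \<Delta>" "\<And>s u x t. (s, u, x, t) \<in> \<Delta> \<Longrightarrow> s \<in> S \<and> x \<in> M \<and> t \<in> S"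
    and F: "s0 \<in> S" "F \<subseteq> S"
  shows "{w. \<exists>f\<in>F. \<exists>xs. fine_path \<Delta> s0 xs w f \<and> word_prod G (\<lambda>x. x) xs = \<one>} \<in> CF" (is "?L \<in> CF")
proof -
  interpret monoid G by (rule G)
  let ?v = "word_prod G (\<lambda>x. x)"
  define N where "N = S \<times> K \<times> S"
  have finN: "finite N" unfolding N_def using K S by simp
  obtain enc where enc: "bij_betw enc N {..<card N}"
    using ex_bij_betw_finite_nat[OF finN] by (auto simp: atLeast0LessThan)
  have inj: "enc z = enc z' \<longleftrightarrow> z = z'" if "z \<in> N" "z' \<in> N" for z z'
    using enc that unfolding bij_betw_def by (auto dest: inj_onD)
  define start where "start = card N"
  have start: "enc z \<noteq> start" if "z \<in> N" for z
    using bij_betw_apply[OF enc that] unfolding start_def by simp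
  have path: "t \<in> S \<and> set xs \<subseteq> M" if "fine_path \<Delta> s xs w t" "s \<in> S" for s xs w t
    using that by (induction rule: fine_path.induct) (auto dest: S(3))
  have val: "?v xs \<in> carrier G" if "set xs \<subseteq> M" for xs
    using that M K by (intro word_prod_closed) blast
  \<comment> \<open>The four kinds of productions: cut a path at a state \<open>r\<close> into parts
    with values in \<open>K\<close>, read a single edge, take the empty path, and start with a path
    of value \<open>\<one>\<close> from \<open>s0\<close> to a final state. Finiteness of
    \<open>K\<close> makes the grammar finite.\<close>
  define P :: "(nat \<times> (nat + nat) list) set" where "P =
    (\<lambda>((s, r, t), (g, h)). (enc (s, g \<otimes> h, t), [Inl (enc (s, g, r)), Inl (enc (r, h, t))])) `
        ((S \<times> S \<times> S) \<times> {(g, h). g \<in> K \<and> h \<in> K \<and> g \<otimes> h \<in> K}) \<union>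
    (\<lambda>(s, u, x, t). (enc (s, x, t), map Inr u)) ` \<Delta> \<union>
    (\<lambda>s. (enc (s, \<one>, s), [])) ` S \<union>
    (\<lambda>f. (start, [Inl (enc (s0, \<one>, f))])) ` F"
  have finP: "finite P"
  proof -
    have "{(g, h). g \<in> K \<and> h \<in> K \<and> g \<otimes> h \<in> K} \<subseteq> K \<times> K" by auto
    then have "finite {(g, h). g \<in> K \<and> h \<in> K \<and> g \<otimes> h \<in> K}" using K(1) by (meson finite_SigmaI finite_subset)
    moreover have "finite F" using F(2) S(1) finite_subset by blast
    ultimately show ?thesis unfolding P_def using S K by simp
  qed
  have P1: "(enc (s, g \<otimes> h, t), [Inl (enc (s, g, r)), Inl (enc (r, h, t))]) \<in> P"
    if "s \<in> S" "r \<in> S" "t \<in> S" "g \<in> K" "h \<in> K" "g \<otimes> h \<in> K" for s r t g h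
    unfolding P_def
    by (rule UnI1, rule UnI1, rule UnI1, rule image_eqI[of _ _ "((s, r, t), (g, h))"]) (simp_all add: that)
  have P2: "(enc (s, x, t), map Inr u) \<in> P" if "(s, u, x, t) \<in> \<Delta>" for s u x t
    unfolding P_def
    by (rule UnI1, rule UnI1, rule UnI2, rule image_eqI[of _ _ "(s, u, x, t)"]) (simp_all add: that)
  have P3: "(enc (s, \<one>, s), []) \<in> P" if "s \<in> S" for s
    unfolding P_def by (rule UnI1, rule UnI2, rule image_eqI[of _ _ s]) (simp_all add: that)
  have P4: "(start, [Inl (enc (s0, \<one>, f))]) \<in> P" if "f \<in> F" for f
    unfolding P_def by (rule UnI2, rule image_eqI[of _ _ f]) (simp_all add: that)
  have complete: "cfg_gen P [Inl (enc (s, ?v xs, t))] w"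
    if "fine_path \<Delta> s xs w t" "?v xs \<in> K" "s \<in> S" for s xs w t
    using that
  proof (induction "length xs" arbitrary: s xs w t rule: less_induct)
    case less
    note p = path[OF less.prems(1,3)]
    consider "xs = []" | x where "xs = [x]" | "2 \<le> length xs"
      by (cases xs rule: remdups_adj.cases) auto
    then show ?case
    proof cases
      case 1
      then have "w = [] \<and> t = s" using less.prems(1) by (auto elim: fine_path_NilE)
      then show ?thesis using 1 P3[OF less.prems(3)] by (auto intro: cfg_gen_single cfg_gen.intros)
    next
      case (2 x)
      then have \<Delta>: "(s, w, x, t) \<in> \<Delta>"
        using less.prems(1) by (auto elim!: fine_path_ConsE fine_path_NilE)
      moreover have "x \<in> carrier G" using p 2 M K by auto
      ultimately show ?thesis
        using cfg_gen_single[OF P2[OF \<Delta>] cfg_gen_terminals] by (simp add: 2)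
    next
      case 3
      from split[OF _ 3 less.prems(2)] p obtain us vs where
        uv: "xs = us @ vs" "us \<noteq> []" "vs \<noteq> []" "?v us \<in> K" "?v vs \<in> K" by blast
      from fine_path_split[OF less.prems(1)[unfolded uv(1)]] obtain r u v where
        r: "w = u @ v" "fine_path \<Delta> s us u r" "fine_path \<Delta> r vs v t" by blast
      have rS: "r \<in> S" using path[OF r(2) less.prems(3)] by blast
      have "cfg_gen P [Inl (enc (s, ?v us, r))] u"
        using less.hyps[OF _ r(2) uv(4) less.prems(3)] uv by simp
      moreover have "cfg_gen P [Inl (enc (r, ?v vs, t))] v"
        using less.hyps[OF _ r(3) uv(5) rS] uv by simp
      ultimately have gen: "cfg_gen P [Inl (enc (s, ?v us, r)), Inl (enc (r, ?v vs, t))] w"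
        unfolding r(1) by (rule cfg_gen_Cons_nonterm)
      have "?v xs = ?v us \<otimes> ?v vs"
        unfolding uv(1) by (rule word_prod_append) (use p uv(1) M K in auto)
      then show ?thesis
        using cfg_gen_single[OF P1 gen] less.prems rS p uv by simp
    qed
  qed
  \<comment> \<open>The intended meaning of each nonterminal; numbers that code nothing get the
    empty language.\<close>
  define T where "T B = {w. (\<exists>s g t. s \<in> S \<and> g \<in> K \<and> t \<in> S \<and> B = enc (s, g, t) \<and>
      (\<exists>xs. fine_path \<Delta> s xs w t \<and> ?v xs = g)) \<or> B = start \<and> w \<in> ?L}" for B
  have T_enc: "w \<in> T (enc (s, g, t)) \<longleftrightarrow> (\<exists>xs. fine_path \<Delta> s xs w t \<and> ?v xs = g)"
    if "s \<in> S" "g \<in> K" "t \<in> S" for s g t w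
  proof -
    have "enc (s, g, t) = enc (s', g', t') \<longleftrightarrow> s = s' \<and> g = g' \<and> t = t'"
      if "s' \<in> S" "g' \<in> K" "t' \<in> S" for s' g' t'
      using inj[of "(s, g, t)" "(s', g', t')"] that \<open>s \<in> S\<close> \<open>g \<in> K\<close> \<open>t \<in> S\<close> unfolding N_def by simp
    moreover have "enc (s, g, t) \<noteq> start" using start that unfolding N_def by simp
    ultimately show ?thesis unfolding T_def using that by blast
  qed
  have T_start: "w \<in> T start \<longleftrightarrow> w \<in> ?L" for w
    unfolding T_def using start unfolding N_def by fastforce
  have sound: "form_lang T rhs \<subseteq> T B" if "(B, rhs) \<in> P" for B rhs
  proof -
    from that consider
      s r t g h where "s \<in> S" "r \<in> S" "t \<in> S" "g \<in> K" "h \<in> K" "g \<otimes> h \<in> K" "B = enc (s, g \<otimes> h, t)"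
        "rhs = [Inl (enc (s, g, r)), Inl (enc (r, h, t))]"
      | s u x t where "(s, u, x, t) \<in> \<Delta>" "B = enc (s, x, t)" "rhs = map Inr u"
      | s where "s \<in> S" "B = enc (s, \<one>, s)" "rhs = []"
      | f where "f \<in> F" "B = start" "rhs = [Inl (enc (s0, \<one>, f))]"
      unfolding P_def by auto
    then show ?thesis
    proof cases
      case 1
      show ?thesis
      proof
        fix w assume "w \<in> form_lang T rhs"
        then obtain u v where uv: "w = u @ v" "u \<in> T (enc (s, g, r))" "v \<in> T (enc (r, h, t))"
          using 1(8) by auto
        obtain xs where xs: "fine_path \<Delta> s xs u r" "?v xs = g" using uv(2) T_enc 1 by blast
        obtain ys where ys: "fine_path \<Delta> r ys v t" "?v ys = h" using uv(3) T_enc 1 by blast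
        have "set xs \<subseteq> M" "set ys \<subseteq> M" using path[OF xs(1)] path[OF ys(1)] 1 by blast+
        then have "?v (xs @ ys) = g \<otimes> h"
          unfolding xs(2)[symmetric] ys(2)[symmetric] using M K by (intro word_prod_append) auto
        moreover have "fine_path \<Delta> s (xs @ ys) w t"
          unfolding uv(1) by (rule fine_path_append[OF xs(1) ys(1)])
        ultimately show "w \<in> T B" using T_enc 1 by blast
      qed
    next
      case 2
      have "fine_path \<Delta> s [x] (u @ []) t" by (rule fine_step[OF 2(1) fine_nil])
      moreover have "x \<in> K" "s \<in> S" "t \<in> S" using S(3)[OF 2(1)] M by auto
      moreover have "?v [x] = x" using \<open>x \<in> K\<close> K by auto
      ultimately have "u \<in> T (enc (s, x, t))" using T_enc by auto
      then show ?thesis using 2 by (simp add: form_lang_terminals)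
    next
      case 3
      have "fine_path \<Delta> s [] [] s" by (rule fine_nil)
      then have "[] \<in> T (enc (s, \<one>, s))" using T_enc[OF 3(1) K(3) 3(1)] by force
      then show ?thesis using 3 by simp
    next
      case 4
      have "T (enc (s0, \<one>, f)) \<subseteq> T start"
        using 4(1) F T_enc[OF F(1) K(3)] T_start by blast
      then show ?thesis using 4 by auto
    qed
  qed
  have "?L = {w. cfg_gen P [Inl start] w}"
  proof
    show "?L \<subseteq> {w. cfg_gen P [Inl start] w}"
    proof
      fix w assume "w \<in> ?L"
      then obtain f xs where *: "f \<in> F" "fine_path \<Delta> s0 xs w f" "?v xs = \<one>" by blast
      then have "cfg_gen P [Inl (enc (s0, \<one>, f))] w"
        using complete[OF *(2)] K(3) F(1) by simp
      then show "w \<in> {w. cfg_gen P [Inl start] w}" using cfg_gen_single[OF P4[OF *(1)]] by blast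
    qed
    show "{w. cfg_gen P [Inl start] w} \<subseteq> ?L"
    proof
      fix w assume "w \<in> {w. cfg_gen P [Inl start] w}"
      then have "w \<in> form_lang T [Inl start]" using cfg_gen_sound sound by blast
      then show "w \<in> ?L" using T_start by simp
    qed
  qed
  then show ?thesis unfolding CF_def using finP by blast
qed

text \<open>Labels of the automaton are arbitrary elements, while splitting concerns words over
  \<open>M\<close>. A transition with label \<open>m\<close> is therefore refined: one edge of value
  \<open>\<one>\<close> reads the input and loads a factorization of \<open>m\<close> over
  \<open>M\<close> into the state, further edges unload it factor by factor.\<close>

lemma gaut_lang_CF:
  fixes G :: "('g, 'b) monoid_scheme" (structure) and A :: "(nat, 'g) gaut"
  assumes G: "Group.monoid G" and K: "finite K" "K \<subseteq> carrier G" and M: "M \<subseteq> K" "\<one> \<in> M"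
    and split: "\<And>xs. set xs \<subseteq> M \<Longrightarrow> 2 \<le> length xs \<Longrightarrow> word_prod G (\<lambda>x. x) xs \<in> K \<Longrightarrow>
      \<exists>us vs. xs = us @ vs \<and> us \<noteq> [] \<and> vs \<noteq> [] \<and> word_prod G (\<lambda>x. x) us \<in> K \<and> word_prod G (\<lambda>x. x) vs \<in> K"
    and gen: "\<And>m. m \<in> carrier G \<Longrightarrow> \<exists>xs. set xs \<subseteq> M \<and> word_prod G (\<lambda>x. x) xs = m"
    and A: "valid_gaut G A"
  shows "gaut_lang G A \<in> CF"
proof -
  interpret monoid G by (rule G)
  let ?v = "word_prod G (\<lambda>x. x)"
  obtain dec where dec: "\<And>m. m \<in> carrier G \<Longrightarrow> set (dec m) \<subseteq> M \<and> ?v (dec m) = m"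
    using gen by metis
  obtain Y where Y: "finite Y" "Y \<subseteq> carrier G" "\<And>q s. snd ` trans A q s \<subseteq> Y"
    using valid_gaut_labels[OF A] by blast
  \<comment> \<open>The possible loads of a state are the suffixes of the chosen factorizations, a
    finite set.\<close>
  define D where "D = insert [] (\<Union>m\<in>Y. (\<lambda>i. drop i (dec m)) ` {..length (dec m)})"
  define S where "S = states A \<times> D"
  have D: "set ys \<subseteq> M" if "ys \<in> D" for ys
  proof -
    from that consider "ys = []" | m i where "m \<in> Y" "ys = drop i (dec m)" unfolding D_def by blast
    then show ?thesis
    proof cases
      case 2
      then have "set ys \<subseteq> set (dec m)" by (simp add: set_drop_subset)
      moreover have "set (dec m) \<subseteq> M" using dec 2(1) Y(2) by blast
      ultimately show ?thesis by blast
    qed simp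
  qed
  have D_tl: "xs \<in> D" if "x # xs \<in> D" for x xs
  proof -
    from that obtain m i where mi: "m \<in> Y" "x # xs = drop i (dec m)" unfolding D_def by auto
    then have "i < length (dec m)" by (metis drop_all linorder_not_less list.distinct(1))
    moreover have "xs = drop (Suc i) (dec m)" using mi(2) by (metis drop_Suc list.sel(3) tl_drop)
    ultimately have "xs \<in> (\<lambda>i. drop i (dec m)) ` {..length (dec m)}"
      by (intro image_eqI[of _ _ "Suc i"]) auto
    then show ?thesis using mi(1) unfolding D_def by blast
  qed
  have D_dec: "dec m \<in> D" if "m \<in> Y" for m
    using that unfolding D_def by (auto intro!: bexI[of _ m] image_eqI[of _ _ 0])
  define lab :: "nat option \<Rightarrow> nat list" where "lab s = (case s of None \<Rightarrow> [] | Some a \<Rightarrow> [a])" for s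
  define \<Delta>1 where "\<Delta>1 = {((q, [] :: 'g list), lab s, \<one>, (p, dec m)) | q s p m. (p, m) \<in> trans A q s}"
  define \<Delta>2 where "\<Delta>2 = {((p, x # xs), [] :: nat list, x, (p, xs)) | p x xs. (p, x # xs) \<in> S}"
  have Ym: "m \<in> Y" if "(p, m) \<in> trans A q s" for p m q s using Y(3)[of q s] that by force
  have fin: "finite S" "finite (states A)" "finite (alph A)"
    using A Y(1) unfolding S_def D_def valid_gaut_def by auto
  have fin\<Delta>: "finite (\<Delta>1 \<union> \<Delta>2)"
  proof -
    have "\<Delta>1 \<subseteq> (\<lambda>(q, s, p, m). ((q, []), lab s, \<one>, (p, dec m))) `
        (states A \<times> insert None (Some ` alph A) \<times> states A \<times> Y)"
    proof
      fix z assume "z \<in> \<Delta>1"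
      then obtain q s p m where z: "z = ((q, []), lab s, \<one>, (p, dec m))" "(p, m) \<in> trans A q s"
        unfolding \<Delta>1_def by blast
      have "s \<in> insert None (Some ` alph A)" using valid_gaut_transD(4)[OF A z(2)] by (cases s) auto
      then have "(q, s, p, m) \<in> states A \<times> insert None (Some ` alph A) \<times> states A \<times> Y"
        using valid_gaut_transD(1,3)[OF A z(2)] Ym[OF z(2)] by simp
      then show "z \<in> (\<lambda>(q, s, p, m). ((q, []), lab s, \<one>, (p, dec m))) `
        (states A \<times> insert None (Some ` alph A) \<times> states A \<times> Y)"
        by (rule rev_image_eqI) (simp add: z(1))
    qed
    then have "finite \<Delta>1" by (rule finite_subset) (use fin Y(1) in simp)
    have "\<Delta>2 \<subseteq> (\<lambda>(p, ys). ((p, ys), [], hd ys, (p, tl ys))) ` S"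
    proof
      fix z assume "z \<in> \<Delta>2"
      then obtain p x xs where z: "z = ((p, x # xs), [], x, (p, xs))" "(p, x # xs) \<in> S"
        unfolding \<Delta>2_def by blast
      from z(2) show "z \<in> (\<lambda>(p, ys). ((p, ys), [], hd ys, (p, tl ys))) ` S"
        by (rule rev_image_eqI) (simp add: z(1))
    qed
    then have "finite \<Delta>2" by (rule finite_subset) (use fin in simp)
    with \<open>finite \<Delta>1\<close> show ?thesis by simp
  qed
  have \<Delta>S: "s \<in> S \<and> x \<in> M \<and> t \<in> S" if "(s, u, x, t) \<in> \<Delta>1 \<union> \<Delta>2" for s u x t
    using that
  proof
    assume "(s, u, x, t) \<in> \<Delta>1"
    then obtain q a p m where *: "s = (q, [])" "x = \<one>" "t = (p, dec m)" "(p, m) \<in> trans A q a"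
      unfolding \<Delta>1_def by blast
    have "[] \<in> D" by (simp add: D_def)
    then show ?thesis
      using valid_gaut_transD(1,3)[OF A *(4)] D_dec[OF Ym[OF *(4)]] M(2) by (simp add: * S_def)
  next
    assume "(s, u, x, t) \<in> \<Delta>2"
    then obtain p xs where *: "s = (p, x # xs)" "t = (p, xs)" "(p, x # xs) \<in> S"
      unfolding \<Delta>2_def by blast
    then have "p \<in> states A" "x # xs \<in> D" unfolding S_def by simp_all
    then show ?thesis using D[of "x # xs"] D_tl[of x xs] *(1-3) by (simp add: S_def)
  qed
  define F where "F = (\<lambda>q. (q, [] :: 'g list)) ` accst A"
  have F: "(init A, []) \<in> S" "F \<subseteq> S"
    using A unfolding valid_gaut_def S_def D_def F_def by auto
  have MK: "M \<subseteq> carrier G" using M K by blast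
  have unload: "fine_path (\<Delta>1 \<union> \<Delta>2) (p, ys) ys [] (p, [])" if "p \<in> states A" "ys \<in> D" for p ys
    using that
  proof (induction ys)
    case Nil
    show ?case by (rule fine_path.fine_nil)
  next
    case (Cons y ys)
    have "((p, y # ys), [], y, (p, ys)) \<in> \<Delta>1 \<union> \<Delta>2" using Cons.prems unfolding \<Delta>2_def S_def by blast
    from fine_step[OF this Cons.IH] Cons.prems D_tl show ?case by auto
  qed
  have fwd: "\<exists>xs. fine_path (\<Delta>1 \<union> \<Delta>2) (q, []) xs w (q', []) \<and> y = x \<otimes> ?v xs"
    if "grun G A q x w q' y n" "x \<in> carrier G" for q x w q' y n
  proof -
    have one_step: "\<exists>xs. fine_path (\<Delta>1 \<union> \<Delta>2) (q, []) xs (lab s) (p, []) \<and> set xs \<subseteq> M \<and> ?v xs = m"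
      if "(p, m) \<in> trans A q s" for p m q s
    proof -
      note t = valid_gaut_transD[OF A that]
      have "((q, []), lab s, \<one>, (p, dec m)) \<in> \<Delta>1 \<union> \<Delta>2" using that unfolding \<Delta>1_def by blast
      from fine_step[OF this unload[OF t(1) D_dec[OF Ym[OF that]]]]
      have "fine_path (\<Delta>1 \<union> \<Delta>2) (q, []) (\<one> # dec m) (lab s) (p, [])" by simp
      moreover have "set (\<one> # dec m) \<subseteq> M" "?v (\<one> # dec m) = m" using dec[OF t(2)] M(2) t(2) by auto
      ultimately show ?thesis by blast
    qed
    have "\<exists>xs. fine_path (\<Delta>1 \<union> \<Delta>2) (q, []) xs w (q', []) \<and> set xs \<subseteq> M \<and> y = x \<otimes> ?v xs"
      using that
    proof (induction rule: grun.induct)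
      case (grun_nil q x)
      show ?case by (rule exI[of _ "[]"]) (use grun_nil in \<open>simp add: fine_path.fine_nil\<close>)
    next
      case (grun_eps p m q x w q' y n)
      obtain xs where xs: "fine_path (\<Delta>1 \<union> \<Delta>2) (q, []) xs (lab None) (p, [])" "set xs \<subseteq> M" "?v xs = m"
        using one_step[OF grun_eps(1)] by blast
      have m: "m \<in> carrier G" using valid_gaut_transD[OF A grun_eps(1)] by blast
      obtain ys where ys: "fine_path (\<Delta>1 \<union> \<Delta>2) (p, []) ys w (q', [])" "set ys \<subseteq> M" "y = x \<otimes> m \<otimes> ?v ys"
        using grun_eps m by auto
      have "?v (xs @ ys) = m \<otimes> ?v ys" using xs ys MK word_prod_append[of xs ys "\<lambda>x. x"] by auto
      moreover have "?v ys \<in> carrier G" using ys(2) MK by (intro word_prod_closed) auto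
      ultimately have "y = x \<otimes> ?v (xs @ ys)" using ys(3) m grun_eps.prems by (simp add: m_assoc)
      with fine_path_append[OF xs(1) ys(1)] xs(2) ys(2) show ?case
        by (intro exI[of _ "xs @ ys"]) (simp add: lab_def)
    next
      case (grun_sym p m q a x w q' y n)
      obtain xs where xs: "fine_path (\<Delta>1 \<union> \<Delta>2) (q, []) xs (lab (Some a)) (p, [])" "set xs \<subseteq> M" "?v xs = m"
        using one_step[OF grun_sym(1)] by blast
      have m: "m \<in> carrier G" using valid_gaut_transD[OF A grun_sym(1)] by blast
      obtain ys where ys: "fine_path (\<Delta>1 \<union> \<Delta>2) (p, []) ys w (q', [])" "set ys \<subseteq> M" "y = x \<otimes> m \<otimes> ?v ys"
        using grun_sym m by auto
      have "?v (xs @ ys) = m \<otimes> ?v ys" using xs ys MK word_prod_append[of xs ys "\<lambda>x. x"] by auto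
      moreover have "?v ys \<in> carrier G" using ys(2) MK by (intro word_prod_closed) auto
      ultimately have "y = x \<otimes> ?v (xs @ ys)" using ys(3) m grun_sym.prems by (simp add: m_assoc)
      with fine_path_append[OF xs(1) ys(1)] xs(2) ys(2) show ?case
        by (intro exI[of _ "xs @ ys"]) (simp add: lab_def)
    qed
    then show ?thesis by blast
  qed
  \<comment> \<open>In state \<open>(p, ys)\<close> the refined path has still to emit
    \<open>ys\<close>, whereas the original automaton has already multiplied by the whole label. Its
    register is ahead by the value of \<open>ys\<close>, hence the factor
    \<open>?v (snd s)\<close>.\<close>
  have bwd: "\<exists>n. grun G A (fst s) (x \<otimes> ?v (snd s)) w f (x \<otimes> ?v xs) n"
    if "fine_path (\<Delta>1 \<union> \<Delta>2) s xs w t" "t = (f, [])" "s \<in> S" "x \<in> carrier G" for s xs w t f x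
    using that
  proof (induction arbitrary: x rule: fine_path.induct)
    case (fine_nil s)
    then show ?case by (auto intro: grun.intros)
  next
    case (fine_step s u z r xs w t)
    have rS: "r \<in> S" "z \<in> M" using \<Delta>S[OF fine_step.hyps(1)] by auto
    have path: "set xs \<subseteq> M"
      using fine_step.hyps(2) by (induction rule: fine_path.induct) (use \<Delta>S in auto)
    have c: "?v xs \<in> carrier G" using path MK by (intro word_prod_closed) auto
    from fine_step.hyps(1) show ?case
    proof
      assume "(s, u, z, r) \<in> \<Delta>1"
      then obtain q a p m where *: "s = (q, [])" "u = lab a" "z = \<one>" "r = (p, dec m)" "(p, m) \<in> trans A q a"
        unfolding \<Delta>1_def by blast
      have m: "m \<in> carrier G" using valid_gaut_transD[OF A *(5)] by blast
      obtain n where "grun G A p (x \<otimes> m) w f (x \<otimes> ?v xs) n"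
        using fine_step.IH[OF fine_step.prems(1) rS(1) fine_step.prems(3)] *(4) dec[OF m] by auto
      then have "grun G A q x (lab a @ w) f (x \<otimes> ?v xs) (Suc n)"
        using *(5) by (cases a) (auto simp: lab_def intro: grun.intros)
      then show ?thesis using * c fine_step.prems by auto
    next
      assume "(s, u, z, r) \<in> \<Delta>2"
      then obtain p ys where *: "s = (p, z # ys)" "u = []" "r = (p, ys)" unfolding \<Delta>2_def by blast
      have zc: "z \<in> carrier G" using rS MK by blast
      have ysc: "?v ys \<in> carrier G"
        using D rS *(3) MK unfolding S_def by (intro word_prod_closed) auto
      obtain n where "grun G A p (x \<otimes> z \<otimes> ?v ys) w f (x \<otimes> z \<otimes> ?v xs) n"
        using fine_step.IH[OF fine_step.prems(1) rS(1), of "x \<otimes> z"] *(3) zc fine_step.prems by auto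
      then show ?thesis using * c zc ysc fine_step.prems by (auto simp: m_assoc)
    qed
  qed
  have "gaut_lang G A = {w. \<exists>f\<in>F. \<exists>xs. fine_path (\<Delta>1 \<union> \<Delta>2) (init A, []) xs w f \<and> ?v xs = \<one>}"
  proof
    show "gaut_lang G A \<subseteq> {w. \<exists>f\<in>F. \<exists>xs. fine_path (\<Delta>1 \<union> \<Delta>2) (init A, []) xs w f \<and> ?v xs = \<one>}"
    proof
      fix w assume "w \<in> gaut_lang G A"
      then obtain q n where q: "q \<in> accst A" "grun G A (init A) \<one> w q \<one> n"
        unfolding gaut_lang_def accepts_in_def by blast
      obtain xs where xs: "fine_path (\<Delta>1 \<union> \<Delta>2) (init A, []) xs w (q, [])" "\<one> = \<one> \<otimes> ?v xs"
        using fwd[OF q(2)] by auto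
      have "set xs \<subseteq> M"
        using xs(1) by (induction rule: fine_path.induct) (use \<Delta>S in auto)
      then have "?v xs \<in> carrier G" using MK by (intro word_prod_closed) auto
      then have "?v xs = \<one>" using xs(2) by simp
      with xs(1) q(1) show "w \<in> {w. \<exists>f\<in>F. \<exists>xs. fine_path (\<Delta>1 \<union> \<Delta>2) (init A, []) xs w f \<and> ?v xs = \<one>}"
        unfolding F_def by blast
    qed
    show "{w. \<exists>f\<in>F. \<exists>xs. fine_path (\<Delta>1 \<union> \<Delta>2) (init A, []) xs w f \<and> ?v xs = \<one>} \<subseteq> gaut_lang G A"
    proof
      fix w assume "w \<in> {w. \<exists>f\<in>F. \<exists>xs. fine_path (\<Delta>1 \<union> \<Delta>2) (init A, []) xs w f \<and> ?v xs = \<one>}"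
      then obtain q xs where xs: "q \<in> accst A" "fine_path (\<Delta>1 \<union> \<Delta>2) (init A, []) xs w (q, [])" "?v xs = \<one>"
        unfolding F_def by blast
      from bwd[OF xs(2) refl F(1) one_closed] xs(3) obtain n where "grun G A (init A) \<one> w q \<one> n" by auto
      with xs(1) show "w \<in> gaut_lang G A" unfolding gaut_lang_def accepts_in_def by blast
    qed
  qed
  moreover have "{w. \<exists>f\<in>F. \<exists>xs. fine_path (\<Delta>1 \<union> \<Delta>2) (init A, []) xs w f \<and> ?v xs = \<one>} \<in> CF"
    by (rule fine_path_lang_CF[OF G K _ M(1) split fin(1) fin\<Delta> \<Delta>S F]) (use M in auto)
  ultimately show ?thesis by simp
qed

section \<open>The Farey tessellation\<close>

lemma SL2Z_simps: "A \<in> carrier SL2Z \<longleftrightarrow> det A = 1" "A \<otimes>\<^bsub>SL2Z\<^esub> B = A ** B" "\<one>\<^bsub>SL2Z\<^esub> = mat2 1 0 0 1"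
  by (simp_all add: SL2Z_def mat_1_mat2)

lemma mat2_in_SL2Z: "mat2 a b c d \<in> carrier SL2Z \<longleftrightarrow> a * d - b * c = 1"
  by (simp add: SL2Z_simps)

text \<open>The columns of a matrix in \<open>SL(2,\<int>)\<close>, read as slopes, are the end points of an edge of the
Farey tessellation. The matrices in \<open>farey_base\<close> give the edge from \<open>0\<close> to \<open>\<infinity>\<close>,
\<open>farey_pos\<close> and \<open>farey_neg\<close> describe its two sides, and \<open>farey_near\<close> gives the edges of the two
triangles that contain it.\<close>
definition farey_pos :: "int ^ 2 ^ 2 \<Rightarrow> bool" where
  "farey_pos A \<longleftrightarrow> A $ 1 $ 1 * A $ 2 $ 1 \<ge> 0 \<and> A $ 1 $ 2 * A $ 2 $ 2 \<ge> 0"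

definition farey_neg :: "int ^ 2 ^ 2 \<Rightarrow> bool" where
  "farey_neg A \<longleftrightarrow> A $ 1 $ 1 * A $ 2 $ 1 \<le> 0 \<and> A $ 1 $ 2 * A $ 2 $ 2 \<le> 0"

definition farey_base :: "(int ^ 2 ^ 2) set" where
  "farey_base = {mat2 1 0 0 1, mat2 (-1) 0 0 (-1), mat2 0 1 (-1) 0, mat2 0 (-1) 1 0}"

definition farey_near :: "(int ^ 2 ^ 2) set" where
  "farey_near = {mat2 a b c d | a b c d. a \<in> {-1, 0, 1} \<and> b \<in> {-1, 0, 1} \<and> c \<in> {-1, 0, 1} \<and> d \<in> {-1, 0, 1}
     \<and> a * d - b * c = 1}"

text \<open>Multiplication on the right by an element of \<open>farey_base\<close> keeps the edge
  and only reorders its end points or changes their signs. The other four matrices replace one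
  column by the sum or a difference of both, that is, they pass to an edge of a common
  triangle.\<close>

definition farey_gens :: "(int ^ 2 ^ 2) set" where
  "farey_gens = farey_base \<union> {mat2 1 1 0 1, mat2 1 (-1) 0 1, mat2 1 0 1 1, mat2 1 0 (-1) 1}"

lemma finite_farey_near: "finite farey_near"
proof (rule finite_subset)
  let ?I = "{-1, 0, 1 :: int}"
  show "farey_near \<subseteq> (\<lambda>(a, b, c, d). mat2 a b c d) ` (?I \<times> ?I \<times> ?I \<times> ?I)"
  proof
    fix A assume "A \<in> farey_near"
    then obtain a b c d where "A = mat2 a b c d" "(a, b, c, d) \<in> ?I \<times> ?I \<times> ?I \<times> ?I"
      unfolding farey_near_def by blast
    then show "A \<in> (\<lambda>(a, b, c, d). mat2 a b c d) ` (?I \<times> ?I \<times> ?I \<times> ?I)"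
      by (intro image_eqI[of _ _ "(a, b, c, d)"]) simp_all
  qed
qed simp

lemma farey_near_SL2Z: "farey_near \<subseteq> carrier SL2Z"
  unfolding farey_near_def by (auto simp: mat2_in_SL2Z)

lemma farey_gens_near: "farey_gens \<subseteq> farey_near"
  unfolding farey_gens_def farey_base_def farey_near_def by auto

lemma farey_base_near: "farey_base \<subseteq> farey_near"
  using farey_gens_near unfolding farey_gens_def by blast

text \<open>With \<open>m = b * c\<close> the determinant gives \<open>a * d = m + 1\<close>, so
  \<open>(a * c) * (b * d) = m * (m + 1)\<close>. This is nonnegative for an integer
  \<open>m\<close>: no edge joins points strictly on opposite sides of the base edge.\<close>

lemma farey_pos_or_neg:
  assumes "A \<in> carrier SL2Z"
  shows "farey_pos A \<or> farey_neg A"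
proof (cases A rule: mat2_cases)
  case (1 a b c d)
  have det: "a * d = 1 + b * c" using assms 1 by (simp add: mat2_in_SL2Z)
  have prod: "(a * c) * (b * d) = (b * c) * (1 + b * c)" by (simp add: det[symmetric] algebra_simps)
  have "0 \<le> m * (1 + m)" for m :: int
  proof (cases "m \<ge> 0")
    case False
    then show ?thesis by (intro mult_nonpos_nonpos) linarith+
  qed simp
  then have "0 \<le> (b * c) * (1 + b * c)" .
  then have "0 \<le> (a * c) * (b * d)" by (simp only: prod)
  then show ?thesis unfolding 1 farey_pos_def farey_neg_def mat2_nth zero_le_mult_iff by blast
qed

lemma farey_base_sides: "A \<in> farey_base \<Longrightarrow> farey_pos A \<and> farey_neg A"
  unfolding farey_base_def by (elim insertE emptyE) (simp_all add: farey_pos_def farey_neg_def)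

lemma farey_baseI:
  fixes a b c d :: int
  assumes "a * d - b * c = 1" "a * c = 0" "b * d = 0"
  shows "mat2 a b c d \<in> farey_base"
proof (cases "a = 0")
  case True
  then have "b * - c = 1" using assms(1) by simp
  then have "b = 1 \<and> - c = 1 \<or> b = -1 \<and> - c = -1" by (rule zmult_eq_1_iff[THEN iffD1])
  moreover from this have "d = 0" using assms(3) by auto
  ultimately show ?thesis using True by (auto simp: farey_base_def)
next
  case False
  then have "c = 0" using assms(2) by simp
  then have "a * d = 1" using assms(1) by simp
  then have "a = 1 \<and> d = 1 \<or> a = -1 \<and> d = -1" by (rule zmult_eq_1_iff[THEN iffD1])
  moreover from this have "b = 0" using assms(3) by auto
  ultimately show ?thesis using \<open>c = 0\<close> by (auto simp: farey_base_def)
qed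

text \<open>With \<open>p = a c\<close>, \<open>q = b d\<close> and \<open>m = b c\<close> the determinant condition gives
\<open>p q = m (m + 1)\<close>, so that \<open>p + q\<close> can be smaller than \<open>\<bar>2 m + 1\<bar>\<close> only if \<open>p = q = 0\<close>.\<close>
lemma farey_step_aux:
  fixes a b c d :: int
  assumes "a * d - b * c = 1" "a * c \<ge> 0" "b * d \<ge> 0" "a * c \<noteq> 0 \<or> b * d \<noteq> 0"
  shows "(a + b) * (c + d) \<ge> 0" "(a - b) * (c - d) \<ge> 0"
proof -
  define p q m where "p = a * c" and "q = b * d" and "m = b * c"
  have ad: "a * d = m + 1" using assms(1) by (simp add: m_def)
  have "p * q = (a * d) * (b * c)" by (simp only: p_def q_def mult_ac)
  then have pq: "p * q = (m + 1) * m" by (simp add: ad m_def)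
  have "p \<ge> 0" "q \<ge> 0" "p \<noteq> 0 \<or> q \<noteq> 0" using assms(2-4) by (simp_all only: p_def q_def)
  then have pos: "p \<ge> 0" "q \<ge> 0" "p + q \<ge> 1" by presburger+
  have "(p + q)^2 \<ge> (2 * m + 1)^2 - 1"
  proof -
    have "(p + q)^2 - (2 * m + 1)^2 + 1 = (p - q)^2"
      using pq by (simp add: power2_eq_square algebra_simps)
    then show ?thesis using zero_le_power2[of "p - q"] by linarith
  qed
  \<comment> \<open>Integrality decides: if the claim failed, then
    \<open>(p + q + 1)^2 <= (2 * m + 1)^2 <= (p + q)^2 + 1\<close>, which contradicts
    \<open>p + q >= 1\<close>.\<close>
  have bound: "\<bar>2 * m + 1\<bar> \<le> p + q"
  proof (rule ccontr)
    assume "\<not> ?thesis"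
    then have "p + q + 1 \<le> \<bar>2 * m + 1\<bar>" by linarith
    then have "(p + q + 1)^2 \<le> \<bar>2 * m + 1\<bar>^2" using pos by (intro power_mono) auto
    then have "(p + q + 1)^2 \<le> (2 * m + 1)^2" by simp
    moreover have "(p + q + 1)^2 = (p + q)^2 + 2 * (p + q) + 1" by (simp add: power2_eq_square algebra_simps)
    moreover have False if "A \<le> B" "A = C + 2 * s + 1" "B - 1 \<le> C" "1 \<le> s" for A B C s :: int
      using that by linarith
    ultimately show False using \<open>(p + q)^2 \<ge> (2 * m + 1)^2 - 1\<close> pos(3) by blast
  qed
  have "(a + b) * (c + d) = p + q + (2 * m + 1)" "(a - b) * (c - d) = p + q - (2 * m + 1)"
    using ad by (simp_all add: p_def q_def m_def algebra_simps)
  then show "(a + b) * (c + d) \<ge> 0" "(a - b) * (c - d) \<ge> 0" using bound by linarith+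
qed

text \<open>Both triangles at an edge other than the base edge lie on the side of that edge. The new
  end points produced by a generator are the sum and difference of the columns, which
  \<open>farey_step_aux\<close> keeps on this side.\<close>

lemma farey_pos_step:
  assumes "A \<in> carrier SL2Z" "farey_pos A" "A \<notin> farey_base" "x \<in> farey_gens"
  shows "farey_pos (A ** x)"
proof (cases A rule: mat2_cases)
  case (1 a b c d)
  have *: "a * d - b * c = 1" "a * c \<ge> 0" "b * d \<ge> 0"
    using assms(1,2) 1 by (auto simp: mat2_in_SL2Z farey_pos_def)
  then have "a * c \<noteq> 0 \<or> b * d \<noteq> 0" using assms(3) 1 farey_baseI by blast
  note ** = farey_step_aux[OF * this]
  have "(b - a) * (d - c) = (a - b) * (c - d)" by (simp add: algebra_simps)
  with ** * assms(4) show ?thesis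
    unfolding 1 farey_gens_def farey_base_def Un_iff
    by (elim disjE insertE emptyE) (simp_all add: farey_pos_def)
qed

lemma farey_neg_step:
  assumes "A \<in> carrier SL2Z" "farey_neg A" "A \<notin> farey_base" "x \<in> farey_gens"
  shows "farey_neg (A ** x)"
proof (cases A rule: mat2_cases)
  case (1 a b c d)
  \<comment> \<open>Negating \<open>b\<close> and \<open>c\<close> is conjugation by the diagonal
    matrix with entries 1 and -1. It negates all slopes and so exchanges the two sides, which
    reduces the claim to \<open>farey_step_aux\<close>.\<close>
  have *: "a * d - (- b) * (- c) = 1" "a * (- c) \<ge> 0" "(- b) * d \<ge> 0"
    using assms(1,2) 1 by (auto simp: mat2_in_SL2Z farey_neg_def)
  then have "a * (- c) \<noteq> 0 \<or> (- b) * d \<noteq> 0" using assms(3) 1 farey_baseI[of a d b c] by auto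
  note ** = farey_step_aux[OF * this]
  have eqs: "(a + - b) * (- c + d) = - ((a - b) * (c - d))" "(a - - b) * (- c - d) = - ((a + b) * (c + d))"
    "(b - a) * (d - c) = (a - b) * (c - d)" by (simp_all add: algebra_simps)
  have "(a - b) * (c - d) \<le> 0" "(a + b) * (c + d) \<le> 0" "a * c \<le> 0" "b * d \<le> 0"
    using ** * unfolding eqs by simp_all
  with eqs(3) assms(4) show ?thesis
    unfolding 1 farey_gens_def farey_base_def Un_iff
    by (elim disjE insertE emptyE) (simp_all add: farey_neg_def)
qed

text \<open>The entries of the inverse of \<open>A\<close> times \<open>B\<close> are, up to sign,
  determinants of a column of \<open>A\<close> with a column of \<open>B\<close>. On one side the
  slopes are among 0, infinity and a single one of 1 and -1, so these determinants are at most 1 in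
  absolute value; only the slopes 1 and -1 together would give 2.\<close>

lemma farey_near_quotient:
  assumes "A \<in> farey_near" "B \<in> farey_near" "farey_pos A \<and> farey_pos B \<or> farey_neg A \<and> farey_neg B"
    and "A ** C = B" "C \<in> carrier SL2Z"
  shows "C \<in> farey_near"
proof -
  have small: "p * s - q * r \<in> {-1, 0, 1}"
    if "p \<in> {-1, 0, 1}" "q \<in> {-1, 0, 1}" "r \<in> {-1, 0, 1}" "s \<in> {-1, 0, 1}"
      "p * q \<ge> 0 \<and> r * s \<ge> 0 \<or> p * q \<le> 0 \<and> r * s \<le> 0" for p q r s :: int
    using that by auto
  obtain a b c d where A: "A = mat2 a b c d" "a \<in> {-1, 0, 1}" "b \<in> {-1, 0, 1}" "c \<in> {-1, 0, 1}" "d \<in> {-1, 0, 1}"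
    "a * d - b * c = 1" using assms(1) unfolding farey_near_def by blast
  obtain a' b' c' d' where B: "B = mat2 a' b' c' d'" "a' \<in> {-1, 0, 1}" "b' \<in> {-1, 0, 1}" "c' \<in> {-1, 0, 1}"
    "d' \<in> {-1, 0, 1}" "a' * d' - b' * c' = 1" using assms(2) unfolding farey_near_def by blast
  have sides: "a * c \<ge> 0 \<and> a' * c' \<ge> 0 \<or> a * c \<le> 0 \<and> a' * c' \<le> 0"
    "a * c \<ge> 0 \<and> b' * d' \<ge> 0 \<or> a * c \<le> 0 \<and> b' * d' \<le> 0"
    "b * d \<ge> 0 \<and> a' * c' \<ge> 0 \<or> b * d \<le> 0 \<and> a' * c' \<le> 0"
    "b * d \<ge> 0 \<and> b' * d' \<ge> 0 \<or> b * d \<le> 0 \<and> b' * d' \<le> 0"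
    using assms(3) unfolding A(1) B(1) farey_pos_def farey_neg_def by auto
  have inv: "mat2 d (- b) (- c) a ** A = mat2 1 0 0 1"
    using A(6) by (simp add: A(1) algebra_simps)
  have "C = (mat2 d (- b) (- c) a ** A) ** C" unfolding inv mat_1_mat2[symmetric] by simp
  also have "\<dots> = mat2 d (- b) (- c) a ** B" unfolding assms(4)[symmetric] by (simp add: matrix_mul_assoc)
  finally have C: "C = mat2 (- (b * c' - d * a')) (- (b * d' - d * b')) (a * c' - c * a') (a * d' - c * b')"
    unfolding B(1) by (simp add: algebra_simps)
  have neg: "- x \<in> {-1, 0, 1}" if "x \<in> {-1, 0, 1}" for x :: int using that by auto
  have "- (b * c' - d * a') \<in> {-1, 0, 1}" "- (b * d' - d * b') \<in> {-1, 0, 1}"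
    "a * c' - c * a' \<in> {-1, 0, 1}" "a * d' - c * b' \<in> {-1, 0, 1}"
    by (intro neg small A B sides)+
  moreover have "- (b * c' - d * a') * (a * d' - c * b') - - (b * d' - d * b') * (a * c' - c * a') = 1"
    using assms(5) unfolding C mat2_in_SL2Z .
  ultimately show ?thesis unfolding farey_near_def C by blast
qed

section \<open>Paths in the Farey tessellation and their splitting\<close>

abbreviation mat_prod :: "(int ^ 2 ^ 2) list \<Rightarrow> int ^ 2 ^ 2" where
  "mat_prod \<equiv> word_prod SL2Z (\<lambda>x. x)"

lemma mat_prod_closed: "set xs \<subseteq> farey_gens \<Longrightarrow> mat_prod xs \<in> carrier SL2Z"
  using farey_gens_near farey_near_SL2Z by (intro monoid.word_prod_closed[OF monoid_SL2Z]) blast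

lemma mat_prod_append:
  "set xs \<subseteq> farey_gens \<Longrightarrow> set ys \<subseteq> farey_gens \<Longrightarrow> mat_prod (xs @ ys) = mat_prod xs ** mat_prod ys"
  using farey_gens_near farey_near_SL2Z
  by (subst monoid.word_prod_append[OF monoid_SL2Z]) (auto simp: SL2Z_simps(2))

text \<open>The side can change only in a step that starts at the base edge. The end of the path is
  exempt from avoiding the base edge, since no step starts there.\<close>

lemma farey_side_preserved:
  assumes "set xs \<subseteq> farey_gens" "A \<in> carrier SL2Z" "A \<notin> farey_base"
    "\<And>us vs. xs = us @ vs \<Longrightarrow> us \<noteq> [] \<Longrightarrow> vs \<noteq> [] \<Longrightarrow> A ** mat_prod us \<notin> farey_base"
  shows "(farey_pos A \<longrightarrow> farey_pos (A ** mat_prod xs)) \<and> (farey_neg A \<longrightarrow> farey_neg (A ** mat_prod xs))"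
  using assms
proof (induction xs arbitrary: A)
  case Nil
  then show ?case by (simp add: SL2Z_simps(3) flip: mat_1_mat2)
next
  case (Cons x xs)
  have x: "x \<in> farey_gens" using Cons.prems(1) by simp
  have Ax: "A ** x \<in> carrier SL2Z"
    using monoid.m_closed[OF monoid_SL2Z Cons.prems(2), of x] x farey_gens_near farey_near_SL2Z
    by (auto simp: SL2Z_simps(2))
  have assoc: "A ** mat_prod (x # us) = A ** x ** mat_prod us" for us
    by (simp add: SL2Z_simps(2) matrix_mul_assoc)
  have step: "farey_pos A \<longrightarrow> farey_pos (A ** x)" "farey_neg A \<longrightarrow> farey_neg (A ** x)"
    using farey_pos_step farey_neg_step Cons.prems(2,3) x by blast+
  show ?case
  proof (cases "xs = []")
    case True
    have "A ** mat_prod (x # xs) = A ** x"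
      unfolding assoc True by (simp add: SL2Z_simps(3) flip: mat_1_mat2)
    then show ?thesis using step by simp
  next
    case False
    have "A ** x = A ** mat_prod [x]" by (simp add: SL2Z_simps(2,3) flip: mat_1_mat2)
    moreover have "A ** mat_prod [x] \<notin> farey_base"
      by (rule Cons.prems(4)[of "[x]" xs]) (use False in auto)
    ultimately have "A ** x \<notin> farey_base" by simp
    moreover have "A ** x ** mat_prod us \<notin> farey_base" if "xs = us @ vs" "us \<noteq> []" "vs \<noteq> []" for us vs
      using Cons.prems(4)[of "x # us" vs] that unfolding assoc by simp
    ultimately show ?thesis
      using Cons.IH[of "A ** x"] Cons.prems(1) Ax step unfolding assoc by auto
  qed
qed

text \<open>If a proper nonempty prefix ends in \<open>farey_base\<close>, the path is cut there;
  the base edge counts for both sides, so the rest joins two near edges on a common side. Otherwise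
  the path stays on one side after its first step, and cutting off this step leaves a path between
  two near edges on that side. \<open>farey_near_quotient\<close> bounds the rest in both
  cases.\<close>

lemma farey_split:
  assumes "set xs \<subseteq> farey_gens" "2 \<le> length xs" "mat_prod xs \<in> farey_near"
  shows "\<exists>us vs. xs = us @ vs \<and> us \<noteq> [] \<and> vs \<noteq> [] \<and> mat_prod us \<in> farey_near \<and> mat_prod vs \<in> farey_near"
proof (cases "\<exists>us vs. xs = us @ vs \<and> us \<noteq> [] \<and> vs \<noteq> [] \<and> mat_prod us \<in> farey_base")
  case True
  then obtain us vs where uv: "xs = us @ vs" "us \<noteq> []" "vs \<noteq> []" "mat_prod us \<in> farey_base" by blast
  have prod: "mat_prod us ** mat_prod vs = mat_prod xs"
    using mat_prod_append assms(1) uv(1) by simp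
  have "farey_pos (mat_prod us) \<and> farey_neg (mat_prod us)" by (rule farey_base_sides[OF uv(4)])
  moreover have "farey_pos (mat_prod xs) \<or> farey_neg (mat_prod xs)"
    using farey_pos_or_neg mat_prod_closed assms(1) by blast
  moreover have us: "mat_prod us \<in> farey_near" using uv(4) farey_base_near by blast
  moreover have "mat_prod vs \<in> carrier SL2Z" using mat_prod_closed assms(1) uv(1) by simp
  ultimately have "mat_prod vs \<in> farey_near" using farey_near_quotient[OF us assms(3) _ prod] by blast
  with us uv show ?thesis by blast
next
  case False
  obtain x ys where x: "xs = x # ys" using assms(2) by (cases xs) auto
  have ys: "ys \<noteq> []" using assms(2) x by auto
  have mx: "mat_prod [x] = x" by (simp add: SL2Z_simps(2,3) flip: mat_1_mat2)
  have xg: "x \<in> farey_gens" "x \<in> farey_near" using assms(1) x farey_gens_near by auto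
  then have xc: "x \<in> carrier SL2Z" using farey_near_SL2Z by blast
  have prod: "x ** mat_prod us = mat_prod (x # us)" for us by (simp add: SL2Z_simps(2))
  have "x \<notin> farey_base" using False[simplified, rule_format, of "[x]" ys] x ys mx by auto
  moreover have "x ** mat_prod us \<notin> farey_base" if "ys = us @ vs" "us \<noteq> []" "vs \<noteq> []" for us vs
    unfolding prod using False that x by (metis append_Cons list.distinct(1))
  ultimately have "(farey_pos x \<longrightarrow> farey_pos (x ** mat_prod ys)) \<and> (farey_neg x \<longrightarrow> farey_neg (x ** mat_prod ys))"
    using farey_side_preserved[of ys x] assms(1) x xc by simp
  then have "farey_pos x \<and> farey_pos (mat_prod xs) \<or> farey_neg x \<and> farey_neg (mat_prod xs)"
    using farey_pos_or_neg[OF xc] prod x by auto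
  moreover have "mat_prod ys \<in> carrier SL2Z" using mat_prod_closed assms(1) x by simp
  ultimately have "mat_prod ys \<in> farey_near"
    using farey_near_quotient[OF xg(2) assms(3)] prod x by blast
  moreover have "xs = [x] @ ys" using x by simp
  moreover have "mat_prod [x] \<in> farey_near" using mx xg(2) by simp
  ultimately show ?thesis using ys by blast
qed

text \<open>Column operations run the Euclidean algorithm on the first row: if both entries are
  nonzero, one of the four operations decreases \<open>\<bar>a\<bar> + \<bar>b\<bar>\<close>. A row
  with a zero entry leaves an element of \<open>farey_base\<close> times a triangular
  matrix.\<close>

lemma SL2Z_generated:
  assumes "A \<in> carrier SL2Z"
  shows "\<exists>xs. set xs \<subseteq> farey_gens \<and> mat_prod xs = A"
proof -
  define gen where "gen A \<longleftrightarrow> (\<exists>xs. set xs \<subseteq> farey_gens \<and> mat_prod xs = A)" for A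
  have gen_mult: "gen (A ** B)" if "gen A" "gen B" for A B
  proof -
    from that obtain xs ys where "set xs \<subseteq> farey_gens" "mat_prod xs = A" "set ys \<subseteq> farey_gens" "mat_prod ys = B"
      unfolding gen_def by blast
    then have "set (xs @ ys) \<subseteq> farey_gens \<and> mat_prod (xs @ ys) = A ** B" by (simp add: mat_prod_append)
    then show ?thesis unfolding gen_def by blast
  qed
  have gen_gens: "gen x" if "x \<in> farey_gens" for x
    unfolding gen_def
    by (rule exI[of _ "[x]"]) (use that in \<open>simp add: SL2Z_simps(2,3) flip: mat_1_mat2\<close>)
  have base: "gen (mat2 1 0 0 1)" "gen (mat2 (-1) 0 0 (-1))" "gen (mat2 0 1 (-1) 0)" "gen (mat2 0 (-1) 1 0)"
    "gen (mat2 1 1 0 1)" "gen (mat2 1 (-1) 0 1)" "gen (mat2 1 0 1 1)" "gen (mat2 1 0 (-1) 1)"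
    by (intro gen_gens; simp add: farey_gens_def farey_base_def)+
  have lower: "gen (mat2 1 0 j 1)" for j
  proof (induction j rule: int_induct[of _ 0])
    case (step1 i)
    then show ?case using gen_mult[OF step1(2) base(7)] by simp
  next
    case (step2 i)
    then show ?case using gen_mult[OF step2(2) base(8)] by simp
  qed (rule base(1))
  have upper: "gen (mat2 1 j 0 1)" for j
  proof (induction j rule: int_induct[of _ 0])
    case (step1 i)
    then show ?case using gen_mult[OF step1(2) base(5)] by (simp add: add.commute)
  next
    case (step2 i)
    then show ?case using gen_mult[OF step2(2) base(6)] by simp
  qed (rule base(1))
  have main: "gen (mat2 a b c d)" if "a * d - b * c = 1" for a b c d
    using that
  proof (induction "nat (\<bar>a\<bar> + \<bar>b\<bar>)" arbitrary: a b c d rule: less_induct)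
    case less
    consider "a = 0" | "b = 0" | "a \<noteq> 0" "b \<noteq> 0" by blast
    then show ?case
    proof cases
      case 1
      then have "b * - c = 1" using less.prems by simp
      then have "b = 1 \<and> - c = 1 \<or> b = -1 \<and> - c = -1" by (rule zmult_eq_1_iff[THEN iffD1])
      then have "b = 1 \<and> c = -1 \<or> b = -1 \<and> c = 1" by auto
      then show ?thesis
        using gen_mult[OF base(3) upper[of "- d"]] gen_mult[OF base(4) upper[of d]] 1 by auto
    next
      case 2
      then have "a * d = 1" using less.prems by simp
      then have "a = 1 \<and> d = 1 \<or> a = -1 \<and> d = -1" by (rule zmult_eq_1_iff[THEN iffD1])
      then show ?thesis
        using gen_mult[OF base(1) lower[of c]] gen_mult[OF base(2) lower[of "- c"]] 2 by auto
    next
      case 3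
      have red: "gen (mat2 (a - b) b (c - d) d) \<Longrightarrow> gen (mat2 a b c d)"
        "gen (mat2 (a + b) b (c + d) d) \<Longrightarrow> gen (mat2 a b c d)"
        "gen (mat2 a (b - a) c (d - c)) \<Longrightarrow> gen (mat2 a b c d)"
        "gen (mat2 a (b + a) c (d + c)) \<Longrightarrow> gen (mat2 a b c d)"
        using gen_mult[OF _ base(7), of "mat2 (a - b) b (c - d) d"]
          gen_mult[OF _ base(8), of "mat2 (a + b) b (c + d) d"]
          gen_mult[OF _ base(5), of "mat2 a (b - a) c (d - c)"]
          gen_mult[OF _ base(6), of "mat2 a (b + a) c (d + c)"] by simp_all
      have dets: "(a - b) * d - b * (c - d) = 1" "(a + b) * d - b * (c + d) = 1"
        "a * (d - c) - (b - a) * c = 1" "a * (d + c) - (b + a) * c = 1"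
        using less.prems by (simp_all add: algebra_simps)
      have "\<bar>a - b\<bar> + \<bar>b\<bar> < \<bar>a\<bar> + \<bar>b\<bar> \<or> \<bar>a + b\<bar> + \<bar>b\<bar> < \<bar>a\<bar> + \<bar>b\<bar> \<or>
          \<bar>a\<bar> + \<bar>b - a\<bar> < \<bar>a\<bar> + \<bar>b\<bar> \<or> \<bar>a\<bar> + \<bar>b + a\<bar> < \<bar>a\<bar> + \<bar>b\<bar>"
        using 3 by linarith
      then show ?thesis
        using less.hyps[of "a - b" b d "c - d"] less.hyps[of "a + b" b d "c + d"]
          less.hyps[of a "b - a" "d - c" c] less.hyps[of a "b + a" "d + c" c] dets red
        by (auto simp: nat_less_eq_zless)
    qed
  qed
  show ?thesis
    using assms main unfolding gen_def by (cases A rule: mat2_cases) (auto simp: mat2_in_SL2Z)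
qed

lemma Lw_lin_SL2Z_subset_CF: "Lw_lin SL2Z \<subseteq> CF"
proof
  fix L assume "L \<in> Lw_lin SL2Z"
  then obtain A :: "(nat, int ^ 2 ^ 2) gaut" and C where A: "valid_gaut SL2Z A" "gaut_lang SL2Z A = L"
    by (rule Lw_linE) blast
  have "gaut_lang SL2Z A \<in> CF"
    by (rule gaut_lang_CF[OF monoid_SL2Z finite_farey_near farey_near_SL2Z farey_gens_near _
          farey_split SL2Z_generated A(1)])
       (auto simp: SL2Z_simps(3) farey_gens_def farey_base_def)
  then show "L \<in> CF" using A(2) by simp
qed

lemma Lw_lin_SL2Z_psubset_SL3Z: "Lw_lin SL2Z \<subset> Lw_lin SL3Z"
  using Lw_lin_SL2Z_subset_SL3Z Lw_lin_SL2Z_subset_CF abc_lang_not_CF abc_lang_Zk2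
    Lw_lin_Zk2_subset_SL3Z by blast

theorem theorem4p16:
  shows "Lw_lin Qpos_group \<subset> Lw_lin SL2Q
     \<and> (Lw_lin integer_group \<subset> Lw_lin BS12 \<and> \<not> Lw_lin BS12 \<subseteq> CF)
     \<and> Lw_lin SL2Z \<subset> Lw_lin SL3Z
     \<and> Lw_lin (Zk 2) \<subset> Lw_lin Heis
     \<and> (\<forall>k\<ge>2. \<not> CF \<subseteq> Lw_lin (Zk k) \<and> \<not> Lw_lin (Zk k) \<subseteq> CF)
     \<and> Lw_lin SL3Z = Lw_lin GL3Z
     \<and> (REG = Lw_lin (free_group 0) \<and> Lw_lin (free_group 0) \<subset> Lw_lin (free_group 1)
        \<and> Lw_lin (free_group 1) = Lw_lin integer_group
        \<and> Lw_lin integer_group \<subset> Lw_lin (free_group 2))"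
proof (intro conjI allI impI)
  show "Lw_lin Qpos_group \<subset> Lw_lin SL2Q" by (rule Lw_lin_Qpos_psubset_SL2Q)
  show "Lw_lin integer_group \<subset> Lw_lin BS12" by (rule Lw_lin_integer_group_psubset_BS12)
  show "\<not> Lw_lin BS12 \<subseteq> CF" using exp_lang_BS12 exp_lang_not_CF by blast
  show "Lw_lin SL2Z \<subset> Lw_lin SL3Z" by (rule Lw_lin_SL2Z_psubset_SL3Z)
  show "Lw_lin (Zk 2) \<subset> Lw_lin Heis" by (rule Lw_lin_Zk2_psubset_Heis)
  show "\<not> CF \<subseteq> Lw_lin (Zk k)" "\<not> Lw_lin (Zk k) \<subseteq> CF" if "2 \<le> k" for k
    by (rule CF_Zk_incomparable[OF that])+
  show "Lw_lin SL3Z = Lw_lin GL3Z" by (rule Lw_lin_SL3Z_eq_GL3Z)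
  show "REG = Lw_lin (free_group 0)"
    using REG_subset_Lw_lin_free_group_0 Lw_lin_free_group_0_subset_REG by (rule equalityI)
  show "Lw_lin (free_group 0) \<subset> Lw_lin (free_group 1)" by (rule Lw_lin_free_group_0_psubset_1)
  show "Lw_lin (free_group 1) = Lw_lin integer_group" by (rule Lw_lin_free_group_1)
  show "Lw_lin integer_group \<subset> Lw_lin (free_group 2)"
    by (rule Lw_lin_integer_group_psubset_free_group_2)
qed

end
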